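(* For real $\alpha$ with $\alpha>0$, $\alpha\neq\frac12$, define $$\varphi_1(\alpha)=\frac{\left|\alpha-\frac12\right|}{\pi}\int_{-\infty}^{\infty}\frac{\ln\left(\left|\zeta\left(\frac12+\alpha+it\right)\left(\left|\alpha-\frac12\right|+it\right)\right|\right)}{\left(\frac12-\alpha\right)^2+t^2}\,dt,$$ $$\varphi_2(\alpha)=\frac{\left|\alpha-\frac12\right|}{\pi}\int_{-\infty}^{\infty}\frac{\ln\left(\left|\zeta\left(\frac12+\alpha+it\right)\left(\left|\alpha-\frac12\right|+it\right)\right|\right)}{\left(\left(\frac12-\alpha\right)^2+t^2\right)^2}\,dt.$$ Then each of the following two statements (A) and (B) is equivalent to the Riemann Hypothesis. (A) For every $\alpha>0$ with $\alpha\ne\frac12$, $$\varphi_1(\alpha)=\begin{cases}0, & 0<\alpha<\frac12,\\[2pt] \ln\left(\zeta(2\alpha)(2\alpha-1)\right), & \alpha>\frac12.\end{cases}$$ (B) For every $\alpha>0$ with $\alpha\ne\frac12$, $$\varphi_2(\alpha)=\begin{cases}-\dfrac{\gamma}{2\left(\frac12-\alpha\right)}, & 0<\alpha<\frac12,\\[8pt] -\dfrac{1}{2\alpha-1}\left(\dfrac{\zeta'(2\alpha)}{\zeta(2\alpha)}+\dfrac{1}{2\alpha-1}\right)+\dfrac{\ln\left(\zeta(2\alpha)(2\alpha-1)\right)}{2\left(\alpha-\frac12\right)^2}, & \alpha>\frac12.\end{cases}$$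
   Context: $\zeta$ denotes the Riemann zeta function (meromorphically continued to $\mathbb{C}$), $\zeta'$ its derivative, $\gamma$ the Euler–Mascheroni constant, and $\ln$ the real natural logarithm. The Riemann Hypothesis is the statement that all zeros of $\zeta(s)$ with $0<\mathrm{Re}(s)<1$ satisfy $\mathrm{Re}(s)=\frac12$. The integrals are Lebesgue integrals over $t\in\mathbb{R}$. *)

theory Defs
  imports "HOL-Complex_Analysis.Complex_Analysis"
begin

text \<open>
  The Riemann zeta function is specified by its meromorphic continuation.  The theorem
  \<open>riemann_zeta_ex1\<close> below shows that the description is satisfied by exactly one function.
  The value at the pole \<open>s = 1\<close> is set to \<open>0\<close> by convention.
\<close>

definition is_riemann_zeta :: "(complex \<Rightarrow> complex) \<Rightarrow> bool" where
  "is_riemann_zeta f \<longleftrightarrow>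
     f holomorphic_on (- {1}) \<and>
     (\<forall>s. Re s > 1 \<longrightarrow> (\<lambda>n. of_nat (Suc n) powr (- s)) sums f s) \<and>
     f 1 = 0"

definition riemann_zeta :: "complex \<Rightarrow> complex" where
  "riemann_zeta = (THE f. is_riemann_zeta f)"

lemma holomorphic_on_suminf_local:
  fixes f :: "nat \<Rightarrow> complex \<Rightarrow> complex"
  assumes "open S" and "\<And>n. f n holomorphic_on S"
    and "\<And>x. x \<in> S \<Longrightarrow> \<exists>d>0. \<exists>M. cball x d \<subseteq> S \<and> summable M \<and>
           (\<forall>n. \<forall>y\<in>cball x d. norm (f n y) \<le> M n)"
  shows "(\<lambda>s. \<Sum>n. f n s) holomorphic_on S"
proof (rule holomorphic_uniform_sequence[OF assms(1)])
  show "(\<lambda>s. \<Sum>i<n. f i s) holomorphic_on S" for n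
    by (intro holomorphic_intros assms)
  fix x assume "x \<in> S"
  from assms(3)[OF this] obtain d M where dM: "d > 0" "cball x d \<subseteq> S" "summable M"
    "\<And>n y. y \<in> cball x d \<Longrightarrow> norm (f n y) \<le> M n" by blast
  have "uniform_limit (cball x d) (\<lambda>n s. \<Sum>i<n. f i s) (\<lambda>s. \<Sum>n. f n s) sequentially"
    using dM by (intro Weierstrass_m_test) auto
  with dM show "\<exists>d>0. cball x d \<subseteq> S \<and>
      uniform_limit (cball x d) (\<lambda>n s. \<Sum>i<n. f i s) (\<lambda>s. \<Sum>n. f n s) sequentially"
    by blast
qed

lemma norm_of_nat_powr:
  "norm (of_nat (Suc n) powr (s :: complex)) = real (Suc n) powr Re s"
  using norm_powr_real_powr[of "of_nat (Suc n)" s]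
  by (simp del: of_nat_Suc)

lemma summable_Suc_powr: "a < -1 \<Longrightarrow> summable (\<lambda>n. real (Suc n) powr a)"
  using summable_Suc_iff[of "\<lambda>n. real n powr a"] summable_real_powr_iff[of a] by simp

definition dirichlet_zeta :: "complex \<Rightarrow> complex" where
  "dirichlet_zeta s = (\<Sum>n. of_nat (Suc n) powr (- s))"

lemma dirichlet_zeta_sums:
  assumes "Re s > 1"
  shows "(\<lambda>n. of_nat (Suc n) powr (- s)) sums dirichlet_zeta s"
proof -
  have "summable (\<lambda>n. norm (of_nat (Suc n) powr (- s)))"
    unfolding norm_of_nat_powr using summable_Suc_powr[of "Re (-s)"] assms by simp
  from summable_sums[OF summable_norm_cancel[OF this]] show ?thesis
    by (simp add: dirichlet_zeta_def)
qed

lemma cball_Re: "(y :: complex) \<in> cball x d \<Longrightarrow> Re y \<ge> Re x - d"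
  using abs_Re_le_cmod[of "x - y"] by (simp add: dist_norm)

lemma open_Re_gt: "open {s. Re s > a}"
  by (simp add: open_halfspace_Re_gt)

lemma holomorphic_dirichlet_zeta: "dirichlet_zeta holomorphic_on {s. Re s > 1}"
  unfolding dirichlet_zeta_def[abs_def]
proof (rule holomorphic_on_suminf_local[OF open_Re_gt])
  show "(\<lambda>s. of_nat (Suc n) powr - s) holomorphic_on {s. 1 < Re s}" for n
    by (intro holomorphic_intros)
  fix x :: complex assume x: "x \<in> {s. 1 < Re s}"
  define d where "d = (Re x - 1) / 2"
  have d: "d > 0" "Re x - d > 1" using x by (auto simp: d_def field_simps)
  have "norm (of_nat (Suc n) powr (- y)) \<le> real (Suc n) powr (- (Re x - d))"
    if "y \<in> cball x d" for n y
    unfolding norm_of_nat_powr using cball_Re[OF that] by (intro powr_mono) auto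
  moreover have "summable (\<lambda>n. real (Suc n) powr (- (Re x - d)))"
    using d by (intro summable_Suc_powr) auto
  moreover have "cball x d \<subseteq> {s. 1 < Re s}"
    using cball_Re d by fastforce
  ultimately show "\<exists>d>0. \<exists>M. cball x d \<subseteq> {s. 1 < Re s} \<and> summable M \<and>
           (\<forall>n. \<forall>y\<in>cball x d. norm (of_nat (Suc n) powr (- y)) \<le> M n)"
    using d(1) by blast
qed

text \<open>
  The continuation is obtained by summing the Taylor expansions of \<open>(n + 1) powr (1 - s)\<close>
  at \<open>n\<close>, which expresses \<open>(s - 1) * \<zeta>(s)\<close> through its values at
  \<open>s + 1, s + 2, \<dots>\<close> and a remainder series.
\<close>

definition taylor_fact :: "nat \<Rightarrow> complex \<Rightarrow> complex" where
  "taylor_fact k s = (\<Prod>i<k. 1 - s - of_nat i)"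

definition taylor_rem :: "nat \<Rightarrow> nat \<Rightarrow> complex \<Rightarrow> complex" where
  "taylor_rem M n s = of_nat (Suc (Suc n)) powr (1 - s) -
     (\<Sum>k\<le>M. taylor_fact k s * of_nat (Suc n) powr (1 - s - of_nat k) / fact k)"

lemma taylor_rem_bound:
  assumes "Re s > - real M"
  shows "norm (taylor_rem M n s) \<le>
    norm (taylor_fact (Suc M) s) / fact M * real (Suc n) powr (- Re s - real M)"
proof -
  define S where "S = closed_segment (of_nat (Suc n)) (of_nat (Suc (Suc n)) :: complex)"
  define f where "f = (\<lambda>i x. taylor_fact i s * x powr (1 - s - of_nat i))"
  define B where "B = norm (taylor_fact (Suc M) s) * real (Suc n) powr (- Re s - real M)"
  have S: "x \<in> \<real> \<and> Re x \<ge> real (Suc n)" if "x \<in> S" for x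
  proof -
    from that obtain u where u: "0 \<le> u" "u \<le> 1"
      "x = (1 - u) *\<^sub>R of_nat (Suc n) + u *\<^sub>R of_nat (Suc (Suc n))"
      by (auto simp: S_def closed_segment_def)
    hence "x = complex_of_real (real (Suc n) + u)"
      by (simp add: complex_eq_iff algebra_simps)
    thus ?thesis using u by auto
  qed
  have "norm (f 0 (of_nat (Suc (Suc n))) - (\<Sum>i\<le>M. f i (of_nat (Suc n)) *
          (of_nat (Suc (Suc n)) - of_nat (Suc n)) ^ i / fact i))
        \<le> B * norm (of_nat (Suc (Suc n)) - of_nat (Suc n) :: complex) ^ Suc M / fact M"
  proof (rule complex_Taylor[where S = S])
    fix i x assume x: "x \<in> S"
    have "x \<notin> \<real>\<^sub>\<le>\<^sub>0"
      using S[OF x] by (auto simp: complex_nonpos_Reals_iff)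
    thus "(f i has_field_derivative f (Suc i) x) (at x within S)"
      unfolding f_def taylor_fact_def
      by (auto intro!: derivative_eq_intros simp: algebra_simps)
  next
    fix x assume x: "x \<in> S"
    have "norm (f (Suc M) x) =
            norm (taylor_fact (Suc M) s) * Re x powr (- Re s - real M)"
      using S[OF x] by (simp add: f_def norm_mult norm_powr_real_powr)
    also have "\<dots> \<le> B"
      unfolding B_def using S[OF x] assms
      by (intro mult_left_mono powr_mono2') auto
    finally show "norm (f (Suc M) x) \<le> B" .
  qed (auto simp: S_def)
  thus ?thesis
    by (simp add: f_def B_def taylor_rem_def taylor_fact_def)
qed

lemma holomorphic_taylor_rem_suminf:
  assumes M: "M \<ge> 1"
  shows "(\<lambda>s. \<Sum>n. taylor_rem M n s) holomorphic_on {s. Re s > 1 - real M}"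
proof (rule holomorphic_on_suminf_local[OF open_Re_gt])
  show "taylor_rem M n holomorphic_on {s. 1 - real M < Re s}" for n
    unfolding taylor_rem_def[abs_def] taylor_fact_def by (intro holomorphic_intros) auto
  fix x :: complex assume x: "x \<in> {s. 1 - real M < Re s}"
  define d where "d = (Re x - (1 - real M)) / 2"
  have d: "d > 0" "Re x - d > 1 - real M" using x by (auto simp: d_def field_simps)
  have "continuous_on (cball x d) (\<lambda>s. norm (taylor_fact (Suc M) s))"
    unfolding taylor_fact_def by (intro continuous_intros)
  hence "bounded ((\<lambda>s. norm (taylor_fact (Suc M) s)) ` cball x d)"
    by (intro compact_imp_bounded compact_continuous_image) auto
  then obtain C where C: "\<And>y. y \<in> cball x d \<Longrightarrow> norm (taylor_fact (Suc M) y) \<le> C"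
    unfolding bounded_iff by force
  have "norm (taylor_rem M n y) \<le> C / fact M * real (Suc n) powr (- (Re x - d) - real M)"
    if y: "y \<in> cball x d" for n y
  proof -
    have "norm (taylor_rem M n y) \<le>
      norm (taylor_fact (Suc M) y) / fact M * real (Suc n) powr (- Re y - real M)"
      using cball_Re[OF y] d by (intro taylor_rem_bound) auto
    also have "\<dots> \<le> C / fact M * real (Suc n) powr (- (Re x - d) - real M)"
      using cball_Re[OF y] C[OF y] order_trans[OF norm_ge_zero C[OF y]]
      by (intro mult_mono divide_right_mono powr_mono) auto
    finally show ?thesis .
  qed
  moreover have "summable (\<lambda>n. C / fact M * real (Suc n) powr (- (Re x - d) - real M))"
    using d by (intro summable_mult summable_Suc_powr) auto
  moreover have "cball x d \<subseteq> {s. 1 - real M < Re s}"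
    using cball_Re d by fastforce
  ultimately show "\<exists>d>0. \<exists>B. cball x d \<subseteq> {s. 1 - real M < Re s} \<and> summable B \<and>
           (\<forall>n. \<forall>y\<in>cball x d. norm (taylor_rem M n y) \<le> B n)"
    using d(1) by blast
qed

lemma dirichlet_zeta_recursion:
  assumes s: "Re s > 1"
  shows "(s - 1) * dirichlet_zeta s = 1 + (\<Sum>n. taylor_rem (Suc K) n s) -
    (\<Sum>j<K. taylor_fact (Suc j) s / fact (j + 2) *
       ((s + of_nat (Suc j) - 1) * dirichlet_zeta (s + of_nat (Suc j))))"
proof -
  define F where "F = (\<lambda>n. of_nat (Suc n) powr (1 - s) :: complex)"
  have "(\<lambda>n. real n powr (1 - Re s)) \<longlonglongrightarrow> 0"
    using s by (intro tendsto_neg_powr filterlim_real_sequentially) auto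
  hence "(\<lambda>n. real (Suc n) powr (1 - Re s)) \<longlonglongrightarrow> 0"
    by (rule LIMSEQ_Suc)
  hence "F \<longlonglongrightarrow> 0"
    unfolding F_def by - (rule tendsto_norm_zero_cancel, unfold norm_of_nat_powr, simp del: of_nat_Suc)
  from telescope_sums[OF this] have 1: "(\<lambda>n. F (Suc n) - F n) sums (- 1)"
    by (simp add: F_def)
  have 2: "(\<lambda>n. taylor_fact (Suc k) s / fact (Suc k) * of_nat (Suc n) powr (- (s + of_nat k)))
          sums (taylor_fact (Suc k) s / fact (Suc k) * dirichlet_zeta (s + of_nat k))" for k
    using s by (intro sums_mult dirichlet_zeta_sums) auto
  have 3: "(\<lambda>n. (F (Suc n) - F n) - (\<Sum>k<Suc K. taylor_fact (Suc k) s / fact (Suc k) *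
              of_nat (Suc n) powr (- (s + of_nat k))))
        sums (- 1 - (\<Sum>k<Suc K. taylor_fact (Suc k) s / fact (Suc k) *
              dirichlet_zeta (s + of_nat k)))"
    by (intro sums_diff 1 sums_sum 2)
  have "(F (Suc n) - F n) - (\<Sum>k<Suc K. taylor_fact (Suc k) s / fact (Suc k) *
              of_nat (Suc n) powr (- (s + of_nat k))) = taylor_rem (Suc K) n s" for n
  proof -
    have "(\<Sum>k\<le>Suc K. taylor_fact k s * of_nat (Suc n) powr (1 - s - of_nat k) / fact k) =
      F n + (\<Sum>k<Suc K. taylor_fact (Suc k) s * of_nat (Suc n) powr (1 - s - of_nat (Suc k))
               / fact (Suc k))"
      unfolding lessThan_Suc_atMost[symmetric] F_def
      by (subst sum.lessThan_Suc_shift) (simp add: taylor_fact_def)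
    moreover have "1 - s - of_nat (Suc k) = - (s + of_nat k)" for k by simp
    ultimately show ?thesis by (simp add: taylor_rem_def F_def)
  qed
  with 3 have "(\<Sum>n. taylor_rem (Suc K) n s) =
       - 1 - (\<Sum>k<Suc K. taylor_fact (Suc k) s / fact (Suc k) * dirichlet_zeta (s + of_nat k))"
    by (simp add: sums_iff)
  also have "\<dots> = - 1 + (s - 1) * dirichlet_zeta s -
      (\<Sum>j<K. taylor_fact (Suc (Suc j)) s / fact (Suc (Suc j)) *
          dirichlet_zeta (s + of_nat (Suc j)))"
    by (subst sum.lessThan_Suc_shift) (simp add: taylor_fact_def algebra_simps)
  also have "(\<Sum>j<K. taylor_fact (Suc (Suc j)) s / fact (Suc (Suc j)) *
          dirichlet_zeta (s + of_nat (Suc j))) =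
      - (\<Sum>j<K. taylor_fact (Suc j) s / fact (j + 2) *
       ((s + of_nat (Suc j) - 1) * dirichlet_zeta (s + of_nat (Suc j))))"
    unfolding sum_negf[symmetric]
  proof (rule sum.cong[OF refl])
    fix j
    have "taylor_fact (Suc (Suc j)) s = - (taylor_fact (Suc j) s * (s + of_nat (Suc j) - 1))"
      unfolding taylor_fact_def prod.lessThan_Suc[of _ "Suc j"] by (simp add: algebra_simps)
    thus "taylor_fact (Suc (Suc j)) s / fact (Suc (Suc j)) * dirichlet_zeta (s + of_nat (Suc j)) =
       - (taylor_fact (Suc j) s / fact (j + 2) *
       ((s + of_nat (Suc j) - 1) * dirichlet_zeta (s + of_nat (Suc j))))"
      by simp
  qed
  finally show ?thesis by (simp add: algebra_simps)
qed

lemma zeta_continuation_step: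
  "\<exists>g. g holomorphic_on {s. Re s > 1 - real K} \<and>
       (\<forall>s. Re s > 1 \<longrightarrow> g s = (s - 1) * dirichlet_zeta s)"
proof (induction K)
  case 0
  show ?case
    by (rule exI[of _ "\<lambda>s. (s - 1) * dirichlet_zeta s"])
       (auto intro!: holomorphic_intros holomorphic_dirichlet_zeta)
next
  case (Suc K)
  then obtain g where g: "g holomorphic_on {s. Re s > 1 - real K}"
    "\<And>s. Re s > 1 \<Longrightarrow> g s = (s - 1) * dirichlet_zeta s" by blast
  define h where "h = (\<lambda>s. 1 + (\<Sum>n. taylor_rem (Suc K) n s) -
    (\<Sum>j<K. taylor_fact (Suc j) s / fact (j + 2) * g (s + of_nat (Suc j))))"
  have "(\<lambda>s. g (s + of_nat (Suc j))) holomorphic_on {s. Re s > 1 - real (Suc K)}" for j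
  proof -
    have "(g \<circ> (\<lambda>s. s + of_nat (Suc j))) holomorphic_on {s. Re s > 1 - real (Suc K)}"
      by (rule holomorphic_on_compose_gen[OF _ g(1)]) (auto intro!: holomorphic_intros)
    thus ?thesis by (simp add: o_def)
  qed
  hence "h holomorphic_on {s. Re s > 1 - real (Suc K)}"
    unfolding h_def taylor_fact_def
    by (intro holomorphic_intros holomorphic_taylor_rem_suminf) auto
  moreover have "h s = (s - 1) * dirichlet_zeta s" if "Re s > 1" for s
    unfolding h_def dirichlet_zeta_recursion[OF that, of K] using that by (simp add: g(2))
  ultimately show ?case by (intro exI[of _ h]) auto
qed

lemma Re_gt_analytic_unique:
  assumes "f holomorphic_on S" "g holomorphic_on S" "open S" "connected S"
    and "\<And>s. Re s > 1 \<Longrightarrow> f s = g s" "{s. Re s > 1} \<subseteq> S" "z \<in> S"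
  shows "f z = g z"
proof -
  have "(2 :: complex) \<in> {s. Re s > 1}" by simp
  then have "{s. Re s > 1} \<noteq> {}" by blast
  with assms show ?thesis
    by (intro analytic_continuation_open[of "{s. Re s > 1}" S f g z] open_Re_gt) auto
qed

theorem riemann_zeta_ex1: "\<exists>!f. is_riemann_zeta f"
proof (rule ex_ex1I)
  obtain g where g: "\<And>K. g K holomorphic_on {s. Re s > 1 - real K}"
    "\<And>K s. Re s > 1 \<Longrightarrow> g K s = (s - 1) * dirichlet_zeta s"
    using zeta_continuation_step by metis
  have g_eq: "g K s = g L s" if "K \<le> L" "Re s > 1 - real K" for K L s
  proof (rule Re_gt_analytic_unique[where f = "g K" and g = "g L" and S = "{s. Re s > 1 - real K}"])
    show "g K holomorphic_on {s. Re s > 1 - real K}" by (rule g)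
    show "g L holomorphic_on {s. Re s > 1 - real K}"
      by (rule holomorphic_on_subset[OF g(1)]) (use that in auto)
    show "connected {s. Re s > 1 - real K}"
      by (intro convex_connected convex_halfspace_Re_gt)
  qed (use that g(2) open_Re_gt in auto)
  define N where "N = (\<lambda>s. nat \<lceil>2 - Re s\<rceil>)"
  define G where "G = (\<lambda>s. g (N s) s)"
  have N: "Re s > 1 - real (N s)" for s unfolding N_def by linarith
  have G_eq: "G s = g K s" if "Re s > 1 - real K" for s K
    unfolding G_def using g_eq[of "N s" K s] g_eq[of K "N s" s] N that by (metis nle_le)
  have "G holomorphic_on {s. Re s > 1 - real K}" for K
    by (rule holomorphic_transform[OF g(1)]) (simp add: G_eq)
  hence "G holomorphic_on (\<Union>K. {s. Re s > 1 - real K})"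
    by (intro holomorphic_on_UN_open open_Re_gt)
  moreover have "(\<Union>K. {s. Re s > 1 - real K}) = UNIV"
    using N by blast
  ultimately have G: "G holomorphic_on UNIV" by simp
  define f where "f = (\<lambda>s. if s = 1 then 0 else G s / (s - 1))"
  have "(\<lambda>s. G s / (s - 1)) holomorphic_on - {1}"
    by (intro holomorphic_intros holomorphic_on_subset[OF G]) auto
  hence "f holomorphic_on - {1}"
    by (rule holomorphic_transform) (auto simp: f_def)
  moreover have "f s = dirichlet_zeta s" if "Re s > 1" for s
  proof -
    have "s \<noteq> 1" using that by auto
    thus ?thesis using that G_eq[of 0 s] g(2)[of s 0] by (simp add: f_def)
  qed
  ultimately show "\<exists>f. is_riemann_zeta f"
    unfolding is_riemann_zeta_def using dirichlet_zeta_sums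
    by (intro exI[of _ f]) (auto simp: f_def)
next
  fix f h assume fh: "is_riemann_zeta f" "is_riemann_zeta h"
  show "f = h"
  proof
    fix z show "f z = h z"
    proof (cases "z = 1")
      case False
      have eq: "f s = h s" if "Re s > 1" for s
        using fh that unfolding is_riemann_zeta_def by (metis sums_unique2)
      show ?thesis
      proof (rule Re_gt_analytic_unique[where f = f and g = h and S = "- {1}"])
        show "f holomorphic_on - {1}" "h holomorphic_on - {1}"
          using fh by (auto simp: is_riemann_zeta_def)
        show "connected (- {1 :: complex})"
          by (simp add: connected_punctured_universe)
      qed (use False eq in auto)
    qed (use fh in \<open>simp add: is_riemann_zeta_def\<close>)
  qed
qed

corollary is_riemann_zeta_riemann_zeta: "is_riemann_zeta riemann_zeta"
  unfolding riemann_zeta_def by (rule theI'[OF riemann_zeta_ex1])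

definition riemann_hypothesis :: bool where
  "riemann_hypothesis \<longleftrightarrow>
     (\<forall>s. riemann_zeta s = 0 \<and> 0 < Re s \<and> Re s < 1 \<longrightarrow> Re s = 1 / 2)"

definition phi1 :: "real \<Rightarrow> real" where
  "phi1 \<alpha> = \<bar>\<alpha> - 1/2\<bar> / pi *
     (LBINT t. ln (norm (riemann_zeta (Complex (1/2 + \<alpha>) t) * Complex \<bar>\<alpha> - 1/2\<bar> t)) /
               ((1/2 - \<alpha>)\<^sup>2 + t\<^sup>2))"

definition phi2 :: "real \<Rightarrow> real" where
  "phi2 \<alpha> = \<bar>\<alpha> - 1/2\<bar> / pi *
     (LBINT t. ln (norm (riemann_zeta (Complex (1/2 + \<alpha>) t) * Complex \<bar>\<alpha> - 1/2\<bar> t)) /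
               ((1/2 - \<alpha>)\<^sup>2 + t\<^sup>2)\<^sup>2)"

text \<open>
  On the real axis to the right of \<open>1\<close>, where these occur in the statement, \<open>\<zeta>\<close> and \<open>\<zeta>'\<close>
  take real values, so that taking the real part merely converts to type \<^typ>\<open>real\<close>.
\<close>

definition zeta_real :: "real \<Rightarrow> real" where
  "zeta_real x = Re (riemann_zeta (of_real x))"

definition zeta_deriv_real :: "real \<Rightarrow> real" where
  "zeta_deriv_real x = Re (deriv riemann_zeta (of_real x))"

end

theory Submission
  imports Defs
begin

text \<open>
  Let \<open>F(s) = (s - 1) * \<zeta>(s)\<close> and \<open>\<sigma> = 1/2 + \<alpha>\<close>, \<open>a = \<bar>\<alpha> - 1/2\<bar>\<close>; the numerator of both integrands is
  \<open>ln \<bar>F(\<sigma> + it)\<bar>\<close>.  The map \<open>w = (s - \<sigma> - a) / (s - \<sigma> + a)\<close> carries the half-plane \<open>Re s > \<sigma>\<close> to the unit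
  disc and the measure \<open>a / (\<pi> * (a\<^sup>2 + t\<^sup>2)) dt\<close> to the normalised angular measure, and
  \<open>2 * a\<^sup>2 / (a\<^sup>2 + t\<^sup>2)\<close> becomes \<open>1 - cos \<theta>\<close>.  Hence \<open>\<phi>\<^sub>1(\<alpha>)\<close> and \<open>2 * a\<^sup>2 * \<phi>\<^sub>2(\<alpha>)\<close> are the means over the
  circle of \<open>ln \<bar>F\<bar>\<close> with the weights \<open>1\<close> and \<open>1 - cos \<theta>\<close>.  By Jensen's formula such a mean is at least
  the value obtained for a zero-free function, and each zero adds an explicit gain, which is positive as
  soon as \<open>Re \<rho> < \<sigma> + a\<close>.  For \<open>\<alpha> < 1/2\<close> we have \<open>\<sigma> + a = 1\<close>, so \<open>F(1) = 1\<close>, \<open>F'(1) = \<gamma>\<close> and the non-vanishing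
  of \<open>\<zeta>\<close> on \<open>Re s \<ge> 1\<close> show that a zero to the right of the critical line violates (A) and (B).
  A zero to the left of it is first moved to the right by the functional equation, which comes from
  comparing the Mellin transforms of \<open>1 / (e\<^sup>x - 1)\<close> and of its partial fraction expansion.  Conversely, under the
  Riemann Hypothesis \<open>1 / F\<close> has polynomial growth on \<open>Re s \<ge> \<sigma>\<close> (Borel--Caratheodory), so the inequality
  applies to both \<open>F\<close> and \<open>1 / F\<close> and becomes an equality.
\<close>

subsection \<open>Jensen's inequality on the unit circle and on half-planes\<close>

text \<open>What shapes the proof is the passage to the boundary line. Zeros may accumulate at
  infinity, and near them ln |F| has no usable lower bound, so convergence of the means over inner
  circles cannot be had by domination. Only an upper bound for ln |F| is carried to the limit, by
  Fatou's lemma; this yields an inequality for the mean. It is one-sided, but it already suffices to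
  detect a zero, and the reciprocal supplies the other side. The parameter l \<in> [0, 1]
  interpolates between the two weights, so that one chain of lemmas with the weight 1 - l cos serves
  (A) at l = 0 and (B) at l = 1. The cosine picks out the first Taylor coefficient of log F at the
  centre of the disc, which is how a logarithmic derivative enters (B). The boundary line itself
  must carry no zeros. When a hypothetical zero is to be detected, this is arranged by moving the
  line: the zeros are countable, so \<sigma> can avoid all their real parts.\<close>

definition jensen_value :: "real \<Rightarrow> (complex \<Rightarrow> complex) \<Rightarrow> real" where
  "jensen_value l h = ln (norm (h 0)) - l / 2 * Re (deriv h 0 / h 0)"

text \<open>For 0 < |z| < 1 the factor w - z may be replaced by 1 - cnj z * w, which has the same
  modulus on the unit circle and no zero in the disc. \<open>zero_gain l z\<close> is the change of
  \<open>jensen_value l\<close> under this replacement: the logarithm comes from the values at 0,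
  the rest from the logarithmic derivatives -1/z and -cnj z.\<close>

definition zero_gain :: "real \<Rightarrow> complex \<Rightarrow> real" where
  "zero_gain l z = ln (1 / norm z) - l / 2 * Re (1 / z - cnj z)"

abbreviation circle_log :: "real \<Rightarrow> (complex \<Rightarrow> complex) \<Rightarrow> real \<Rightarrow> real" where
  "circle_log l h t \<equiv> ln (norm (h (cis t))) * (1 - l * cos t)"

text \<open>A zero-free \<open>h\<close> on a disc is \<open>exp L\<close>, and ln |h| is the real
  part of \<open>L\<close>. Since 2 cos t = cis t + 1 / cis t, the weighted mean of \<open>L\<close>
  involves only L(0), L'(0) and the mean of \<open>L (cis t) * cis t\<close>, which vanishes by
  Cauchy's theorem.\<close>

lemma has_integral_circle_ln_zero_free:
  assumes h: "h holomorphic_on ball 0 R" and R: "R > 1"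
    and nz: "\<And>w. w \<in> ball 0 R \<Longrightarrow> h w \<noteq> 0"
  shows "((\<lambda>t. circle_log l h t) has_integral 2 * pi * jensen_value l h) {0..2*pi}"
proof -
  have 0: "0 \<in> ball (0::complex) R" using R by simp
  obtain L where L: "L holomorphic_on ball 0 R" "\<And>w. w \<in> ball 0 R \<Longrightarrow> exp (L w) = h w"
    using holomorphic_logarithm_exists[OF convex_ball open_ball h nz 0] by blast
  have c: "continuous_on (cball 0 1) L" and hb: "L holomorphic_on ball 0 1"
    using R by (auto intro!: holomorphic_on_imp_continuous_on holomorphic_on_subset[OF L(1)])
  have cp: "(f has_contour_integral I) (circlepath 0 1) \<longleftrightarrow>
      ((\<lambda>t. f (cis t) * \<i> * cis t) has_integral I) {0..2*pi}" for f I
    using has_contour_integral_part_circlepath_iff[of 0 "2*pi" f I 0 1]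
    by (simp add: circlepath_def)
  \<comment> \<open>k = 0 gives the mean of \<open>L\<close>, k = 1 the mean of
    \<open>L / cis t\<close>.\<close>
  have 1: "((\<lambda>t. L (cis t) / cis t ^ Suc k * \<i> * cis t) has_integral
      2 * pi * \<i> / fact k * (deriv ^^ k) L 0) {0..2*pi}" for k
    using Cauchy_has_contour_integral_higher_derivative_circlepath[OF c hb, of 0 k]
    unfolding cp by simp
  have 2: "((\<lambda>t. L (cis t) * \<i> * cis t) has_integral 0) {0..2*pi}"
  proof -
    have "(L has_contour_integral 0) (circlepath 0 1)"
      by (rule Cauchy_theorem_disc_simple[OF L(1)]) (use R in auto)
    thus ?thesis unfolding cp .
  qed
  have 3: "((\<lambda>t. - \<i> * (L (cis t) / cis t ^ Suc 0 * \<i> * cis t)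
         - l / 2 * (- \<i> * (L (cis t) / cis t ^ Suc 1 * \<i> * cis t) + - \<i> * (L (cis t) * \<i> * cis t)))
      has_integral (- \<i> * (2 * pi * \<i> / fact 0 * (deriv ^^ 0) L 0)
         - l / 2 * (- \<i> * (2 * pi * \<i> / fact 1 * (deriv ^^ 1) L 0) + - \<i> * 0))) {0..2*pi}"
    by (intro has_integral_diff has_integral_mult_right has_integral_add 1 2)
  have eq1: "- \<i> * (L (cis t) / cis t ^ Suc 0 * \<i> * cis t)
         - l / 2 * (- \<i> * (L (cis t) / cis t ^ Suc 1 * \<i> * cis t) + - \<i> * (L (cis t) * \<i> * cis t))
       = L (cis t) * of_real (1 - l * cos t)" for t
  proof -
    have "cis t + inverse (cis t) = 2 * of_real (cos t)"
      by (simp add: cis_inverse complex_eq_iff)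
    hence e: "inverse (cis t) = 2 * of_real (cos t) - cis t" by (metis add_diff_cancel_left')
    have "- \<i> * (L (cis t) / cis t ^ Suc 0 * \<i> * cis t)
         - l / 2 * (- \<i> * (L (cis t) / cis t ^ Suc 1 * \<i> * cis t) + - \<i> * (L (cis t) * \<i> * cis t))
       = L (cis t) - l / 2 * (L (cis t) * inverse (cis t) + L (cis t) * cis t)"
      by (simp add: field_simps)
    also have "\<dots> = L (cis t) * of_real (1 - l * cos t)"
      unfolding e by (simp add: algebra_simps)
    finally show ?thesis .
  qed
  have "((\<lambda>t. Re (L (cis t) * of_real (1 - l * cos t))) has_integral
      Re (- \<i> * (2 * pi * \<i> / fact 0 * (deriv ^^ 0) L 0)
         - l / 2 * (- \<i> * (2 * pi * \<i> / fact 1 * (deriv ^^ 1) L 0) + - \<i> * 0))) {0..2*pi}"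
    using has_integral_linear[OF 3[unfolded eq1] bounded_linear_Re] by (simp add: o_def)
  moreover have "Re (L (cis t) * of_real (1 - l * cos t)) = circle_log l h t" for t
  proof -
    have "h (cis t) = exp (L (cis t))" using L(2)[of "cis t"] R by simp
    thus ?thesis by simp
  qed
  moreover have "Re (- \<i> * (2 * pi * \<i> / fact 0 * (deriv ^^ 0) L 0)
         - l / 2 * (- \<i> * (2 * pi * \<i> / fact 1 * (deriv ^^ 1) L 0) + - \<i> * 0)) = 2 * pi * jensen_value l h"
  proof -
    have "(h has_field_derivative exp (L 0) * deriv L 0) (at 0)"
    proof (rule has_field_derivative_transform_within_open[OF _ open_ball 0])
      show "((\<lambda>w. exp (L w)) has_field_derivative exp (L 0) * deriv L 0) (at 0)"
        by (rule derivative_eq_intros holomorphic_derivI[OF L(1) open_ball 0])+ simp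
    qed (use L in auto)
    hence "deriv h 0 = h 0 * deriv L 0" using L(2)[OF 0] by (simp add: DERIV_imp_deriv)
    moreover have "ln (norm (h 0)) = Re (L 0)" using L(2)[OF 0] by (metis ln_exp norm_exp_eq_Re)
    ultimately show ?thesis using nz[OF 0] by (simp add: jensen_value_def algebra_simps)
  qed
  ultimately show ?thesis by (simp only:)
qed

lemma has_integral_circle_ln_linear:
  assumes z: "norm z < 1" "z \<noteq> 0"
  shows "((\<lambda>t. ln (norm (cis t - z)) * (1 - l * cos t)) has_integral
     2 * pi * (jensen_value l (\<lambda>w. w - z) + zero_gain l z)) {0..2*pi}"
proof -
  \<comment> \<open>The modulus of the zero of 1 - cnj z * w, hence the radius up to which this
    function is zero-free.\<close>
  define R where "R = 1 / norm z"
  have R: "R > 1" using z by (simp add: R_def)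
  have "1 - cnj z * w \<noteq> 0" if "w \<in> ball 0 R" for w
  proof
    assume "1 - cnj z * w = 0"
    hence "norm (cnj z * w) = 1" by (metis eq_iff_diff_eq_0 norm_one)
    with that z show False by (simp add: R_def norm_mult field_simps)
  qed
  hence 1: "((\<lambda>t. ln (norm (1 - cnj z * cis t)) * (1 - l * cos t)) has_integral
       2 * pi * jensen_value l (\<lambda>w. 1 - cnj z * w)) {0..2*pi}"
    by (intro has_integral_circle_ln_zero_free[OF _ R] holomorphic_intros)
  have 2: "norm (1 - cnj z * cis t) = norm (cis t - z)" for t
  proof -
    \<comment> \<open>Conjugation and multiplication by \<open>cis t\<close> both preserve the
      modulus and together produce \<open>cis t - z\<close>.\<close>
    have "norm (1 - cnj z * cis t) = norm (cnj (1 - cnj z * cis t) * cis t)"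
      by (simp only: norm_mult complex_mod_cnj norm_cis mult_1_right)
    also have "cnj (1 - cnj z * cis t) * cis t = cis t - z"
      by (simp add: algebra_simps cis_cnj flip: cis_inverse)
    finally show ?thesis .
  qed
  have d: "deriv (\<lambda>w. 1 - cnj z * w) 0 = - cnj z" "deriv (\<lambda>w. w - z) 0 = 1"
    by (rule DERIV_imp_deriv, auto intro!: derivative_eq_intros)+
  have "jensen_value l (\<lambda>w. 1 - cnj z * w) = jensen_value l (\<lambda>w. w - z) + zero_gain l z"
    using z by (simp add: jensen_value_def zero_gain_def d ln_div ring_distribs)
  with 1 show ?thesis by (simp add: 2)
qed

text \<open>The local factorisation at \<open>z\<close> is extended to all of \<open>S\<close> by
  dividing by \<open>(w - z) ^ n\<close> away from \<open>z\<close>. The cofactor then lives on the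
  same domain as \<open>h\<close>, as an induction over the zeros requires.\<close>

lemma holomorphic_factor_zero_global:
  assumes h: "h holomorphic_on S" and S: "open S" "connected S" and z: "z \<in> S" "h z = 0"
    and nz: "u \<in> S" "h u \<noteq> 0"
  obtains g n where "n > 0" "g holomorphic_on S" "g z \<noteq> 0" "\<And>w. w \<in> S \<Longrightarrow> h w = (w - z) ^ n * g w"
proof -
  have nc: "\<not> h constant_on S" using z nz by (metis constant_on_def)
  obtain g r n where g: "0 < n" "0 < r" "ball z r \<subseteq> S" "g holomorphic_on ball z r"
      "\<And>w. w \<in> ball z r \<Longrightarrow> h w = (w - z) ^ n * g w" "\<And>w. w \<in> ball z r \<Longrightarrow> g w \<noteq> 0"
    using holomorphic_factor_zero_nonconstant[OF h S z nc] by metis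
  define f where "f = (\<lambda>w. if w = z then g z else h w / (w - z) ^ n)"
  have f1: "f w = g w" if "w \<in> ball z r" for w
    using g(5)[OF that] by (auto simp: f_def)
  have "f holomorphic_on ball z r \<union> (S - {z})"
  proof (rule holomorphic_on_Un)
    show "f holomorphic_on ball z r" using g(4) f1 by (metis holomorphic_transform)
    have "(\<lambda>w. h w / (w - z) ^ n) holomorphic_on S - {z}"
      by (intro holomorphic_intros holomorphic_on_subset[OF h]) auto
    thus "f holomorphic_on S - {z}"
      by (rule holomorphic_transform) (auto simp: f_def)
  qed (use S in auto)
  hence "f holomorphic_on S" by (rule holomorphic_on_subset) (use g z in auto)
  moreover have "f z \<noteq> 0" using f1[of z] g(6)[of z] g(2) by simp
  moreover have "h w = (w - z) ^ n * f w" if "w \<in> S" for w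
    using z g(1) by (auto simp: f_def)
  ultimately show ?thesis using that g(1) by blast
qed

lemma jensen_value_mult:
  assumes "f field_differentiable at 0" "g field_differentiable at 0" "f 0 \<noteq> 0" "g 0 \<noteq> 0"
  shows "jensen_value l (\<lambda>w. f w * g w) = jensen_value l f + jensen_value l g"
proof -
  have "(f 0 * deriv g 0 + deriv f 0 * g 0) / (f 0 * g 0) = deriv f 0 / f 0 + deriv g 0 / g 0"
    using assms by (simp add: field_simps)
  hence "deriv (\<lambda>w. f w * g w) 0 / (f 0 * g 0) = deriv f 0 / f 0 + deriv g 0 / g 0"
    using deriv_mult[OF assms(1,2)] by simp
  thus ?thesis
    using assms by (simp add: jensen_value_def norm_mult ln_mult algebra_simps)
qed

lemma jensen_value_power:
  assumes "f field_differentiable at 0" "f 0 \<noteq> 0"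
  shows "jensen_value l (\<lambda>w. f w ^ n) = real n * jensen_value l f"
proof (induction n)
  case 0
  then show ?case by (simp add: jensen_value_def)
next
  case (Suc n)
  have "(\<lambda>w. f w ^ n) field_differentiable at 0"
    by (intro derivative_intros assms)
  from jensen_value_mult[OF assms(1) this] assms Suc show ?case
    by (simp add: algebra_simps)
qed

lemma jensen_value_cong:
  assumes "\<And>w. w \<in> S \<Longrightarrow> f w = g w" "open S" "0 \<in> S"
  shows "jensen_value l f = jensen_value l g"
proof -
  have "eventually (\<lambda>w. f w = g w) (nhds 0)"
    using assms eventually_nhds by blast
  from deriv_cong_ev[OF this refl] assms show ?thesis by (simp add: jensen_value_def)
qed

text \<open>Induction on the number of distinct zeros in the open disc. Splitting off
  \<open>(w - z) ^ n\<close> with the full multiplicity \<open>n\<close> removes one of them and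
  adds \<open>n * zero_gain l z\<close> to the mean. The conclusion records the gain of one zero at
  a time, since a single positive gain is enough for a strict inequality later.\<close>

lemma integral_circle_ln_ge:
  assumes h: "h holomorphic_on ball 0 R" and R: "R > 1" and h0: "h 0 \<noteq> 0"
    and sph: "\<And>w. norm w = 1 \<Longrightarrow> h w \<noteq> 0"
    and gain: "\<And>w. norm w < 1 \<Longrightarrow> h w = 0 \<Longrightarrow> zero_gain l w \<ge> 0"
  shows "\<exists>I. ((\<lambda>t. circle_log l h t) has_integral I) {0..2*pi} \<and> 2 * pi * jensen_value l h \<le> I \<and>
     (\<forall>z. norm z < 1 \<longrightarrow> h z = 0 \<longrightarrow> 2 * pi * (jensen_value l h + zero_gain l z) \<le> I)"
proof -
  define K where "K = (\<lambda>h::complex\<Rightarrow>complex. {w. norm w < 1 \<and> h w = 0})"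
  have fin: "finite {w \<in> cball 0 1. h w = 0}"
    if "h holomorphic_on ball 0 R" "h 0 \<noteq> 0" "norm w = 1 \<Longrightarrow> h w \<noteq> 0" for h :: "complex \<Rightarrow> complex" and w
  proof (cases "h constant_on ball 0 R")
    case True
    hence "{w \<in> cball 0 1. h w = 0} = {}"
      using that R by (force simp: constant_on_def)
    thus ?thesis by (metis finite.emptyI)
  next
    case False
    thus ?thesis
      by (intro holomorphic_compact_finite_zeros[of h "ball 0 R"]) (use that R in auto)
  qed
  have finK: "finite (K h)" 
    if "h holomorphic_on ball 0 R" "h 0 \<noteq> 0" for h :: "complex \<Rightarrow> complex"
    by (rule finite_subset[OF _ fin[OF that, of 0]]) (auto simp: K_def)
  show ?thesis using h h0 sph gain
  proof (induction "card (K h)" arbitrary: h rule: less_induct)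
    case (less h)
    show ?case
    proof (cases "K h = {}")
      case True
      have nzc: "h w \<noteq> 0" if "w \<in> cball 0 1" for w
        using that True less.prems(3)[of w] by (cases "norm w = 1") (auto simp: K_def)
      \<comment> \<open>The zero-free lemma asks for a disc larger than the unit disc, while absence
        of zeros is known on the closed unit disc; compactness provides the margin \<open>e\<close>,
        with \<open>sgn w\<close> the point of the closed disc nearest to an outer
        \<open>w\<close>.\<close>
      have "\<exists>R'>1. \<forall>w\<in>ball 0 R'. w \<in> ball 0 R \<and> h w \<noteq> 0"
      proof -
        have "open (ball 0 R \<inter> h -` (- {0}))"
          by (intro continuous_open_preimage holomorphic_on_imp_continuous_on less.prems) auto
        moreover have "cball 0 1 \<subseteq> ball 0 R \<inter> h -` (- {0})" using nzc R by auto
        ultimately obtain e where e: "e > 0" "(\<Union>x\<in>cball 0 1. ball x e) \<subseteq> ball 0 R \<inter> h -` (- {0})"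
          using compact_in_open_separated compact_subset_open_imp_ball_epsilon_subset compact_cball by metis
        have "w \<in> (\<Union>x\<in>cball 0 1. ball x e)" if w: "w \<in> ball 0 (1 + e)" for w :: complex
        proof (cases "norm w \<le> 1")
          case True
          thus ?thesis using e by force
        next
          case False
          have "norm (sgn w - w) = norm ((1 / norm w - 1) *\<^sub>R w)"
            by (simp add: sgn_div_norm scaleR_diff_left divide_inverse)
          also have "\<dots> = \<bar>1 / norm w - 1\<bar> * norm w" by simp
          also have "\<dots> = norm w - 1"
            using False by (auto simp: abs_if field_simps)
          also have "\<dots> < e" using w by simp
          finally have "w \<in> ball (sgn w) e" by (simp add: dist_norm)
          moreover have "sgn w \<in> cball (0::complex) 1" by (simp add: norm_sgn)
          ultimately show ?thesis by blast
        qed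
        hence "\<forall>w\<in>ball 0 (1 + e). w \<in> ball 0 R \<inter> h -` (- {0})" using e(2) by blast
        thus ?thesis using e(1) by (intro exI[of _ "1 + e"]) simp
      qed
      then obtain R' where R': "R' > 1" "\<And>w. w \<in> ball 0 R' \<Longrightarrow> w \<in> ball 0 R \<and> h w \<noteq> 0" by blast
      have "((\<lambda>t. circle_log l h t) has_integral 2 * pi * jensen_value l h) {0..2*pi}"
        by (rule has_integral_circle_ln_zero_free[OF holomorphic_on_subset[OF less.prems(1)] R'(1)])
           (use R' in auto)
      thus ?thesis using True by (auto simp: K_def)
    next
      case False
      then obtain z where z: "norm z < 1" "h z = 0" by (auto simp: K_def)
      have z0: "z \<noteq> 0" using less.prems z by auto
      obtain g n where g: "n > 0" "g holomorphic_on ball 0 R" "g z \<noteq> 0"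
          "\<And>w. w \<in> ball 0 R \<Longrightarrow> h w = (w - z) ^ n * g w"
        by (rule holomorphic_factor_zero_global[OF less.prems(1) open_ball connected_ball, of z 0])
           (use z R less.prems in auto)
      have Kg: "K g \<subset> K h"
      proof
        show "K g \<subseteq> K h" using g(4) R by (auto simp: K_def)
        show "K g \<noteq> K h" using g(3) z by (auto simp: K_def)
      qed
      have g0: "g 0 \<noteq> 0" using g(4)[of 0] less.prems R by auto
      have "\<exists>I. ((\<lambda>t. circle_log l g t) has_integral I) {0..2*pi} \<and> 2 * pi * jensen_value l g \<le> I \<and>
         (\<forall>z. norm z < 1 \<longrightarrow> g z = 0 \<longrightarrow> 2 * pi * (jensen_value l g + zero_gain l z) \<le> I)"
      proof (rule less.hyps)
        show "card (K g) < card (K h)"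
          by (rule psubset_card_mono[OF finK[OF less.prems(1,2)] Kg])
        show "g w \<noteq> 0" if "norm w = 1" for w
          using less.prems(3)[OF that] g(4)[of w] R that by auto
        show "0 \<le> zero_gain l w" if "norm w < 1" "g w = 0" for w
          using less.prems(4)[of w] g(4)[of w] R that by auto
      qed (use g g0 in auto)
      then obtain I where I: "2 * pi * jensen_value l g \<le> I" "((\<lambda>t. circle_log l g t) has_integral I) {0..2*pi}"
        "\<And>z. norm z < 1 \<Longrightarrow> g z = 0 \<Longrightarrow> 2 * pi * (jensen_value l g + zero_gain l z) \<le> I" by blast
      define I' where "I' = real n * (2 * pi * (jensen_value l (\<lambda>w. w - z) + zero_gain l z)) + I"
      have "((\<lambda>t. real n * (ln (norm (cis t - z)) * (1 - l * cos t))
              + circle_log l g t) has_integral I') {0..2*pi}"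
        unfolding I'_def
        by (intro has_integral_add has_integral_mult_right has_integral_circle_ln_linear I(2) z z0)
      moreover have "real n * (ln (norm (cis t - z)) * (1 - l * cos t))
              + circle_log l g t = circle_log l h t" for t
      proof -
        have "h (cis t) \<noteq> 0" "h (cis t) = (cis t - z) ^ n * g (cis t)"
          using less.prems(3)[of "cis t"] g(4)[of "cis t"] R by auto
        thus ?thesis
          using g(1) by (simp add: norm_mult norm_power ln_mult ln_realpow algebra_simps)
      qed
      ultimately have int: "((\<lambda>t. circle_log l h t) has_integral I') {0..2*pi}"
        by simp
      have "jensen_value l h = jensen_value l (\<lambda>w. (w - z) ^ n * g w)"
        by (rule jensen_value_cong[where S = "ball 0 R"]) (use R g(4) in auto)
      also have "\<dots> = jensen_value l (\<lambda>w. (w - z) ^ n) + jensen_value l g"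
        by (rule jensen_value_mult)
           (use z0 g0 g(2) R in \<open>auto intro!: derivative_intros holomorphic_on_imp_differentiable_at[of _ "ball 0 R"]\<close>)
      also have "jensen_value l (\<lambda>w. (w - z) ^ n) = real n * jensen_value l (\<lambda>w. w - z)"
        by (rule jensen_value_power) (use z0 in \<open>auto intro!: derivative_intros\<close>)
      \<comment> \<open>The excess of \<open>I'\<close> over the zero-free value: \<open>n\<close>
        gains of \<open>z\<close>, plus the excess that \<open>g\<close> already has.\<close>
      finally have V: "I' = 2 * pi * (jensen_value l h + real n * zero_gain l z) + (I - 2 * pi * jensen_value l g)"
        by (simp add: I'_def algebra_simps)
      have gz: "0 \<le> zero_gain l z" "zero_gain l z \<le> real n * zero_gain l z"
        using less.prems(4)[OF z] g(1) mult_right_mono[of 1 "real n" "zero_gain l z"] by auto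
      have ge: "2 * pi * (jensen_value l h + x) \<le> I'"
        if "2 * pi * (x - real n * zero_gain l z) \<le> I - 2 * pi * jensen_value l g" for x
        using that unfolding V by (simp add: algebra_simps)
      have "2 * pi * (jensen_value l h + 0) \<le> I'"
        by (rule ge, rule order_trans[of _ 0]) (use gz I(1) in \<open>auto simp: mult_le_0_iff\<close>)
      moreover have "2 * pi * (jensen_value l h + zero_gain l u) \<le> I'" if u: "norm u < 1" "h u = 0" for u
      proof (rule ge, cases "u = z")
        case True
        have "2 * pi * (zero_gain l u - real n * zero_gain l z) \<le> 0"
          using gz True by (simp add: mult_le_0_iff)
        thus "2 * pi * (zero_gain l u - real n * zero_gain l z) \<le> I - 2 * pi * jensen_value l g"
          using I(1) by linarith
      next
        case False
        hence "g u = 0" using u g(4)[of u] R by simp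
        have "2 * pi * (zero_gain l u - real n * zero_gain l z) \<le> 2 * pi * zero_gain l u"
          using gz by simp
        also have "\<dots> \<le> I - 2 * pi * jensen_value l g"
          using I(3)[OF u(1) \<open>g u = 0\<close>] by (simp add: distrib_left)
        finally show "2 * pi * (zero_gain l u - real n * zero_gain l z) \<le> I - 2 * pi * jensen_value l g" .
      qed
      ultimately show ?thesis using int by auto
    qed
  qed
qed

section \<open>Limits of means from inner circles to the unit circle\<close>

text \<open>Fatou's lemma for the nonnegative functions \<open>C - f n\<close>. The majorant
  \<open>C\<close> bounds from above only, since logarithms near zeros have no common lower bound;
  integrability of the limit comes out as part of the conclusion.\<close>

lemma integral_ge_of_pointwise_limit:
  fixes f :: "nat \<Rightarrow> 'a \<Rightarrow> real"
  assumes f: "\<And>n. integrable M (f n)" and C: "integrable M C"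
    and le: "\<And>n. AE x in M. f n x \<le> C x"
    and lim: "AE x in M. (\<lambda>n. f n x) \<longlonglongrightarrow> g x"
    and g[measurable]: "g \<in> borel_measurable M"
    and v: "\<And>n. v n \<le> integral\<^sup>L M (f n)" "v \<longlonglongrightarrow> v0"
  shows "integrable M g" "v0 \<le> integral\<^sup>L M g"
proof -
  have [measurable]: "f n \<in> borel_measurable M" "C \<in> borel_measurable M" for n
    using f C by (auto intro: borel_measurable_integrable)
  have le': "AE x in M. \<forall>n. f n x \<le> C x" using le by (simp add: AE_all_countable)
  have gC: "AE x in M. g x \<le> C x"
    using le' lim by eventually_elim (meson LIMSEQ_le_const2)
  have nn: "(\<integral>\<^sup>+x. ennreal (C x - f n x) \<partial>M) \<le> ennreal (integral\<^sup>L M C - v n)" for n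
  proof -
    have "(\<integral>\<^sup>+x. ennreal (C x - f n x) \<partial>M) = ennreal (\<integral>x. C x - f n x \<partial>M)"
      by (rule nn_integral_eq_integral) (use f C le in auto)
    also have "\<dots> \<le> ennreal (integral\<^sup>L M C - v n)"
      using f C v(1)[of n] by (simp add: ennreal_leI)
    finally show ?thesis .
  qed
  have "(\<integral>\<^sup>+x. ennreal (C x - g x) \<partial>M) = (\<integral>\<^sup>+x. liminf (\<lambda>n. ennreal (C x - f n x)) \<partial>M)"
  proof (rule nn_integral_cong_AE)
    show "AE x in M. ennreal (C x - g x) = liminf (\<lambda>n. ennreal (C x - f n x))"
      using lim
    proof eventually_elim
      case (elim x)
      have "(\<lambda>n. ennreal (C x - f n x)) \<longlonglongrightarrow> ennreal (C x - g x)"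
        by (intro tendsto_ennrealI tendsto_intros elim)
      thus ?case by (intro lim_imp_Liminf[symmetric]) auto
    qed
  qed
  also have "\<dots> \<le> liminf (\<lambda>n. \<integral>\<^sup>+x. ennreal (C x - f n x) \<partial>M)"
    by (rule nn_integral_liminf) measurable
  also have "\<dots> \<le> liminf (\<lambda>n. ennreal (integral\<^sup>L M C - v n))"
    by (rule Liminf_mono) (use nn in auto)
  also have "(\<lambda>n. ennreal (integral\<^sup>L M C - v n)) \<longlonglongrightarrow> ennreal (integral\<^sup>L M C - v0)"
    by (intro tendsto_ennrealI tendsto_intros v)
  hence "liminf (\<lambda>n. ennreal (integral\<^sup>L M C - v n)) = ennreal (integral\<^sup>L M C - v0)"
    by (intro lim_imp_Liminf) auto
  finally have le0: "(\<integral>\<^sup>+x. ennreal (C x - g x) \<partial>M) \<le> ennreal (integral\<^sup>L M C - v0)" .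
  have int: "integrable M (\<lambda>x. C x - g x)"
  proof (rule integrableI_nonneg)
    show "(\<integral>\<^sup>+x. ennreal (C x - g x) \<partial>M) < \<infinity>"
      using le0 by (rule le_less_trans) simp
  qed (use gC in auto)
  from Bochner_Integration.integrable_diff[OF C this] show g': "integrable M g" by simp
  have nonneg: "0 \<le> integral\<^sup>L M C - v0"
  proof (rule LIMSEQ_le_const)
    show "(\<lambda>n. integral\<^sup>L M C - v n) \<longlonglongrightarrow> integral\<^sup>L M C - v0" by (intro tendsto_intros v)
    have "0 \<le> integral\<^sup>L M C - v n" for n
      using v(1)[of n] integral_mono_AE[OF f C le, of n] by linarith
    thus "\<exists>N. \<forall>n\<ge>N. 0 \<le> integral\<^sup>L M C - v n" by blast
  qed
  have "ennreal (\<integral>x. C x - g x \<partial>M) \<le> ennreal (integral\<^sup>L M C - v0)"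
    using le0 nn_integral_eq_integral[OF int] gC by auto
  hence "(\<integral>x. C x - g x \<partial>M) \<le> integral\<^sup>L M C - v0" using nonneg by simp
  thus "v0 \<le> integral\<^sup>L M g" using C g' by simp
qed

lemma has_integral_imp_set_lebesgue:
  fixes f :: "real \<Rightarrow> real"
  assumes "(f has_integral I) {a..b}" "continuous_on {a..b} f"
  shows "set_integrable lborel {a..b} f" "(LBINT t:{a..b}. f t) = I"
proof -
  show i: "set_integrable lborel {a..b} f"
    by (rule borel_integrable_atLeastAtMost'[OF assms(2)])
  show "(LBINT t:{a..b}. f t) = I"
    using set_borel_integral_eq_integral(2)[OF i] assms(1) by (simp add: integral_unique)
qed

lemma cis_neq_1: "t \<in> {0<..<2*pi} \<Longrightarrow> cis t \<noteq> 1"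
proof
  assume t: "t \<in> {0<..<2*pi}" and "cis t = 1"
  hence "cos t = 1" by (metis cis.simps(1) one_complex.simps(1))
  then obtain n :: int where n: "t = of_int n * (2 * pi)" by (auto simp: cos_one_2pi_int)
  hence "0 < of_int n * (2 * pi)" "of_int n * (2 * pi) < 1 * (2 * pi)" using t by simp_all
  hence "0 < (of_int n :: real)" "of_int n < (1::real)"
    by (simp_all add: zero_less_mult_iff mult_less_cancel_right)
  thus False by simp
qed

lemma AE_cis_neq_1: "AE t in lborel. t \<in> {0..2*pi} \<longrightarrow> cis t \<noteq> 1"
  using AE_lborel_singleton[of 0] AE_lborel_singleton[of "2 * pi"]
  by eventually_elim (auto intro!: cis_neq_1)

lemma open_imp_fsigma: "open S \<Longrightarrow> fsigma (S :: complex set)"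
proof -
  assume "open S"
  then obtain C :: "nat \<Rightarrow> complex set" where "\<And>n. compact (C n)" "\<Union>(range C) = S"
    by (rule open_Union_compact_subsets) blast
  thus ?thesis unfolding fsigma_Union_compact by (intro exI[of _ C]) auto
qed

lemma circle_weight_bounds:
  fixes l :: real
  assumes "0 \<le> l" "l \<le> 1"
  shows "0 \<le> 1 - l * cos t" "1 - l * cos t \<le> 2"
proof -
  have "\<bar>l * cos t\<bar> \<le> 1 * 1"
    unfolding abs_mult using assms by (intro mult_mono) auto
  thus "0 \<le> 1 - l * cos t" "1 - l * cos t \<le> 2" by linarith+
qed

text \<open>\<open>integral_circle_ln_ge\<close> is applied to \<open>H (r * w)\<close> for radii
  \<open>r\<close> tending to 1; unlike \<open>H\<close>, these functions are holomorphic beyond the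
  unit circle. A zero \<open>w\<close> of \<open>H\<close> becomes the zero \<open>w / r\<close>,
  which is why the gain hypothesis speaks of these quotients.\<close>

lemma integral_circle_ln_ge_boundary:
  assumes H: "H holomorphic_on ball 0 1" "continuous_on (cball 0 1) H" and H0: "H 0 \<noteq> 0"
    and sph: "\<And>w. norm w = 1 \<Longrightarrow> w \<noteq> 1 \<Longrightarrow> H w \<noteq> 0"
    and l: "0 \<le> l" "l \<le> 1"
    and gain: "\<And>w r. norm w < r \<Longrightarrow> r < 1 \<Longrightarrow> H w = 0 \<Longrightarrow> zero_gain l (w / of_real r) \<ge> 0"
  shows "set_integrable lborel {0..2*pi} (\<lambda>t. circle_log l H t)"
    and "2 * pi * jensen_value l H \<le> (LBINT t:{0..2*pi}. circle_log l H t)"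
    and "\<And>z. norm z < 1 \<Longrightarrow> H z = 0 \<Longrightarrow>
      2 * pi * (jensen_value l H + zero_gain l z) \<le> (LBINT t:{0..2*pi}. circle_log l H t)"
proof -
  let ?g = "\<lambda>t. circle_log l H t"
  note w0 = circle_weight_bounds[OF l]
  have "bounded (H ` cball 0 1)"
    by (intro compact_imp_bounded compact_continuous_image H) auto
  then obtain B0 where B0: "\<And>w. norm w \<le> 1 \<Longrightarrow> norm (H w) \<le> B0"
    unfolding bounded_iff by force
  \<comment> \<open>\<open>B \<ge> 1\<close> makes \<open>ln B\<close> nonnegative, so that the
    weight may be replaced by its bound 2.\<close>
  define B where "B = max 1 B0"
  have B: "B \<ge> 1" "\<And>w. norm w \<le> 1 \<Longrightarrow> norm (H w) \<le> B"
    using B0 by (auto simp: B_def le_max_iff_disj)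
  have "countable {w \<in> ball 0 1. H w = 0}"
  proof (cases "H constant_on ball 0 1")
    case True
    hence "{w \<in> ball 0 1. H w = 0} = {}" using H0 by (force simp: constant_on_def)
    thus ?thesis by (metis countable_empty)
  next
    case False
    thus ?thesis by (intro holomorphic_countable_zeros H(1)) (auto intro: open_imp_fsigma)
  qed
  \<comment> \<open>Zeros may accumulate at the unit circle, but their moduli form a countable set,
    so radii without zeros exist arbitrarily close to 1.\<close>
  hence cnt: "countable (norm ` {w \<in> ball 0 1. H w = 0})" by simp
  have "\<exists>r. 1 - 1 / real (n + 2) < r \<and> r < 1 \<and> r \<notin> norm ` {w \<in> ball 0 1. H w = 0}" for n
    using real_interval_avoid_countable_set[OF _ cnt, of "1 - 1 / real (n + 2)" 1] by auto
  then obtain r where r: "\<And>n. 1 - 1 / real (n + 2) < r n" "\<And>n. r n < 1"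
    "\<And>n. r n \<notin> norm ` {w \<in> ball 0 1. H w = 0}" by metis
  have r0: "r n > 0" for n
  proof -
    have "1 / real (n + 2) \<le> 1" by simp
    with r(1)[of n] show ?thesis by linarith
  qed
  have rlim: "r \<longlonglongrightarrow> 1"
  proof (rule tendsto_sandwich[of "\<lambda>n. 1 - 1 / real (n + 2)" r _ "\<lambda>_. 1"])
    show "(\<lambda>n. 1 - 1 / real (n + 2)) \<longlonglongrightarrow> 1"
      using tendsto_diff[OF tendsto_const LIMSEQ_ignore_initial_segment[OF lim_1_over_n, of 2], of 1]
      by simp
  qed (use r in \<open>auto intro!: always_eventually less_imp_le\<close>)
  define h where "h = (\<lambda>n w. H (of_real (r n) * w))"
  define f where "f = (\<lambda>n t. ln (norm (h n (cis t))) * (1 - l * cos t))"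
  have hball: "of_real (r n) * w \<in> ball 0 1" if "w \<in> ball 0 (1 / r n)" for n and w :: complex
    using that r0[of n] by (auto simp: norm_mult field_simps)
  have h1: "h n holomorphic_on ball 0 (1 / r n)" for n
  proof -
    have "(H \<circ> (\<lambda>w. of_real (r n) * w)) holomorphic_on ball 0 (1 / r n)"
      by (rule holomorphic_on_compose_gen[OF _ H(1)]) (use hball in \<open>auto intro!: holomorphic_intros\<close>)
    thus ?thesis by (simp add: h_def o_def)
  qed
  have h2: "h n w \<noteq> 0" if "norm w = 1" for n w
  proof
    assume "h n w = 0"
    hence "of_real (r n) * w \<in> {w \<in> ball 0 1. H w = 0}"
      using r0[of n] r(2)[of n] that by (auto simp: h_def norm_mult)
    hence "norm (of_real (r n) * w) \<in> norm ` {w \<in> ball 0 1. H w = 0}" by blast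
    moreover have "norm (of_real (r n) * w) = r n" using that r0[of n] by (simp add: norm_mult)
    ultimately show False using r(3) by simp
  qed
  have vh: "jensen_value l (h n) = ln (norm (H 0)) - l / 2 * Re (of_real (r n) * deriv H 0 / H 0)" for n
  proof -
    have "(H has_field_derivative deriv H 0) (at (of_real (r n) * 0))"
      using holomorphic_derivI[OF H(1), of 0] by simp
    hence "((\<lambda>w. H (of_real (r n) * w)) has_field_derivative deriv H 0 * of_real (r n)) (at 0)"
      by (rule DERIV_chain2) (auto intro!: derivative_eq_intros)
    hence "deriv (h n) 0 = of_real (r n) * deriv H 0"
      by (simp add: h_def DERIV_imp_deriv mult.commute)
    thus ?thesis by (simp add: jensen_value_def h_def)
  qed
  have "\<exists>I. (f n has_integral I) {0..2*pi} \<and> 2 * pi * jensen_value l (h n) \<le> I \<and>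
     (\<forall>z. norm z < 1 \<longrightarrow> h n z = 0 \<longrightarrow> 2 * pi * (jensen_value l (h n) + zero_gain l z) \<le> I)" for n
    unfolding f_def
  proof (rule integral_circle_ln_ge[OF h1])
    show "1 / r n > 1" using r(2) r0 by (simp add: field_simps)
    show "h n 0 \<noteq> 0" using H0 by (simp add: h_def)
    fix w :: complex assume w: "norm w < 1" "h n w = 0"
    have "norm (of_real (r n) * w) < r n" using w r0[of n] by (simp add: norm_mult)
    from gain[OF this r(2)] w r0[of n] show "0 \<le> zero_gain l w" by (simp add: h_def)
  qed (use h2 in auto)
  then obtain I where I: "\<And>n. 2 * pi * jensen_value l (h n) \<le> I n" "\<And>n. (f n has_integral I n) {0..2*pi}"
    "\<And>n z. norm z < 1 \<Longrightarrow> h n z = 0 \<Longrightarrow> 2 * pi * (jensen_value l (h n) + zero_gain l z) \<le> I n"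
    by metis
  have cf: "continuous_on {0..2*pi} (f n)" for n
  proof -
    have "continuous_on {0..2*pi} (\<lambda>t. h n (cis t))"
      by (rule continuous_on_compose2[OF holomorphic_on_imp_continuous_on[OF h1]])
         (use r0[of n] r(2)[of n] in \<open>auto intro!: continuous_intros\<close>)
    thus ?thesis unfolding f_def using h2[of "cis _" n]
      by (intro continuous_intros) auto
  qed
  note fI = has_integral_imp_set_lebesgue[OF I(2) cf]
  have mem: "of_real x * cis t \<in> cball 0 1" if "0 \<le> x" "x \<le> 1" for x t
    using that by (simp add: norm_mult)
  have cH: "continuous_on UNIV (\<lambda>t. H (cis t))"
    by (rule continuous_on_compose2[OF H(2)]) (auto intro!: continuous_intros)
  have meas: "(\<lambda>t. indicator {0..2*pi} t *\<^sub>R ?g t) \<in> borel_measurable lborel"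
    using borel_measurable_continuous_onI[OF cH] by measurable
  have lim: "AE t in lborel. (\<lambda>n. indicator {0..2*pi} t *\<^sub>R f n t) \<longlonglongrightarrow> indicator {0..2*pi} t *\<^sub>R ?g t"
    using AE_cis_neq_1
  proof eventually_elim
    case (elim t)
    show ?case
    proof (cases "t \<in> {0..2*pi}")
      case True
      have "(\<lambda>n. H (of_real (r n) * cis t)) \<longlonglongrightarrow> H (cis t)"
      proof (rule continuous_on_tendsto_compose[OF H(2)])
        have "(\<lambda>n. of_real (r n) * cis t) \<longlonglongrightarrow> of_real 1 * cis t"
          by (intro tendsto_intros rlim)
        thus "(\<lambda>n. of_real (r n) * cis t) \<longlonglongrightarrow> cis t" by simp
        show "\<forall>\<^sub>F n in sequentially. of_real (r n) * cis t \<in> cball 0 1"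
          by (intro always_eventually allI mem less_imp_le r0 r(2))
      qed auto
      thus ?thesis unfolding f_def h_def
        using sph[of "cis t"] elim True by (intro tendsto_intros) auto
    qed simp
  qed
  have bnd: "indicator {0..2*pi} t *\<^sub>R f n t \<le> indicator {0..2*pi} t *\<^sub>R (2 * ln B)" for t n
  proof -
    have nm: "norm (of_real (r n) * cis t) \<le> 1" using mem[of "r n" t] r0[of n] r(2)[of n] by simp
    have "ln (norm (h n (cis t))) \<le> ln B"
      using B(1) B(2)[OF nm] h2[of "cis t" n] by (auto simp: h_def)
    hence "f n t \<le> ln B * (1 - l * cos t)"
      unfolding f_def by (intro mult_right_mono w0)
    also have "\<dots> \<le> ln B * 2" using B(1) by (intro mult_left_mono w0) auto
    finally show ?thesis by (auto simp: indicator_def)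
  qed
  have vlim: "(\<lambda>n. 2 * pi * jensen_value l (h n)) \<longlonglongrightarrow> 2 * pi * jensen_value l H"
  proof -
    have "(\<lambda>n. 2 * pi * (ln (norm (H 0)) - l / 2 * Re (of_real (r n) * deriv H 0 / H 0)))
        \<longlonglongrightarrow> 2 * pi * (ln (norm (H 0)) - l / 2 * Re (of_real 1 * deriv H 0 / H 0))"
      by (intro tendsto_intros rlim H0)
    thus ?thesis unfolding vh by (simp add: jensen_value_def)
  qed
  have fI2: "(LBINT t. indicator {0..2*pi} t *\<^sub>R f n t) = I n" for n
    using fI(2)[of n] by (simp add: set_lebesgue_integral_def)
  have v1: "2 * pi * jensen_value l (h n) \<le> (LBINT t. indicator {0..2*pi} t *\<^sub>R f n t)" for n
    unfolding fI2 by (rule I(1))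
  have Ci: "integrable lborel (\<lambda>t. indicator {0..2*pi} t *\<^sub>R (2 * ln B))"
    using borel_integrable_atLeastAtMost'[of 0 "2*pi" "\<lambda>_. 2 * ln B"] by (simp add: set_integrable_def)
  have fi: "integrable lborel (\<lambda>t. indicator {0..2*pi} t *\<^sub>R f n t)" for n
    using fI(1)[of n] by (simp add: set_integrable_def)
  note res = integral_ge_of_pointwise_limit[OF fi Ci AE_I2[OF bnd] lim meas v1 vlim]
  show "set_integrable lborel {0..2*pi} ?g" using res(1) by (simp add: set_integrable_def)
  show "2 * pi * jensen_value l H \<le> (LBINT t:{0..2*pi}. ?g t)"
    using res(2) by (simp add: set_lebesgue_integral_def)
  fix z :: complex assume z: "norm z < 1" "H z = 0"
  have z0: "z \<noteq> 0" using z H0 by auto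
  \<comment> \<open>The zero \<open>z\<close> lies inside the circle of radius \<open>r n\<close>
    only from some \<open>n\<close> on; for the earlier \<open>n\<close> the bound without gain is
    used.\<close>
  define v where "v = (\<lambda>n. 2 * pi * (jensen_value l (h n) + (if norm z < r n then zero_gain l (z / of_real (r n)) else 0)))"
  have v: "v n \<le> (LBINT t. indicator {0..2*pi} t *\<^sub>R f n t)" for n
  proof (cases "norm z < r n")
    case True
    thus ?thesis unfolding fI2 v_def using I(3)[of "z / of_real (r n)" n] r0[of n] z
      by (simp add: h_def norm_divide)
  qed (use v1[of n] in \<open>simp add: v_def\<close>)
  have "(\<lambda>n. 2 * pi * jensen_value l (h n) + 2 * pi * zero_gain l (z / of_real (r n)))
      \<longlonglongrightarrow> 2 * pi * jensen_value l H + 2 * pi * zero_gain l (z / of_real 1)"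
    unfolding zero_gain_def using z0 by (intro tendsto_intros vlim rlim) auto
  moreover have "\<forall>\<^sub>F n in sequentially. 2 * pi * jensen_value l (h n) + 2 * pi * zero_gain l (z / of_real (r n)) = v n"
    using order_tendstoD(1)[OF rlim z(1)] by eventually_elim (simp add: v_def distrib_left)
  ultimately have "v \<longlonglongrightarrow> 2 * pi * jensen_value l H + 2 * pi * zero_gain l (z / of_real 1)"
    by (rule Lim_transform_eventually)
  from integral_ge_of_pointwise_limit(2)[OF fi Ci AE_I2[OF bnd] lim meas v this]
  show "2 * pi * (jensen_value l H + zero_gain l z) \<le> (LBINT t:{0..2*pi}. ?g t)"
    by (simp add: set_lebesgue_integral_def distrib_left)
qed

text \<open>Here equality matters, because this factor is divided out again in
  \<open>circle_jensen\<close>. One direction is the boundary lemma. The other is the Fatou argument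
  for the negated logarithms of |1 - r cis t| as r tends to 1, with a majorant that comes from |1 -
  cis t| \<le> 2 |1 - r cis t|.\<close>

lemma integral_circle_ln_one_minus:
  assumes l: "0 \<le> l" "l \<le> 1"
  shows "set_integrable lborel {0..2*pi} (\<lambda>t. ln (norm (1 - cis t)) * (1 - l * cos t))"
    and "(LBINT t:{0..2*pi}. ln (norm (1 - cis t)) * (1 - l * cos t)) = 2 * pi * jensen_value l (\<lambda>w. 1 - w)"
proof -
  let ?g = "\<lambda>t. ln (norm (1 - cis t)) * (1 - l * cos t)"
  show int: "set_integrable lborel {0..2*pi} ?g"
    by (rule integral_circle_ln_ge_boundary(1)[where H = "\<lambda>w. 1 - w"])
       (use l in \<open>auto intro!: holomorphic_intros continuous_intros\<close>)
  have ge: "2 * pi * jensen_value l (\<lambda>w. 1 - w) \<le> (LBINT t:{0..2*pi}. ?g t)"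
    by (rule integral_circle_ln_ge_boundary(2)[where H = "\<lambda>w. 1 - w"])
       (use l in \<open>auto intro!: holomorphic_intros continuous_intros\<close>)
  define r where "r = (\<lambda>n. 1 - 1 / real (n + 2))"
  have r: "0 < r n" "r n < 1" for n by (auto simp: r_def)
  have rlim: "r \<longlonglongrightarrow> 1"
    using tendsto_diff[OF tendsto_const LIMSEQ_ignore_initial_segment[OF lim_1_over_n, of 2], of 1]
    by (simp add: r_def)
  let ?f = "\<lambda>n t. ln (norm (1 - of_real (r n) * cis t)) * (1 - l * cos t)"
  have nz: "1 - w \<noteq> 0" if "norm w < 1" for w :: complex using that by auto
  have nz': "1 - of_real (r n) * cis t \<noteq> 0" for n t
    by (rule nz) (use r[of n] in \<open>simp add: norm_mult\<close>)
  have v: "jensen_value l (\<lambda>w. 1 - of_real x * w) = l / 2 * x" for x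
  proof -
    have "deriv (\<lambda>w. 1 - of_real x * w) 0 = - (of_real x :: complex)"
      by (rule DERIV_imp_deriv) (auto intro!: derivative_eq_intros)
    thus ?thesis by (simp add: jensen_value_def)
  qed
  have hi: "(?f n has_integral 2 * pi * (l / 2 * r n)) {0..2*pi}" for n
    unfolding v[symmetric]
  proof (rule has_integral_circle_ln_zero_free)
    show "1 / r n > 1" using r by (simp add: field_simps)
    show "1 - of_real (r n) * w \<noteq> 0" if "w \<in> ball 0 (1 / r n)" for w :: complex
      by (rule nz) (use that r(1)[of n] in \<open>simp add: norm_mult field_simps\<close>)
  qed (auto intro!: holomorphic_intros)
  have "continuous_on {0..2*pi} (?f n)" for n
    using nz' by (intro continuous_intros) auto
  note fI = has_integral_imp_set_lebesgue[OF hi this]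
  have "set_integrable lborel {0..2*pi} (\<lambda>t. ln 2 * (1 - l * cos t) - ?g t)"
    by (intro set_integral_diff int borel_integrable_atLeastAtMost' continuous_intros)
  hence C: "integrable lborel (\<lambda>t. indicator {0..2*pi} t *\<^sub>R (ln 2 * (1 - l * cos t) - ?g t))"
    by (simp only: set_integrable_def)
  have le: "AE t in lborel. - (indicator {0..2*pi} t *\<^sub>R ?f n t) \<le>
      indicator {0..2*pi} t *\<^sub>R (ln 2 * (1 - l * cos t) - ?g t)" for n
    using AE_cis_neq_1
  proof eventually_elim
    case (elim t)
    show ?case
    proof (cases "t \<in> {0..2*pi}")
      case True
      define x y where "x = norm (1 - of_real (r n) * cis t)" and "y = norm (1 - cis t)"
      have y: "y > 0" and x: "x > 0" using elim True nz' by (simp_all add: x_def y_def)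
      have "1 - r n = norm (1::complex) - norm (of_real (r n) * cis t)"
        using r[of n] by (simp add: norm_mult)
      also have "\<dots> \<le> x" unfolding x_def by (rule norm_triangle_ineq2)
      finally have "1 - r n \<le> x" .
      moreover have "y \<le> x + norm (of_real (r n) * cis t - cis t)"
        unfolding y_def x_def using norm_triangle_ineq[of "1 - of_real (r n) * cis t" "of_real (r n) * cis t - cis t"]
        by simp
      moreover have "norm (of_real (r n) * cis t - cis t) = 1 - r n"
      proof -
        have "of_real (r n) * cis t - cis t = of_real (r n - 1) * cis t" by (simp add: algebra_simps)
        also have "norm \<dots> = 1 - r n" unfolding norm_mult norm_of_real norm_cis using r[of n] by simp
        finally show ?thesis .
      qed
      ultimately have "y / 2 \<le> x" by simp
      hence "ln (y / 2) \<le> ln x" using y x by simp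
      hence "- ln x \<le> ln 2 - ln y" using y by (simp add: ln_div)
      hence "- ln x * (1 - l * cos t) \<le> (ln 2 - ln y) * (1 - l * cos t)"
        by (rule mult_right_mono[OF _ circle_weight_bounds(1)[OF l]])
      thus ?thesis using True by (simp add: x_def y_def left_diff_distrib)
    qed simp
  qed
  have lim: "AE t in lborel. (\<lambda>n. - (indicator {0..2*pi} t *\<^sub>R ?f n t)) \<longlonglongrightarrow> - (indicator {0..2*pi} t *\<^sub>R ?g t)"
    using AE_cis_neq_1
  proof eventually_elim
    case (elim t)
    show ?case
    proof (cases "t \<in> {0..2*pi}")
      case True
      hence "(\<lambda>n. - ?f n t) \<longlonglongrightarrow> - (ln (norm (1 - of_real 1 * cis t)) * (1 - l * cos t))"
        using elim by (intro tendsto_intros rlim) auto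
      thus ?thesis using True by simp
    qed simp
  qed
  have vlim: "(\<lambda>n. - (2 * pi * (l / 2 * r n))) \<longlonglongrightarrow> - (2 * pi * (l / 2 * 1))"
    by (intro tendsto_intros rlim)
  have fi: "integrable lborel (\<lambda>t. - (indicator {0..2*pi} t *\<^sub>R ?f n t))" for n
    using fI(1)[of n] unfolding set_integrable_def by (rule integrable_minus)
  have gm: "(\<lambda>t. - (indicator {0..2*pi} t *\<^sub>R ?g t)) \<in> borel_measurable lborel"
    using integrable_minus[OF int[unfolded set_integrable_def]] by (rule borel_measurable_integrable)
  have vle: "- (2 * pi * (l / 2 * r n)) \<le> (LBINT t. - (indicator {0..2*pi} t *\<^sub>R ?f n t))" for n
    using fI(2)[of n] unfolding set_lebesgue_integral_def integral_minus by (simp only: order_refl)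
  have "- (2 * pi * (l / 2 * 1)) \<le> (LBINT t. - (indicator {0..2*pi} t *\<^sub>R ?g t))"
    by (rule integral_ge_of_pointwise_limit(2)[OF fi C le lim gm vle vlim])
  hence "(LBINT t:{0..2*pi}. ?g t) \<le> 2 * pi * (l / 2 * 1)"
    by (simp add: set_lebesgue_integral_def)
  moreover have "jensen_value l (\<lambda>w. 1 - w) = l / 2 * 1"
    using v[of 1] by (simp only: of_real_1 mult_1_left)
  ultimately show "(LBINT t:{0..2*pi}. ?g t) = 2 * pi * jensen_value l (\<lambda>w. 1 - w)"
    using ge by (simp only: order_antisym)
qed

lemma set_integral_Icc_Ioo:
  fixes f :: "real \<Rightarrow> real"
  assumes "a \<le> b"
  shows "(LBINT t:{a..b}. f t) = (LBINT t:{a<..<b}. f t)"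
  using interval_integral_Icc[OF assms, of f] interval_integral_Ioo[of "ereal a" "ereal b" f] assms
  by simp

text \<open>The point 1 of the circle represents infinity of the half-plane, and polynomial growth
  of degree \<open>k\<close> there turns into the bound \<open>C / norm (1 - w) ^ k\<close>. The
  exponent \<open>Suc k\<close> in \<open>H\<close>, one more than \<open>k\<close>, forces the
  limit 0 at 1.\<close>

lemma circle_jensen:
  assumes G: "G holomorphic_on ball 0 1" "continuous_on (cball 0 1 - {1}) G" and G0: "G 0 \<noteq> 0"
    and sph: "\<And>w. norm w = 1 \<Longrightarrow> w \<noteq> 1 \<Longrightarrow> G w \<noteq> 0"
    and l: "0 \<le> l" "l \<le> 1"
    and gain: "\<And>w r. norm w < r \<Longrightarrow> r < 1 \<Longrightarrow> G w = 0 \<Longrightarrow> zero_gain l (w / of_real r) \<ge> 0"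
    and bnd: "\<And>w. norm w \<le> 1 \<Longrightarrow> w \<noteq> 1 \<Longrightarrow> norm (G w) \<le> C / norm (1 - w) ^ k"
  shows "set_integrable lborel {0<..<2*pi} (\<lambda>t. circle_log l G t)"
    and "2 * pi * jensen_value l G \<le> (LBINT t:{0<..<2*pi}. circle_log l G t)"
    and "\<And>z. norm z < 1 \<Longrightarrow> G z = 0 \<Longrightarrow> 2 * pi * (jensen_value l G + zero_gain l z) \<le>
           (LBINT t:{0<..<2*pi}. circle_log l G t)"
proof -
  \<comment> \<open>This factor makes the function continuous at \<open>1\<close>, and \<open>ln \<bar>1 - w\<bar>\<close> has exactly the zero-free mean.\<close>
  define H where "H = (\<lambda>w. if w = 1 then 0 else (1 - w) ^ Suc k * G w)"
  have Hh: "H holomorphic_on ball 0 1"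
  proof (rule holomorphic_transform)
    show "(\<lambda>w. (1 - w) ^ Suc k * G w) holomorphic_on ball 0 1" by (intro holomorphic_intros G)
  qed (auto simp: H_def)
  have Hc: "continuous_on (cball 0 1) H"
    unfolding continuous_on_eq_continuous_within
  proof
    fix x :: complex assume x: "x \<in> cball 0 1"
    show "continuous (at x within cball 0 1) H"
    proof (cases "x = 1")
      case True
      have "(H \<longlongrightarrow> 0) (at 1 within cball 0 1)"
      proof (rule Lim_null_comparison)
        show "\<forall>\<^sub>F w in at 1 within cball 0 1. norm (H w) \<le> C * norm (1 - w)"
          unfolding eventually_at_filter
        proof (intro always_eventually allI impI)
          fix w :: complex assume w: "w \<noteq> 1" "w \<in> cball 0 1"
          have "norm (H w) = norm (1 - w) ^ Suc k * norm (G w)"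
            using w by (simp add: H_def norm_mult norm_power)
          also have "\<dots> \<le> norm (1 - w) ^ Suc k * (C / norm (1 - w) ^ k)"
            using bnd[of w] w by (intro mult_left_mono) auto
          also have "\<dots> = C * norm (1 - w)" using w by simp
          finally show "norm (H w) \<le> C * norm (1 - w)" .
        qed
        have "((\<lambda>w::complex. C * norm (1 - w)) \<longlongrightarrow> C * norm (1 - (1::complex))) (at 1 within cball (0::complex) 1)"
          by (intro tendsto_intros)
        thus "((\<lambda>w. C * norm (1 - (w::complex))) \<longlongrightarrow> 0) (at 1 within cball 0 1)" by simp
      qed
      thus ?thesis using True by (simp add: continuous_within H_def)
    next
      case False
      have "continuous_on (cball 0 1 - {1}) (\<lambda>w. (1 - w) ^ Suc k * G w)"
        by (intro continuous_intros G)
      hence "continuous_on (cball 0 1 - {1}) H"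
        by (rule continuous_on_eq) (auto simp: H_def)
      hence "continuous (at x within cball 0 1 - {1}) H"
        using x False by (simp add: continuous_on_eq_continuous_within)
      moreover have "at x within cball 0 1 - {1} = at x within cball 0 1"
        by (rule at_within_nhd[of x "- {1}"]) (use False in auto)
      ultimately show ?thesis by (simp add: continuous_within)
    qed
  qed
  have H0: "H 0 \<noteq> 0" using G0 by (simp add: H_def)
  have Hs: "H w \<noteq> 0" if "norm w = 1" "w \<noteq> 1" for w using sph[OF that] that by (simp add: H_def)
  have Hg: "zero_gain l (w / of_real r) \<ge> 0" if "norm w < r" "r < 1" "H w = 0" for w r
    using gain[of w r] that by (auto simp: H_def split: if_splits)
  have HH1: "set_integrable lborel {0..2*pi} (\<lambda>t. circle_log l H t)"
    by (rule integral_circle_ln_ge_boundary(1)[OF Hh Hc H0]) (fact Hs l Hg)+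
  have HH2: "2 * pi * jensen_value l H \<le> (LBINT t:{0..2*pi}. circle_log l H t)"
    by (rule integral_circle_ln_ge_boundary(2)[OF Hh Hc H0]) (fact Hs l Hg)+
  have HHz: "2 * pi * (jensen_value l H + zero_gain l z)
           \<le> (LBINT t:{0..2*pi}. circle_log l H t)" if "norm z < 1" "H z = 0" for z
    by (rule integral_circle_ln_ge_boundary(3)[OF Hh Hc H0]) (fact Hs l Hg that)+
  note one = integral_circle_ln_one_minus[OF l]
  let ?f = "\<lambda>t. circle_log l G t"
  let ?h = "\<lambda>t. circle_log l H t - real (Suc k) * (ln (norm (1 - cis t)) * (1 - l * cos t))"
  have hi: "set_integrable lborel {0..2*pi} ?h"
    by (intro set_integral_diff set_integrable_mult_right HH1 one)
  have eq: "?h t = ?f t" if "t \<in> {0<..<2*pi}" for t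
  proof -
    have "norm (H (cis t)) = norm (1 - cis t) ^ Suc k * norm (G (cis t))" "norm (G (cis t)) > 0" "norm (1 - cis t) > 0"
      using cis_neq_1[OF that] sph[of "cis t"] by (auto simp: H_def norm_mult norm_power)
    hence "ln (norm (H (cis t))) = real (Suc k) * ln (norm (1 - cis t)) + ln (norm (G (cis t)))"
      by (simp add: ln_mult ln_realpow del: power_Suc of_nat_Suc)
    thus ?thesis by (simp add: algebra_simps)
  qed
  have "set_integrable lborel {0<..<2*pi} ?h"
    by (rule set_integrable_subset[OF hi]) auto
  thus "set_integrable lborel {0<..<2*pi} ?f"
    by (subst set_integrable_cong[OF refl refl eq[symmetric]]) auto
  have "(LBINT t:{0<..<2*pi}. ?f t) = (LBINT t:{0<..<2*pi}. ?h t)"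
    by (rule set_lebesgue_integral_cong) (auto simp only: eq sets_lborel greaterThanLessThan_borel)
  also have "\<dots> = (LBINT t:{0..2*pi}. ?h t)" by (rule set_integral_Icc_Ioo[symmetric]) auto
  also have "\<dots> = (LBINT t:{0..2*pi}. circle_log l H t)
       - (LBINT t:{0..2*pi}. real (Suc k) * (ln (norm (1 - cis t)) * (1 - l * cos t)))"
    by (intro set_integral_diff set_integrable_mult_right HH1 one)
  also have "(LBINT t:{0..2*pi}. real (Suc k) * (ln (norm (1 - cis t)) * (1 - l * cos t)))
      = real (Suc k) * (2 * pi * jensen_value l (\<lambda>w. 1 - w))"
    unfolding set_integral_mult_right one(2) by simp
  finally have int: "(LBINT t:{0<..<2*pi}. ?f t) = (LBINT t:{0..2*pi}. circle_log l H t)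
      - real (Suc k) * (2 * pi * jensen_value l (\<lambda>w. 1 - w))" .
  have "jensen_value l H = jensen_value l (\<lambda>w. (1 - w) ^ Suc k * G w)"
    by (rule jensen_value_cong[where S = "ball 0 1"]) (auto simp: H_def)
  also have "\<dots> = jensen_value l (\<lambda>w. (1 - w) ^ Suc k) + jensen_value l G"
    by (rule jensen_value_mult)
       (use G0 G in \<open>auto simp del: power_Suc intro!: derivative_intros holomorphic_on_imp_differentiable_at[of _ "ball 0 1"]\<close>)
  also have "jensen_value l (\<lambda>w. (1 - w) ^ Suc k) = real (Suc k) * jensen_value l (\<lambda>w. 1 - w)"
    by (rule jensen_value_power) (auto intro!: derivative_intros)
  finally have V: "jensen_value l H = real (Suc k) * jensen_value l (\<lambda>w. 1 - w) + jensen_value l G" .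
  show "2 * pi * jensen_value l G \<le> (LBINT t:{0<..<2*pi}. ?f t)"
    using HH2 unfolding int V by argo
  show "2 * pi * (jensen_value l G + zero_gain l z) \<le> (LBINT t:{0<..<2*pi}. ?f t)"
    if "norm z < 1" "G z = 0" for z
  proof -
    have "H z = 0" using that by (simp add: H_def)
    from HHz[OF that(1) this] show ?thesis unfolding int V by argo
  qed
qed

section \<open>From the disc to a half-plane\<close>

text \<open>With R = |z|, Re (1/z - cnj z) = Re z * (1/R^2 - 1), which is at most 1 - R^2 by the
  hypothesis on Re z, while ln (1/R) > (1 - R^2) / 2 because ln x < x - 1 at x = R^2. Geometrically,
  z lies outside the open disc with diameter [0, 1].\<close>

lemma zero_gain_pos:
  assumes z: "z \<noteq> 0" "norm z < 1" "Re z \<le> (norm z)\<^sup>2" and l: "0 \<le> l" "l \<le> 1"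
  shows "zero_gain l z > 0"
proof -
  define R where "R = norm z"
  have R: "0 < R" "R < 1" using z by (auto simp: R_def)
  have "R\<^sup>2 < 1" using R by (simp add: power_less_one_iff)
  have 1: "Re (1 / z - cnj z) = Re z * (1 / R\<^sup>2 - 1)"
    by (simp add: complex_div_cnj[of 1] Re_divide_of_real R_def algebra_simps flip: of_real_power)
  have "Re z * (1 / R\<^sup>2 - 1) \<le> R\<^sup>2 * (1 / R\<^sup>2 - 1)"
    using z(3) \<open>R\<^sup>2 < 1\<close> R by (intro mult_right_mono) (auto simp: R_def field_simps)
  also have "\<dots> = 1 - R\<^sup>2" using R by (simp add: field_simps)
  finally have "l / 2 * Re (1 / z - cnj z) \<le> l / 2 * (1 - R\<^sup>2)"
    unfolding 1 using l by (intro mult_left_mono) auto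
  also have "\<dots> \<le> 1 / 2 * (1 - R\<^sup>2)"
    using l \<open>R\<^sup>2 < 1\<close> by (intro mult_right_mono) auto
  finally have 2: "l / 2 * Re (1 / z - cnj z) \<le> (1 - R\<^sup>2) / 2" by simp
  have "ln (R\<^sup>2) < R\<^sup>2 - 1"
    using R \<open>R\<^sup>2 < 1\<close> ln_eq_minus_one[of "R\<^sup>2"] ln_le_minus_one[of "R\<^sup>2"] by fastforce
  hence "(1 - R\<^sup>2) / 2 < - ln R" using R by (simp add: ln_realpow)
  also have "- ln R = ln (1 / norm z)" using R by (simp add: R_def ln_div)
  finally show ?thesis using 2 unfolding zero_gain_def by (simp only: diff_gt_0_iff_gt)
qed

text \<open>The Cayley transform on the boundary: the circle without 1 goes to the imaginary axis,
  on which cot (t / 2) is the coordinate.\<close>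

lemma half_angle_cis:
  assumes t: "t \<in> {0<..<2*pi}"
  shows "(1 + cis t) / (1 - cis t) = \<i> * of_real (cot (t / 2))"
proof -
  define u where "u = t / 2"
  have t2: "t = 2 * u" by (simp add: u_def)
  have s: "sin u > 0" unfolding u_def using t by (intro sin_gt_zero) auto
  have e1: "1 + cis t = 2 * of_real (cos u) * cis u"
    using cos_double_cos[of u] sin_double[of u]
    by (simp only: t2 complex_eq_iff plus_complex.simps cis.simps one_complex.simps) (simp add: power2_eq_square)
  have e2: "1 - cis t = - 2 * \<i> * of_real (sin u) * cis u"
    using cos_double_sin[of u] sin_double[of u]
    by (simp only: t2 complex_eq_iff minus_complex.simps cis.simps one_complex.simps) (simp add: power2_eq_square)
  show ?thesis unfolding e1 e2 using s
    by (simp add: cot_def u_def[symmetric] field_simps cis_neq_zero)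
qed

text \<open>The Poisson kernel of the half-plane, seen from a point at distance \<open>a\<close>
  from its edge, times the transported weight 1 - l cos.\<close>

definition half_plane_kernel :: "real \<Rightarrow> real \<Rightarrow> real \<Rightarrow> real" where
  "half_plane_kernel l a t = a / pi / (a\<^sup>2 + t\<^sup>2) * (1 - l + l * (2 * a\<^sup>2 / (a\<^sup>2 + t\<^sup>2)))"

abbreviation half_plane_mean :: "real \<Rightarrow> real \<Rightarrow> real \<Rightarrow> (complex \<Rightarrow> complex) \<Rightarrow> real" where
  "half_plane_mean l a \<sigma> F \<equiv> (LBINT t. ln (norm (F (Complex \<sigma> t))) * half_plane_kernel l a t)"

text \<open>\<open>jensen_value\<close> transported by the Cayley map, whose derivative at 0 is 2 a;
  this turns the factor l / 2 into l * a.\<close>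

definition half_plane_value :: "real \<Rightarrow> real \<Rightarrow> (complex \<Rightarrow> complex) \<Rightarrow> complex \<Rightarrow> real" where
  "half_plane_value l a F z = ln (norm (F z)) - l * a * Re (deriv F z / F z)"

text \<open>The first factor is the modulus of the derivative of t \<mapsto> a cot (t / 2).
  Everything reduces to a^2 + (a cot (t/2))^2 = a^2 / sin^2 (t/2) and 1 - cos t = 2 sin^2
  (t/2).\<close>

lemma half_plane_kernel_cot:
  assumes a: "a > 0" and t: "t \<in> {0<..<2*pi}"
  shows "a / (2 * (sin (t / 2))\<^sup>2) * half_plane_kernel l a (a * cot (t / 2)) = (1 - l * cos t) / (2 * pi)"
proof -
  define s where "s = sin (t / 2)"
  have s: "s > 0" unfolding s_def using t by (intro sin_gt_zero) auto
  have c: "cos t = 1 - 2 * s\<^sup>2" using cos_double_sin[of "t / 2"] by (simp add: s_def)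
  have "a\<^sup>2 + (a * cot (t / 2))\<^sup>2 = a\<^sup>2 * ((sin (t / 2))\<^sup>2 + (cos (t / 2))\<^sup>2) / s\<^sup>2"
    using s unfolding cot_def s_def[symmetric] by (simp add: power_mult_distrib power_divide field_simps)
  hence e: "a\<^sup>2 + (a * cot (t / 2))\<^sup>2 = a\<^sup>2 / s\<^sup>2" by (simp only: sin_cos_squared_add mult_1_right)
  show ?thesis unfolding half_plane_kernel_def e s_def[symmetric] c
    using s a by (simp add: field_simps power2_eq_square)
qed

lemma cot_half_surj: "(\<lambda>t. a * cot (t / 2)) ` {0<..<2*pi} = UNIV" if "a > 0" for a :: real
proof -
  have "y \<in> (\<lambda>t. a * cot (t / 2)) ` {0<..<2*pi}" for y
  proof (rule image_eqI)
    let ?t = "pi - 2 * arctan (y / a)"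
    show "y = a * cot (?t / 2)"
    proof -
      have "cot (?t / 2) = cot (pi / 2 - arctan (y / a))" by (simp add: diff_divide_distrib)
      also have "\<dots> = tan (arctan (y / a))" by (simp add: cot_def tan_def cos_diff sin_diff)
      finally show ?thesis using that arctan[of "y / a"] by simp
    qed
    show "?t \<in> {0<..<2*pi}" using arctan_lbound[of "y / a"] arctan_ubound[of "y / a"] by simp
  qed
  thus ?thesis by blast
qed

lemma cot_half_inj: "inj_on (\<lambda>t. a * cot (t / 2)) {0<..<2*pi}" if "a > 0" for a :: real
proof (rule inj_onI)
  fix x y assume xy: "x \<in> {0<..<2*pi}" "y \<in> {0<..<2*pi}" "a * cot (x / 2) = a * cot (y / 2)"
  have s: "sin (x / 2) > 0" "sin (y / 2) > 0" using xy by (auto intro!: sin_gt_zero)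
  have "cot (x / 2) = cot (y / 2)" using xy that by simp
  hence "cos (x / 2) * sin (y / 2) = cos (y / 2) * sin (x / 2)" using s by (simp add: cot_def field_simps)
  hence s0: "sin (y / 2 - x / 2) = 0" by (simp add: sin_diff mult.commute)
  have "- pi < y / 2 - x / 2" "y / 2 - x / 2 < pi" using xy by auto
  from sin_eq_0_pi[OF this s0] have "y / 2 - x / 2 = 0" .
  thus "x = y" by simp
qed

text \<open>\<open>circle_jensen\<close> for \<open>F\<close> composed with the Cayley map
  \<open>m\<close>, followed by a substitution on the line. The centre of the disc corresponds to
  \<sigma> + a, which is why the value is taken there; the hypothesis on zeros also makes
  \<open>F\<close> nonzero at that point.\<close>

lemma half_plane_jensen:
  assumes F: "F holomorphic_on S" "open S" "\<And>s. Re s \<ge> \<sigma> \<Longrightarrow> s \<in> S"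
    and a: "a > 0" and l: "0 \<le> l" "l \<le> 1"
    and line: "\<And>s. Re s = \<sigma> \<Longrightarrow> F s \<noteq> 0"
    and zeros: "\<And>s. Re s > \<sigma> \<Longrightarrow> F s = 0 \<Longrightarrow> Re s < \<sigma> + a"
    and bnd: "\<And>s. Re s \<ge> \<sigma> \<Longrightarrow> norm (F s) \<le> C * (1 + norm s) ^ k"
  shows "integrable lborel (\<lambda>t. ln (norm (F (Complex \<sigma> t))) * half_plane_kernel l a t)"
    and "half_plane_value l a F (of_real (\<sigma> + a)) \<le> half_plane_mean l a \<sigma> F"
    and "\<And>s. Re s > \<sigma> \<Longrightarrow> F s = 0 \<Longrightarrow>
       half_plane_value l a F (of_real (\<sigma> + a)) < half_plane_mean l a \<sigma> F"
proof -
  define m where "m = (\<lambda>w. of_real \<sigma> + of_real a * ((1 + w) / (1 - w)) :: complex)"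
  define G where "G = (\<lambda>w. F (m w))"
  have Rem: "Re ((1 + w) / (1 - w)) = (1 - (norm w)\<^sup>2) / (norm (1 - w))\<^sup>2" if "w \<noteq> 1" for w
  proof -
    have "(1 + w) / (1 - w) = (1 + w) * cnj (1 - w) / of_real ((norm (1 - w))\<^sup>2)"
      using complex_div_cnj[of "1 + w" "1 - w"] by (simp only: of_real_power)
    also have "Re \<dots> = Re ((1 + w) * cnj (1 - w)) / (norm (1 - w))\<^sup>2" by (rule Re_divide_of_real)
    also have "Re ((1 + w) * cnj (1 - w)) = 1 - (norm w)\<^sup>2"
      unfolding cmod_power2 by (simp add: algebra_simps power2_eq_square)
    finally show ?thesis .
  qed
  have m1: "Re (m w) = \<sigma> + a * ((1 - (norm w)\<^sup>2) / (norm (1 - w))\<^sup>2)" if "w \<noteq> 1" for w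
    unfolding m_def plus_complex.sel times_complex.sel Rem[OF that] by simp
  have mge: "Re (m w) \<ge> \<sigma>" if "norm w \<le> 1" "w \<noteq> 1" for w
  proof -
    have "(norm w)\<^sup>2 \<le> 1" using that by (simp add: power_le_one)
    thus ?thesis using m1[OF that(2)] a by simp
  qed
  have mgt: "Re (m w) > \<sigma>" if "norm w < 1" for w
  proof -
    have "(norm w)\<^sup>2 < 1" "w \<noteq> 1" using that by (auto simp: power_less_one_iff)
    thus ?thesis using m1[of w] a by simp
  qed
  have hol: "m holomorphic_on - {1}" unfolding m_def by (intro holomorphic_intros) auto
  have "F \<circ> m holomorphic_on ball 0 1"
  proof (rule holomorphic_on_compose_gen[OF _ F(1)])
    show "m holomorphic_on ball 0 1" by (rule holomorphic_on_subset[OF hol]) auto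
    show "m ` ball 0 1 \<subseteq> S" using mgt F(3) less_imp_le by fastforce
  qed
  hence Gh: "G holomorphic_on ball 0 1" by (simp add: G_def o_def)
  have Gc: "continuous_on (cball 0 1 - {1}) G"
    unfolding G_def
  proof (rule continuous_on_compose2[OF holomorphic_on_imp_continuous_on[OF F(1)]])
    show "continuous_on (cball 0 1 - {1}) m"
      by (rule continuous_on_subset[OF holomorphic_on_imp_continuous_on[OF hol]]) auto
    show "m ` (cball 0 1 - {1}) \<subseteq> S" by (intro image_subsetI F(3) mge) auto
  qed
  have m0: "m 0 = of_real (\<sigma> + a)" by (simp add: m_def)
  have G0: "G 0 \<noteq> 0" using zeros[of "of_real (\<sigma> + a)"] a by (auto simp: G_def m0)
  have Gs: "G w \<noteq> 0" if "norm w = 1" "w \<noteq> 1" for w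
    unfolding G_def by (rule line) (use m1[OF that(2)] that in simp)
  \<comment> \<open>Re (m w) < \<sigma> + a unfolds to 1 - |w|^2 < |1 - w|^2, that is, Re w < |w|^2:
    the condition of \<open>zero_gain_pos\<close>.\<close>
  have Gz: "w \<noteq> 0 \<and> Re w \<le> (norm w)\<^sup>2" if "norm w < 1" "G w = 0" for w
  proof
    show "w \<noteq> 0" using that G0 by auto
    have w1: "w \<noteq> 1" using that by auto
    have "Re (m w) < \<sigma> + a" using zeros[OF mgt[OF that(1)]] that by (simp add: G_def)
    hence "a * ((1 - (norm w)\<^sup>2) / (norm (1 - w))\<^sup>2) < a * 1" using m1[OF w1] by simp
    hence "(1 - (norm w)\<^sup>2) / (norm (1 - w))\<^sup>2 < 1" using a by (simp only: mult_less_cancel_left_pos)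
    hence "1 - (norm w)\<^sup>2 < (norm (1 - w))\<^sup>2" using w1 by (simp add: field_simps)
    also have "(norm (1 - w))\<^sup>2 = 1 - 2 * Re w + (norm w)\<^sup>2"
      unfolding cmod_power2 by (simp add: power2_eq_square algebra_simps)
    finally show "Re w \<le> (norm w)\<^sup>2" by simp
  qed
  have gain: "zero_gain l (w / of_real r) \<ge> 0" if w: "norm w < r" "r < 1" "G w = 0" for w r
  proof (rule less_imp_le[OF zero_gain_pos[OF _ _ _ l]])
    have r: "r > 0" using w(1) norm_ge_zero[of w] by linarith
    have w': "w \<noteq> 0" "Re w \<le> (norm w)\<^sup>2" using Gz[of w] w by auto
    show "w / of_real r \<noteq> 0" using r w' by simp
    show "norm (w / of_real r) < 1" using w r by (simp add: norm_divide)
    \<comment> \<open>The condition has to persist for w / r: the real part is divided by r, the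
      squared modulus by r^2.\<close>
    have "Re w * r \<le> (norm w)\<^sup>2"
    proof (cases "Re w \<ge> 0")
      case True
      hence "Re w * r \<le> Re w * 1" using w by (intro mult_left_mono) auto
      thus ?thesis using w' by simp
    next
      case False
      hence "Re w * r \<le> 0" using r by (simp add: mult_nonpos_nonneg)
      thus ?thesis using order_trans zero_le_power2 by blast
    qed
    thus "Re (w / of_real r) \<le> (norm (w / of_real r))\<^sup>2"
      using r by (simp add: norm_divide field_simps power2_eq_square)
  qed
  \<comment> \<open>\<open>M\<close> collects two estimates on the closed disc without 1: 1 \<le> 2
    / |1 - w| for the constant part and |1 + w| \<le> 2 for the rest.\<close>
  define M where "M = 2 * (1 + \<bar>\<sigma>\<bar>) + 2 * a"
  have C0: "C \<ge> 0"
  proof (rule ccontr)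
    assume "\<not> C \<ge> 0"
    hence "C * (1 + norm (of_real \<sigma> :: complex)) ^ k < 0"
      by (intro mult_neg_pos zero_less_power) (auto intro: add_pos_nonneg)
    thus False using bnd[of "of_real \<sigma>"] norm_ge_zero[of "F (of_real \<sigma>)"] by (simp del: norm_ge_zero)
  qed
  have Gb: "norm (G w) \<le> C * M ^ k / norm (1 - w) ^ k" if w: "norm w \<le> 1" "w \<noteq> 1" for w
  proof -
    have p: "norm (1 - w) > 0" using w by simp
    have n1: "norm (1 - w) \<le> 2" "norm (1 + w) \<le> 2"
      using norm_triangle_ineq4[of 1 w] norm_triangle_ineq[of 1 w] w by auto
    have "norm (m w) \<le> \<bar>\<sigma>\<bar> + a * (norm (1 + w) / norm (1 - w))"
      unfolding m_def using a by (intro order_trans[OF norm_triangle_ineq]) (simp add: norm_mult norm_divide)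
    also have "\<dots> \<le> \<bar>\<sigma>\<bar> + a * (2 / norm (1 - w))"
      using a n1 p by (intro add_left_mono mult_left_mono divide_right_mono) auto
    finally have "1 + norm (m w) \<le> (1 + \<bar>\<sigma>\<bar>) * 1 + a * (2 / norm (1 - w))" by simp
    also have "\<dots> \<le> (1 + \<bar>\<sigma>\<bar>) * (2 / norm (1 - w)) + a * (2 / norm (1 - w))"
      using n1 p by (intro add_right_mono mult_left_mono) auto
    also have "\<dots> = M / norm (1 - w)" by (simp add: M_def add_divide_distrib algebra_simps)
    finally have "(1 + norm (m w)) ^ k \<le> (M / norm (1 - w)) ^ k" by (intro power_mono) auto
    hence "C * (1 + norm (m w)) ^ k \<le> C * (M / norm (1 - w)) ^ k"
      using C0 by (rule mult_left_mono)
    with bnd[OF mge[OF w]] show ?thesis by (simp add: G_def power_divide)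
  qed
  define I where "I = (LBINT t:{0<..<2*pi}. circle_log l G t)"
  have J1: "set_integrable lborel {0<..<2*pi} (\<lambda>t. circle_log l G t)"
    by (rule circle_jensen(1)[OF Gh Gc G0]) (fact Gs l gain Gb)+
  have J2: "2 * pi * jensen_value l G \<le> I"
    unfolding I_def by (rule circle_jensen(2)[OF Gh Gc G0]) (fact Gs l gain Gb)+
  have J3: "2 * pi * (jensen_value l G + zero_gain l z) \<le> I" if "norm z < 1" "G z = 0" for z
    unfolding I_def by (rule circle_jensen(3)[OF Gh Gc G0]) (fact Gs l gain Gb that)+
  define f where "f = (\<lambda>t. ln (norm (F (Complex \<sigma> t))) * half_plane_kernel l a t)"
  define g where "g = (\<lambda>t. a * cot (t / 2))"
  \<comment> \<open>The derivative of the decreasing substitution \<open>g\<close>; its modulus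
    turns the kernel on the line into (1 - l cos t) / (2 pi).\<close>
  define g' where "g' = (\<lambda>t. - (a / (2 * (sin (t / 2))\<^sup>2)))"
  have fg: "\<bar>g' t\<bar> * f (g t) = (1 / (2 * pi)) * (circle_log l G t)"
    if t: "t \<in> {0<..<2*pi}" for t
  proof -
    have "m (cis t) = Complex \<sigma> (g t)"
      unfolding m_def half_angle_cis[OF t] by (simp add: g_def complex_eq_iff)
    hence "\<bar>g' t\<bar> * f (g t) = ln (norm (G (cis t))) * (a / (2 * (sin (t / 2))\<^sup>2) * half_plane_kernel l a (a * cot (t / 2)))"
      using a by (simp add: f_def G_def g'_def g_def)
    thus ?thesis unfolding half_plane_kernel_cot[OF a t] by simp
  qed
  have si: "set_integrable lborel {0<..<2*pi} (\<lambda>t. \<bar>g' t\<bar> * f (g t))"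
  proof -
    have "set_integrable lborel {0<..<2*pi} (\<lambda>t. (1 / (2 * pi)) * (circle_log l G t))"
      by (rule set_integrable_mult_right[OF J1])
    thus ?thesis by (subst set_integrable_cong[OF refl refl fg]) auto
  qed
  have sI: "(LBINT t:{0<..<2*pi}. \<bar>g' t\<bar> * f (g t)) = I / (2 * pi)"
  proof -
    have "(LBINT t:{0<..<2*pi}. \<bar>g' t\<bar> * f (g t)) =
       (LBINT t:{0<..<2*pi}. (1 / (2 * pi)) * (circle_log l G t))"
      by (rule set_lebesgue_integral_cong) (auto simp only: fg sets_lborel greaterThanLessThan_borel)
    also have "\<dots> = I / (2 * pi)" unfolding set_integral_mult_right I_def by simp
    finally show ?thesis .
  qed
  have ai: "(\<lambda>t. \<bar>g' t\<bar> * f (g t)) absolutely_integrable_on {0<..<2*pi}"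
    using si unfolding set_integrable_def
    by (subst integrable_completion) (auto intro: borel_measurable_integrable)
  have "(\<lambda>t. \<bar>g' t\<bar> * f (g t)) absolutely_integrable_on {0<..<2*pi} \<and>
      integral {0<..<2*pi} (\<lambda>t. \<bar>g' t\<bar> * f (g t)) = I / (2 * pi)"
    using ai set_borel_integral_eq_integral(2)[OF si] sI by simp
  also have "?this \<longleftrightarrow> f absolutely_integrable_on (g ` {0<..<2*pi}) \<and> integral (g ` {0<..<2*pi}) f = I / (2 * pi)"
  proof (rule has_absolute_integral_change_of_variables_1')
    fix t assume t: "t \<in> {0<..<2*pi}"
    have s: "sin (t / 2) > 0" using t by (intro sin_gt_zero) auto
    have "(g has_field_derivative a * (- inverse ((sin (t / 2))\<^sup>2) * (1 / 2))) (at t)"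
      unfolding g_def
    proof (rule DERIV_cmult, rule DERIV_chain2[where f = cot])
      show "(cot has_field_derivative - inverse ((sin (t / 2))\<^sup>2)) (at (t / 2))"
        using s by (intro DERIV_cot) simp
      show "((\<lambda>t. t / 2) has_field_derivative 1 / 2) (at t)"
        by (auto intro!: derivative_eq_intros)
    qed
    from has_field_derivative_at_within[OF this] show "(g has_field_derivative g' t) (at t within {0<..<2*pi})"
      by (rule DERIV_cong) (simp add: g'_def field_simps)
  qed (use cot_half_inj[OF a] in \<open>auto simp: g_def\<close>)
  finally have fi: "f absolutely_integrable_on UNIV" "integral UNIV f = I / (2 * pi)"
    using cot_half_surj[OF a] by (auto simp: g_def)
  have cF: "continuous_on UNIV (\<lambda>t. F (Complex \<sigma> t))"
    by (rule continuous_on_compose2[OF holomorphic_on_imp_continuous_on[OF F(1)]])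
       (use F(3) in \<open>auto intro!: continuous_intros simp: Complex_eq\<close>)
  have fm: "f \<in> borel_measurable lborel"
    unfolding f_def half_plane_kernel_def
    using borel_measurable_continuous_onI[OF cF] by measurable
  have int: "integrable lborel f"
    using fi(1) fm by (simp add: set_integrable_def integrable_completion)
  have "integral\<^sup>L lborel f = I / (2 * pi)"
    using fi(2) integral_lborel[OF int] by simp
  have dG: "deriv G 0 = 2 * of_real a * deriv F (of_real (\<sigma> + a))"
  proof (rule DERIV_imp_deriv)
    have 1: "(F has_field_derivative deriv F (m 0)) (at (m 0))"
      by (rule holomorphic_derivI[OF F(1,2)]) (use F(3) mgt[of 0] in simp)
    have 2: "(m has_field_derivative 2 * of_real a) (at 0)"
      unfolding m_def by (auto intro!: derivative_eq_intros)
    show "(G has_field_derivative 2 * of_real a * deriv F (of_real (\<sigma> + a))) (at 0)"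
      using DERIV_chain2[OF 1 2] by (simp add: G_def m0 mult.commute)
  qed
  have V: "jensen_value l G = half_plane_value l a F (of_real (\<sigma> + a))"
  proof -
    have "deriv G 0 / G 0 = of_real (2 * a) * (deriv F (of_real (\<sigma> + a)) / F (of_real (\<sigma> + a)))"
      unfolding dG by (simp add: G_def m0)
    hence "Re (deriv G 0 / G 0) = 2 * a * Re (deriv F (of_real (\<sigma> + a)) / F (of_real (\<sigma> + a)))"
      by (simp only: Re_complex_of_real Im_complex_of_real times_complex.simps mult_zero_left diff_zero)
    thus ?thesis by (simp add: jensen_value_def half_plane_value_def G_def m0)
  qed
  show "integrable lborel (\<lambda>t. ln (norm (F (Complex \<sigma> t))) * half_plane_kernel l a t)"
    using int by (simp add: f_def)
  have eq: "half_plane_mean l a \<sigma> F = I / (2 * pi)"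
    using \<open>integral\<^sup>L lborel f = I / (2 * pi)\<close> by (simp add: f_def)
  show "half_plane_value l a F (of_real (\<sigma> + a)) \<le> half_plane_mean l a \<sigma> F"
    unfolding eq using J2 by (simp add: V field_simps)
  fix s assume s: "Re s > \<sigma>" "F s = 0"
  \<comment> \<open>\<open>w\<close> will be the preimage of \<open>s\<close> under
    \<open>m\<close>, so that the zero of \<open>F\<close> becomes a zero of \<open>G\<close> in the
    disc.\<close>
  define z where "z = (s - of_real \<sigma>)"
  define w where "w = (z - of_real a) / (z + of_real a)"
  have Rez: "Re z > 0" using s by (simp add: z_def)
  have za: "z + of_real a \<noteq> 0" using Rez a by (auto simp: complex_eq_iff)
  have cw: "(1 + w) / (1 - w) = z / of_real a"
  proof -
    have "1 + w = 2 * z / (z + of_real a)" "1 - w = 2 * of_real a / (z + of_real a)"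
      using za by (simp_all add: w_def field_simps)
    thus ?thesis using za a by simp
  qed
  have mw: "m w = s" unfolding m_def cw using a by (simp add: z_def)
  have "(norm (z - of_real a))\<^sup>2 < (norm (z + of_real a))\<^sup>2"
    using mult_pos_pos[OF a Rez] unfolding cmod_power2 by (simp add: power2_eq_square algebra_simps)
  hence "norm (z - of_real a) < norm (z + of_real a)" by (rule power_less_imp_less_base) simp
  hence w: "norm w < 1" using za by (simp add: w_def norm_divide)
  have Gw: "G w = 0" using s mw by (simp add: G_def)
  have "zero_gain l w > 0" using Gz[OF w Gw] w by (intro zero_gain_pos l) auto
  hence "2 * pi * zero_gain l w > 0" by simp
  hence "2 * pi * half_plane_value l a F (of_real (\<sigma> + a)) < 2 * pi * (jensen_value l G + zero_gain l w)"
    unfolding V distrib_left by simp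
  also have "\<dots> \<le> I" by (rule J3[OF w Gw])
  finally have "half_plane_value l a F (of_real (\<sigma> + a)) * (2 * pi) < I"
    unfolding mult.commute[of _ "2 * pi"] .
  moreover have "(0::real) < 2 * pi" by simp
  ultimately show "half_plane_value l a F (of_real (\<sigma> + a)) < half_plane_mean l a \<sigma> F"
    unfolding eq using pos_less_divide_eq by blast
qed

subsection \<open>The entire function \<open>(s - 1) * \<zeta>(s)\<close>\<close>

text \<open>With the convention \<open>riemann_zeta 1 = 0\<close> the product alone would be 0 at 1;
  the residue 1 has to be put in by hand.\<close>

definition zeta_reg :: "complex \<Rightarrow> complex" where
  "zeta_reg s = (if s = 1 then 1 else (s - 1) * riemann_zeta s)"

lemma riemann_zeta_holomorphic: "riemann_zeta holomorphic_on - {1}"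
  using is_riemann_zeta_riemann_zeta by (simp add: is_riemann_zeta_def)

lemma riemann_zeta_sums: "Re s > 1 \<Longrightarrow> (\<lambda>n. of_nat (Suc n) powr (- s)) sums riemann_zeta s"
  using is_riemann_zeta_riemann_zeta by (simp add: is_riemann_zeta_def)

lemma riemann_zeta_eq_dirichlet: "Re s > 1 \<Longrightarrow> riemann_zeta s = dirichlet_zeta s"
  using riemann_zeta_sums dirichlet_zeta_sums sums_unique2 by blast

text \<open>\<open>dirichlet_zeta_recursion\<close> with \<open>K = 0\<close> expresses (s - 1)
  zeta(s) by a series that is holomorphic for Re s > 0. Every term vanishes at s = 1, which yields
  the value 1 there and shows that the singularity is removable.\<close>

lemma zeta_reg_eq_suminf:
  assumes s: "Re s > 0"
  shows "zeta_reg s = 1 + (\<Sum>n. taylor_rem 1 n s)"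
proof (cases "s = 1")
  case True
  have "taylor_rem 1 n 1 = 0" for n
    by (simp add: taylor_rem_def taylor_fact_def powr_0 del: of_nat_Suc)
  thus ?thesis by (simp add: zeta_reg_def True)
next
  case False
  have "(s - 1) * riemann_zeta s = 1 + (\<Sum>n. taylor_rem 1 n s)"
  proof (rule Re_gt_analytic_unique[where S = "{s. Re s > 0} - {1}" and
      f = "\<lambda>s. (s - 1) * riemann_zeta s" and g = "\<lambda>s. 1 + (\<Sum>n. taylor_rem 1 n s)"])
    show "(\<lambda>s. (s - 1) * riemann_zeta s) holomorphic_on {s. Re s > 0} - {1}"
      by (intro holomorphic_intros holomorphic_on_subset[OF riemann_zeta_holomorphic]) auto
    show "(\<lambda>s. 1 + (\<Sum>n. taylor_rem 1 n s)) holomorphic_on {s. Re s > 0} - {1}"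
      by (intro holomorphic_intros holomorphic_on_subset[OF holomorphic_taylor_rem_suminf]) auto
    show "connected ({s. Re s > 0} - {1 :: complex})"
      by (intro connected_open_delete open_Re_gt convex_connected convex_halfspace_Re_gt) simp
    show "(s - 1) * riemann_zeta s = 1 + (\<Sum>n. taylor_rem 1 n s)" if "Re s > 1" for s
      using dirichlet_zeta_recursion[OF that, of 0] riemann_zeta_eq_dirichlet[OF that] by simp
  qed (use False s open_Re_gt in \<open>auto intro!: open_Diff\<close>)
  thus ?thesis using False by (simp add: zeta_reg_def)
qed

lemma zeta_reg_holomorphic: "zeta_reg holomorphic_on A"
proof -
  have "zeta_reg holomorphic_on (- {1}) \<union> {s. Re s > 0}"
  proof (rule holomorphic_on_Un)
    show "zeta_reg holomorphic_on - {1}"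
    proof (rule holomorphic_transform)
      show "(\<lambda>s. (s - 1) * riemann_zeta s) holomorphic_on - {1}"
        by (intro holomorphic_intros riemann_zeta_holomorphic)
    qed (auto simp: zeta_reg_def)
    show "zeta_reg holomorphic_on {s. Re s > 0}"
    proof (rule holomorphic_transform)
      show "(\<lambda>s. 1 + (\<Sum>n. taylor_rem 1 n s)) holomorphic_on {s. Re s > 0}"
        by (intro holomorphic_intros holomorphic_on_subset[OF holomorphic_taylor_rem_suminf]) auto
    qed (auto simp: zeta_reg_eq_suminf)
  qed (use open_Re_gt in auto)
  moreover have "- {1} \<union> {s. Re s > 0} = (UNIV :: complex set)" by auto
  ultimately have "zeta_reg holomorphic_on UNIV" by simp
  thus ?thesis by (rule holomorphic_on_subset) simp
qed

lemma norm_taylor_rem_one: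
  assumes "Re s > -1"
  shows "norm (taylor_rem 1 n s) \<le> norm s * norm (1 - s) * real (Suc n) powr (- Re s - 1)"
proof -
  have "taylor_fact (Suc 1) s = (1 - s) * (- s)"
    by (simp add: taylor_fact_def numeral_2_eq_2)
  with taylor_rem_bound[of 1 s n] assms show ?thesis by (simp add: norm_mult mult_ac)
qed

text \<open>On this half-plane each remainder is at most |s| |1 - s| (n + 1)^(-3/2), so the series
  grows quadratically.\<close>

lemma zeta_reg_bound:
  "\<exists>C. \<forall>s. Re s \<ge> 1 / 2 \<longrightarrow> norm (zeta_reg s) \<le> C * (1 + norm s) ^ 2"
proof -
  define Z where "Z = (\<Sum>n. real (Suc n) powr (- 3 / 2))"
  have sZ: "summable (\<lambda>n. real (Suc n) powr (- 3 / 2))" by (rule summable_Suc_powr) simp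
  have Z0: "Z \<ge> 0" unfolding Z_def by (rule suminf_nonneg[OF sZ]) simp
  have "norm (zeta_reg s) \<le> (1 + Z) * (1 + norm s) ^ 2" if s: "Re s \<ge> 1 / 2" for s
  proof -
    have le: "norm (taylor_rem 1 n s) \<le> norm s * norm (1 - s) * real (Suc n) powr (- 3 / 2)" for n
      by (rule order_trans[OF norm_taylor_rem_one]) (use s in \<open>auto intro!: mult_left_mono powr_mono\<close>)
    have "norm (\<Sum>n. taylor_rem 1 n s) \<le> (\<Sum>n. norm s * norm (1 - s) * real (Suc n) powr (- 3 / 2))"
      by (rule norm_suminf_le) (use le sZ in \<open>auto intro: summable_mult\<close>)
    also have "\<dots> = norm s * norm (1 - s) * Z" unfolding Z_def by (rule suminf_mult[OF sZ])
    also have "\<dots> \<le> (1 + norm s) * (1 + norm s) * Z"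
      using norm_triangle_ineq4[of 1 s] Z0 by (intro mult_right_mono mult_mono) auto
    finally have "norm (zeta_reg s) \<le> 1 + (1 + norm s)\<^sup>2 * Z"
      using s norm_triangle_ineq[of 1 "\<Sum>n. taylor_rem 1 n s"] 
      by (simp add: zeta_reg_eq_suminf power2_eq_square)
    moreover have "1 \<le> (1 + norm s)\<^sup>2" by (simp add: one_le_power)
    ultimately have "norm (zeta_reg s) \<le> (1 + norm s)\<^sup>2 + (1 + norm s)\<^sup>2 * Z" by linarith
    thus ?thesis by (simp add: distrib_right mult.commute)
  qed
  thus ?thesis by blast
qed

lemma DERIV_powr_diff:
  fixes c :: complex
  assumes "c \<noteq> 0"
  shows "((\<lambda>s. c powr (b - s)) has_field_derivative - Ln c * c powr (b - z)) (at z)"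
  using assms by (auto simp: powr_def intro!: derivative_eq_intros)

text \<open>Termwise differentiation at 1: the n-th remainder contributes 1/(n+1) + ln (n+1) - ln
  (n+2), and these sum to Euler's constant.\<close>

lemma deriv_zeta_reg_1: "deriv zeta_reg 1 = euler_mascheroni"
proof -
  let ?A = "ball (1::complex) (1 / 2)"
  define f where "f = (\<lambda>N s. \<Sum>n<N. taylor_rem 1 n s)"
  have Re_ge: "Re s \<ge> 1 / 2" if "s \<in> ?A" for s
    using that abs_Re_le_cmod[of "1 - s"] by (auto simp: dist_norm)
  have le: "norm (taylor_rem 1 n s) \<le> real (Suc n) powr (- 3 / 2)" if s: "s \<in> ?A" for n s
  proof -
    have "norm s \<le> 1 + 1 / 2"
      using s norm_triangle_ineq4[of 1 "1 - s"] by (simp add: dist_norm)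
    moreover have "norm (1 - s) \<le> 1 / 2" using s by (simp add: dist_norm)
    ultimately have "norm s * norm (1 - s) \<le> (1 + 1 / 2) * (1 / 2)" by (intro mult_mono) auto
    hence "norm s * norm (1 - s) * real (Suc n) powr (- Re s - 1) \<le> 1 * real (Suc n) powr (- 3 / 2)"
      using Re_ge[OF s] by (intro mult_mono powr_mono) auto
    thus ?thesis using norm_taylor_rem_one[of s n] Re_ge[OF s] by simp
  qed
  have ul: "uniform_limit ?A f (\<lambda>s. \<Sum>n. taylor_rem 1 n s) sequentially"
    unfolding f_def by (rule Weierstrass_m_test[OF le summable_Suc_powr]) auto
  have hol: "f N holomorphic_on ?A" for N
    unfolding f_def taylor_rem_def[abs_def] taylor_fact_def by (intro holomorphic_intros) auto
  have "(\<lambda>N. (deriv ^^ 1) (f N) 1) \<longlonglongrightarrow> (deriv ^^ 1) (\<lambda>s. \<Sum>n. taylor_rem 1 n s) 1"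
    by (rule higher_deriv_complex_uniform_limit[OF ul]) (use hol in auto)
  moreover have "deriv (f N) 1 = (\<Sum>n<N. inverse (of_nat (n+1)) + of_real (ln (of_nat (n+1))) - of_real (ln (of_nat (n+2))))" for N
  proof (rule DERIV_imp_deriv)
    have "(taylor_rem 1 n has_field_derivative
       inverse (of_nat (n+1)) + of_real (ln (of_nat (n+1))) - of_real (ln (of_nat (n+2)))) (at 1)" for n
    proof -
      have tr: "taylor_rem 1 n = (\<lambda>s. of_nat (Suc (Suc n)) powr (1 - s) -
         (of_nat (Suc n) powr (1 - s) + (1 - s) * of_nat (Suc n) powr (0 - s)))"
        by (auto simp: taylor_rem_def taylor_fact_def fun_eq_iff)
      have L: "Ln (of_nat (Suc k)) = of_real (ln (real (Suc k)))" for k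
        using Ln_of_real[of "real (Suc k)"] by (simp del: of_nat_Suc)
      have "(taylor_rem 1 n has_field_derivative
         (- Ln (of_nat (Suc (Suc n))) * of_nat (Suc (Suc n)) powr (1 - 1)
           - (- Ln (of_nat (Suc n)) * of_nat (Suc n) powr (1 - 1) +
               ((1 - 1) * (- Ln (of_nat (Suc n)) * of_nat (Suc n) powr (0 - 1)) + (0 - 1) * of_nat (Suc n) powr (0 - 1))))) (at 1)"
        unfolding tr
        by (intro DERIV_diff DERIV_add DERIV_mult' DERIV_powr_diff DERIV_const DERIV_ident) (simp_all del: of_nat_Suc)
      moreover have "of_nat (Suc n) powr (0 - 1) = (inverse (of_nat (n + 1)) :: complex)"
        by (simp add: powr_minus del: of_nat_Suc)
      ultimately show ?thesis
        by (elim DERIV_cong) (simp add: L del: of_nat_Suc)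
    qed
    thus "(f N has_field_derivative (\<Sum>n<N. inverse (of_nat (n+1)) + of_real (ln (of_nat (n+1))) - of_real (ln (of_nat (n+2))))) (at 1)"
      unfolding f_def by (intro DERIV_sum) auto
  qed
  moreover have "(\<lambda>N. \<Sum>n<N. inverse (of_nat (n+1)) + of_real (ln (of_nat (n+1))) - of_real (ln (of_nat (n+2)))) \<longlonglongrightarrow> (euler_mascheroni :: complex)"
    using euler_mascheroni_sum[where 'a = complex] by (simp add: sums_def)
  ultimately have d: "deriv (\<lambda>s. \<Sum>n. taylor_rem 1 n s) 1 = euler_mascheroni"
    using LIMSEQ_unique by simp
  have "deriv zeta_reg 1 = deriv (\<lambda>s. 1 + (\<Sum>n. taylor_rem 1 n s)) 1"
  proof (rule deriv_cong_ev)
    have "eventually (\<lambda>s. s \<in> {s. Re s > 0}) (nhds 1)"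
      by (rule eventually_nhds_in_open[OF open_Re_gt]) simp
    thus "eventually (\<lambda>s. zeta_reg s = 1 + (\<Sum>n. taylor_rem 1 n s)) (nhds 1)"
      by eventually_elim (simp add: zeta_reg_eq_suminf)
  qed simp
  also have "\<dots> = deriv (\<lambda>s. \<Sum>n. taylor_rem 1 n s) 1"
  proof (subst deriv_add)
    show "(\<lambda>s. \<Sum>n. taylor_rem 1 n s) field_differentiable at 1"
      using holomorphic_taylor_rem_suminf[of 1]
      by (rule holomorphic_on_imp_differentiable_at) (auto intro: open_Re_gt)
  qed auto
  finally show ?thesis using d by simp
qed

lemma riemann_zeta_real:
  assumes x: "x > 1"
  shows "riemann_zeta (of_real x) = of_real (zeta_real x)" "zeta_real x > 0"
proof -
  have p: "of_nat (Suc n) powr (- complex_of_real x) = of_real (real (Suc n) powr (- x))" for n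
    using powr_of_real[of "real (Suc n)" "-x"] by (simp del: of_nat_Suc)
  have S: "summable (\<lambda>n. real (Suc n) powr (- x))" using summable_Suc_powr[of "-x"] x by simp
  have "(\<lambda>n. complex_of_real (real (Suc n) powr (- x))) sums of_real (\<Sum>n. real (Suc n) powr (- x))"
    using summable_sums[OF S] by (rule sums_of_real)
  moreover have "(\<lambda>n. complex_of_real (real (Suc n) powr (- x))) sums riemann_zeta (of_real x)"
    using riemann_zeta_sums[of "of_real x"] x p by simp
  ultimately have eq: "riemann_zeta (of_real x) = of_real (\<Sum>n. real (Suc n) powr (- x))"
    by (rule sums_unique2[symmetric])
  thus "riemann_zeta (of_real x) = of_real (zeta_real x)" by (simp add: zeta_real_def)
  have "0 < (\<Sum>n. real (Suc n) powr (- x))" by (rule suminf_pos[OF S]) simp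
  thus "zeta_real x > 0" using eq by (simp add: zeta_real_def)
qed

lemma zeta_reg_real:
  assumes x: "x > 1"
  shows "norm (zeta_reg (of_real x)) = zeta_real x * (x - 1)"
    and "Re (deriv zeta_reg (of_real x) / zeta_reg (of_real x)) = zeta_deriv_real x / zeta_real x + 1 / (x - 1)"
proof -
  let ?z = "complex_of_real x"
  have z1: "?z \<noteq> 1" using x by auto
  have F: "zeta_reg ?z = (?z - 1) * of_real (zeta_real x)"
    using z1 riemann_zeta_real[OF x] by (simp add: zeta_reg_def)
  show "norm (zeta_reg ?z) = zeta_real x * (x - 1)"
  proof -
    have "?z - 1 = of_real (x - 1)" by simp
    thus ?thesis unfolding F norm_mult using x riemann_zeta_real(2)[OF x]
      by (simp only: norm_of_real abs_of_pos mult.commute diff_gt_0_iff_gt)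
  qed
  have "deriv zeta_reg ?z = deriv (\<lambda>s. (s - 1) * riemann_zeta s) ?z"
  proof (rule deriv_cong_ev)
    have "eventually (\<lambda>s. s \<in> - {1}) (nhds ?z)"
      by (rule eventually_nhds_in_open) (use z1 in auto)
    thus "eventually (\<lambda>s. zeta_reg s = (s - 1) * riemann_zeta s) (nhds ?z)"
      by eventually_elim (simp add: zeta_reg_def)
  qed simp
  also have "\<dots> = (?z - 1) * deriv riemann_zeta ?z + riemann_zeta ?z"
  proof (rule DERIV_imp_deriv)
    have "(riemann_zeta has_field_derivative deriv riemann_zeta ?z) (at ?z)"
      by (rule holomorphic_derivI[OF riemann_zeta_holomorphic]) (use z1 in auto)
    thus "((\<lambda>s. (s - 1) * riemann_zeta s) has_field_derivative
        (?z - 1) * deriv riemann_zeta ?z + riemann_zeta ?z) (at ?z)"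
      by (auto intro!: derivative_eq_intros)
  qed
  finally have "deriv zeta_reg ?z / zeta_reg ?z = deriv riemann_zeta ?z / of_real (zeta_real x) + of_real (1 / (x - 1))"
    unfolding F using z1 riemann_zeta_real[OF x] by (simp add: field_simps)
  thus "Re (deriv zeta_reg ?z / zeta_reg ?z) = zeta_deriv_real x / zeta_real x + 1 / (x - 1)"
    by (simp add: zeta_deriv_real_def Re_divide_of_real)
qed

section \<open>Euler product and non-vanishing on Re s \<ge> 1\<close>

text \<open>The value at n = 0 is 0, so multiplicativity holds without exception and the sum over
  \<open>UNIV\<close> is zeta.\<close>

definition nat_cpow :: "complex \<Rightarrow> nat \<Rightarrow> complex" where
  "nat_cpow s n = of_nat n powr (- s)"

lemma nat_cpow_0 [simp]: "nat_cpow s 0 = 0"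
  by (simp add: nat_cpow_def)

lemma nat_cpow_1 [simp]: "nat_cpow s (Suc 0) = 1"
  by (simp add: nat_cpow_def)

lemma nat_cpow_mult: "nat_cpow s (m * n) = nat_cpow s m * nat_cpow s n"
  by (simp add: nat_cpow_def powr_times_real)

lemma norm_nat_cpow: "norm (nat_cpow s n) = real n powr (- Re s)"
  using norm_of_nat_powr[of "n - 1" "- s"] by (cases "n = 0") (simp_all add: nat_cpow_def)

lemma summable_norm_nat_cpow: "Re s > 1 \<Longrightarrow> summable (\<lambda>n. norm (nat_cpow s n))"
  unfolding norm_nat_cpow by (simp add: summable_real_powr_iff)

lemma summable_on_nat_cpow: "Re s > 1 \<Longrightarrow> nat_cpow s summable_on A"
  using summable_on_subset[OF norm_summable_imp_summable_on[OF summable_norm_nat_cpow]] by blast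

lemma infsum_nat_cpow: "Re s > 1 \<Longrightarrow> infsum (nat_cpow s) UNIV = riemann_zeta s"
proof -
  assume s: "Re s > 1"
  have "nat_cpow s sums infsum (nat_cpow s) UNIV"
    by (intro has_sum_imp_sums has_sum_infsum summable_on_nat_cpow s)
  moreover have "nat_cpow s sums riemann_zeta s"
    using riemann_zeta_sums[OF s] sums_Suc[of "nat_cpow s" "riemann_zeta s"]
    by (simp add: nat_cpow_def)
  ultimately show ?thesis by (rule sums_unique2)
qed

definition coprime_to :: "nat set \<Rightarrow> nat set" where
  "coprime_to P = {n. n > 0 \<and> (\<forall>p\<in>P. \<not> p dvd n)}"

text \<open>The sieve of Eratosthenes: for a new prime \<open>q\<close>, the multiples of
  \<open>q\<close> in \<open>coprime_to P\<close> are \<open>q\<close> times the whole set, so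
  removing them multiplies the sum by 1 - q^(-s).\<close>

lemma infsum_coprime_to:
  assumes s: "Re s > 1" and P: "finite P" "\<And>p. p \<in> P \<Longrightarrow> prime p"
  shows "infsum (nat_cpow s) (coprime_to P) = riemann_zeta s * (\<Prod>p\<in>P. 1 - nat_cpow s p)"
  using P
proof (induction P)
  case empty
  have "infsum (nat_cpow s) (coprime_to {}) = infsum (nat_cpow s) UNIV"
    by (rule infsum_cong_neutral) (auto simp: coprime_to_def)
  thus ?case by (simp add: infsum_nat_cpow[OF s])
next
  case (insert q P)
  have q: "prime q" using insert by simp
  have un: "coprime_to P = coprime_to (insert q P) \<union> (\<lambda>n. q * n) ` coprime_to P"
  proof (intro equalityI subsetI)
    fix n assume n: "n \<in> coprime_to P"
    show "n \<in> coprime_to (insert q P) \<union> (\<lambda>n. q * n) ` coprime_to P"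
    proof (cases "q dvd n")
      case True
      then obtain m where m: "n = q * m" by (elim dvdE)
      hence "m \<in> coprime_to P" using n by (auto simp: coprime_to_def)
      thus ?thesis using m by blast
    qed (use n in \<open>auto simp: coprime_to_def\<close>)
  next
    fix n assume "n \<in> coprime_to (insert q P) \<union> (\<lambda>n. q * n) ` coprime_to P"
    thus "n \<in> coprime_to P"
    proof
      assume "n \<in> (\<lambda>n. q * n) ` coprime_to P"
      then obtain m where m: "n = q * m" "m \<in> coprime_to P" by blast
      have "\<not> p dvd n" if p: "p \<in> P" for p
      proof
        assume "p dvd n"
        moreover have "prime p" "p \<noteq> q" using p insert by auto
        ultimately have "p dvd q \<or> p dvd m" using m by (simp add: prime_dvd_mult_iff)
        thus False using \<open>p \<noteq> q\<close> \<open>prime p\<close> q p m primes_dvd_imp_eq by (auto simp: coprime_to_def)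
      qed
      thus ?thesis using m q prime_gt_0_nat by (auto simp: coprime_to_def)
    qed (auto simp: coprime_to_def)
  qed
  have "infsum (nat_cpow s) (coprime_to P) = infsum (nat_cpow s) (coprime_to (insert q P)) +
      infsum (nat_cpow s) ((\<lambda>n. q * n) ` coprime_to P)"
    by (subst un, rule infsum_Un_disjoint)
       (auto intro!: summable_on_nat_cpow s simp: coprime_to_def)
  also have "infsum (nat_cpow s) ((\<lambda>n. q * n) ` coprime_to P) = infsum (nat_cpow s \<circ> (\<lambda>n. q * n)) (coprime_to P)"
    by (rule infsum_reindex) (use q in \<open>auto simp: inj_on_def\<close>)
  also have "\<dots> = nat_cpow s q * infsum (nat_cpow s) (coprime_to P)"
    by (simp add: o_def nat_cpow_mult infsum_cmult_right')
  finally have "infsum (nat_cpow s) (coprime_to (insert q P)) =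
      infsum (nat_cpow s) (coprime_to P) - nat_cpow s q * infsum (nat_cpow s) (coprime_to P)"
    by (metis add_diff_cancel_right')
  also have "\<dots> = infsum (nat_cpow s) (coprime_to P) * (1 - nat_cpow s q)"
    by (simp add: algebra_simps)
  finally have "infsum (nat_cpow s) (coprime_to (insert q P)) = infsum (nat_cpow s) (coprime_to P) * (1 - nat_cpow s q)" .
  thus ?case using insert by (simp add: mult_ac)
qed

abbreviation euler_prod :: "complex \<Rightarrow> nat \<Rightarrow> complex" where
  "euler_prod s N \<equiv> (\<Prod>p | prime p \<and> p \<le> N. 1 - nat_cpow s p)"

text \<open>Apart from 1, a positive integer without prime factor up to N exceeds N, so the distance
  to 1 is at most a tail of an absolutely convergent series. In this form no infinite product has to
  be inverted, and a zero of zeta would contradict the limit 1 at once.\<close>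

lemma euler_product_tendsto:
  assumes s: "Re s > 1"
  shows "(\<lambda>N. riemann_zeta s * euler_prod s N) \<longlonglongrightarrow> 1"
proof -
  define g where "g = (\<lambda>n. norm (nat_cpow s n))"
  have gs: "summable g" unfolding g_def by (rule summable_norm_nat_cpow[OF s])
  have gon: "g summable_on A" for A
    unfolding g_def using summable_on_subset[OF norm_summable_imp_summable_on[of g]] gs by (simp add: g_def)
  have ginf: "infsum g UNIV = suminf g"
    using has_sum_imp_sums[OF has_sum_infsum[OF gon]] by (simp add: sums_iff)
  have "norm (riemann_zeta s * euler_prod s N - 1) \<le> suminf g - sum g {..N}"
    if N: "N \<ge> 1" for N
  proof -
    define P where "P = {p. prime p \<and> p \<le> N}"
    have fin: "finite P" unfolding P_def by (rule finite_subset[of _ "{..N}"]) auto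
    have sub: "coprime_to P - {1} \<subseteq> - {..N}"
    proof
      fix n assume n: "n \<in> coprime_to P - {1}"
      hence "n \<noteq> 1" "n > 0" by (auto simp: coprime_to_def)
      then obtain p where p: "prime p" "p dvd n" using prime_factor_nat by blast
      hence "p \<notin> P" using n by (auto simp: coprime_to_def)
      hence "p > N" using p by (auto simp: P_def)
      moreover have "p \<le> n" using p \<open>n > 0\<close> by (simp add: dvd_imp_le)
      ultimately show "n \<in> - {..N}" by simp
    qed
    have 1: "1 \<in> coprime_to P" using not_prime_1 by (auto simp: coprime_to_def P_def)
    have "infsum (nat_cpow s) (coprime_to P) = infsum (nat_cpow s) ({1} \<union> (coprime_to P - {1}))"
      using 1 by (simp add: insert_absorb)
    also have "\<dots> = infsum (nat_cpow s) {1} + infsum (nat_cpow s) (coprime_to P - {1})"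
      by (rule infsum_Un_disjoint) (auto intro!: summable_on_nat_cpow s)
    finally have "infsum (nat_cpow s) (coprime_to P) = 1 + infsum (nat_cpow s) (coprime_to P - {1})"
      by simp
    moreover have "infsum (nat_cpow s) (coprime_to P) = riemann_zeta s * (\<Prod>p\<in>P. 1 - nat_cpow s p)"
      by (rule infsum_coprime_to[OF s fin]) (simp add: P_def)
    ultimately have "riemann_zeta s * (\<Prod>p\<in>P. 1 - nat_cpow s p) - 1 = infsum (nat_cpow s) (coprime_to P - {1})"
      by (metis add_diff_cancel_left')
    also have "norm \<dots> \<le> infsum g (coprime_to P - {1})"
      unfolding g_def by (rule norm_infsum_bound) (use gon in \<open>simp add: g_def\<close>)
    also have "\<dots> \<le> infsum g (- {..N})"
      by (rule infsum_mono_neutral[OF gon gon]) (use sub in \<open>auto simp: g_def\<close>)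
    also have "\<dots> = suminf g - sum g {..N}"
    proof -
      have "infsum g ({..N} \<union> - {..N}) = infsum g {..N} + infsum g (- {..N})"
        by (rule infsum_Un_disjoint) (auto intro: gon)
      moreover have "{..N} \<union> - {..N} = UNIV" by auto
      ultimately show ?thesis using ginf by simp
    qed
    finally show ?thesis by (simp add: P_def)
  qed
  hence ev: "\<forall>\<^sub>F N in sequentially. norm (riemann_zeta s * euler_prod s N - 1)
      \<le> suminf g - sum g {..N}"
    by (rule eventually_sequentiallyI)
  have "(\<lambda>N. suminf g - sum g {..N}) \<longlonglongrightarrow> suminf g - suminf g"
    by (intro tendsto_intros summable_LIMSEQ'[OF gs])
  hence "(\<lambda>N. suminf g - sum g {..N}) \<longlonglongrightarrow> 0" by simp
  from Lim_null_comparison[OF ev this]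
  have "(\<lambda>N. riemann_zeta s * euler_prod s N - 1) \<longlonglongrightarrow> 0" .
  thus ?thesis by (rule LIM_zero_cancel)
qed

lemma riemann_zeta_nonzero_Re_gt_1: "Re s > 1 \<Longrightarrow> riemann_zeta s \<noteq> 0"
proof
  assume "Re s > 1" "riemann_zeta s = 0"
  hence "(\<lambda>N. 0) \<longlonglongrightarrow> (1::complex)" using euler_product_tendsto[of s] by simp
  thus False using LIMSEQ_unique[OF tendsto_const] zero_neq_one by blast
qed

text \<open>The logarithm of the left side is a series with terms -(r^n / n) (3 + 4 cos x + cos 2x),
  x being the angle of w^n, and 3 + 4 cos x + cos 2x = 2 (1 + cos x)^2 \<ge> 0.\<close>

lemma mertens_341:
  fixes w :: complex
  assumes r: "0 \<le> r" "r < 1" and w: "norm w = 1"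
  shows "norm (1 - of_real r :: complex) ^ 3 * norm (1 - of_real r * w) ^ 4 * norm (1 - of_real r * w\<^sup>2) \<le> 1"
proof -
  have ser: "(\<lambda>n. - (r ^ n * Re (v ^ n)) / real n) sums ln (norm (1 - of_real r * v))" 
    and nz: "1 - of_real r * v \<noteq> 0" if v: "norm v = 1" for v
  proof -
    have n1: "norm (of_real r * v) < 1" using r v by (simp add: norm_mult)
    thus nz: "1 - of_real r * v \<noteq> 0" by auto
    have "(\<lambda>n. - ((of_real r * v) ^ n) / of_nat n) sums ln (1 - of_real r * v)"
      using Ln_series'[of "- (of_real r * v)"] n1 by simp
    from sums_Re[OF this] nz show "(\<lambda>n. - (r ^ n * Re (v ^ n)) / real n) sums ln (norm (1 - of_real r * v))"
      by (simp add: power_mult_distrib Re_divide_of_nat flip: of_real_power)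
  qed
  define L where "L = (3 * ln (norm (1 - of_real r * 1 :: complex)) + 4 * ln (norm (1 - of_real r * w)) + ln (norm (1 - of_real r * w\<^sup>2)))"
  have S1: "(\<lambda>n. 3 * (- (r ^ n * Re (1 ^ n)) / real n) + 4 * (- (r ^ n * Re (w ^ n)) / real n)
      + - (r ^ n * Re ((w\<^sup>2) ^ n)) / real n) sums L"
    unfolding L_def by (intro sums_add sums_mult ser) (use w in \<open>auto simp: norm_power\<close>)
  have S2: "3 * (- (r ^ n * Re (1 ^ n)) / real n) + 4 * (- (r ^ n * Re (w ^ n)) / real n)
      + - (r ^ n * Re ((w\<^sup>2) ^ n)) / real n \<le> 0" for n
  proof -
    define e where "e = w ^ n"
    have e: "(Re e)\<^sup>2 + (Im e)\<^sup>2 = 1" using w by (simp add: e_def norm_power flip: cmod_power2)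
    have "(w\<^sup>2) ^ n = e\<^sup>2" by (simp add: e_def power_mult[symmetric] mult.commute)
    hence "Re ((w\<^sup>2) ^ n) = 2 * (Re e)\<^sup>2 - 1" using e by (simp add: power2_eq_square)
    hence "3 + 4 * Re (w ^ n) + Re ((w\<^sup>2) ^ n) = 2 * (1 + Re e)\<^sup>2"
      by (simp add: e_def power2_eq_square algebra_simps)
    hence "- (r ^ n / real n) * (3 + 4 * Re (w ^ n) + Re ((w\<^sup>2) ^ n)) \<le> 0" using r by simp
    moreover have "3 * (- (r ^ n * Re (1 ^ n)) / real n) + 4 * (- (r ^ n * Re (w ^ n)) / real n)
      + - (r ^ n * Re ((w\<^sup>2) ^ n)) / real n = - (r ^ n / real n) * (3 + 4 * Re (w ^ n) + Re ((w\<^sup>2) ^ n))"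
      by (simp add: algebra_simps)
    ultimately show ?thesis by (simp only:)
  qed
  have "L \<le> 0" by (rule sums_le[OF S2 S1 sums_zero])
  have p: "norm (1 - of_real r * v) > 0" if "norm v = 1" for v :: complex using nz[OF that] by simp
  have p': "norm (1 - of_real r :: complex) > 0" "norm (1 - of_real r * w) > 0" "norm (1 - of_real r * w\<^sup>2) > 0"
    using p[of 1] p[OF w] p[of "w\<^sup>2"] w by (auto simp: norm_power)
  have "ln (norm (1 - of_real r :: complex) ^ 3 * norm (1 - of_real r * w) ^ 4 * norm (1 - of_real r * w\<^sup>2)) = L"
    using p' unfolding L_def by (simp add: ln_mult ln_realpow)
  hence "ln (norm (1 - of_real r :: complex) ^ 3 * norm (1 - of_real r * w) ^ 4 * norm (1 - of_real r * w\<^sup>2)) \<le> ln 1"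
    using \<open>L \<le> 0\<close> by simp
  thus ?thesis using p' by (subst (asm) ln_le_cancel_iff) auto
qed

text \<open>\<open>mertens_341\<close> is used at every prime, with r = p^(-x) and w = p^(-iy). The
  finite products approximate the inverse of zeta, so the upper bound 1 for them becomes a lower
  bound here.\<close>

lemma riemann_zeta_341:
  assumes x: "x > 1"
  shows "norm (riemann_zeta (of_real x)) ^ 3 * norm (riemann_zeta (Complex x y)) ^ 4
           * norm (riemann_zeta (Complex x (2 * y))) \<ge> 1"
proof -
  define E where "E = (\<lambda>s N. \<Prod>p | prime p \<and> p \<le> N. 1 - nat_cpow s p)"
  define X where "X = norm (riemann_zeta (of_real x)) ^ 3 * norm (riemann_zeta (Complex x y)) ^ 4
           * norm (riemann_zeta (Complex x (2 * y)))"
  define Y where "Y = (\<lambda>N. norm (E (of_real x) N) ^ 3 * norm (E (Complex x y) N) ^ 4 * norm (E (Complex x (2*y)) N))"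
  have "(\<lambda>N. norm (riemann_zeta (of_real x) * E (of_real x) N) ^ 3 * norm (riemann_zeta (Complex x y) * E (Complex x y) N) ^ 4
        * norm (riemann_zeta (Complex x (2*y)) * E (Complex x (2*y)) N)) \<longlonglongrightarrow> norm (1::complex) ^ 3 * norm (1::complex) ^ 4 * norm (1::complex)"
    unfolding E_def by (intro tendsto_intros euler_product_tendsto) (use x in auto)
  hence lim: "(\<lambda>N. X * Y N) \<longlonglongrightarrow> 1"
    by (simp add: X_def Y_def norm_mult power_mult_distrib mult_ac)
  have "X * Y N \<le> X" for N
  proof -
    have "Y N = (\<Prod>p | prime p \<and> p \<le> N. norm (1 - nat_cpow (of_real x) p) ^ 3 *
        norm (1 - nat_cpow (Complex x y) p) ^ 4 * norm (1 - nat_cpow (Complex x (2*y)) p))"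
      by (simp add: Y_def E_def prod_norm[symmetric] prod.distrib prod_power_distrib)
    also have "\<dots> \<le> 1"
    proof (rule prod_le_1, safe)
      fix p :: nat assume p: "prime p"
      have p1: "p > 1" using prime_gt_1_nat[OF p] .
      define r where "r = real p powr (- x)"
      define w where "w = cis (- y * ln (real p))"
      have cp: "nat_cpow (Complex x v) p = of_real r * cis (- v * ln (real p))" for v
      proof -
        have "nat_cpow (Complex x v) p = exp (- Complex x v * of_real (ln (real p)))"
          using p1 Ln_of_real[of "real p"] by (simp add: nat_cpow_def powr_def)
        also have "\<dots> = of_real (exp (- x * ln (real p))) * cis (- v * ln (real p))"
          by (simp add: exp_eq_polar)
        finally show ?thesis using p1 by (simp add: r_def powr_def)
      qed
      have "nat_cpow (of_real x) p = of_real r" using cp[of 0] by (simp add: Complex_eq)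
      moreover have "nat_cpow (Complex x y) p = of_real r * w" by (simp add: cp w_def)
      moreover have "nat_cpow (Complex x (2 * y)) p = of_real r * w\<^sup>2"
        by (simp add: cp w_def power2_eq_square cis_mult mult.assoc)
      moreover have "r < 1" unfolding r_def using p1 x by (intro powr_less_one) auto
      ultimately show "norm (1 - nat_cpow (of_real x) p) ^ 3 *
        norm (1 - nat_cpow (Complex x y) p) ^ 4 * norm (1 - nat_cpow (Complex x (2*y)) p) \<le> 1"
        using mertens_341[of r w] by (simp add: r_def w_def)
    qed auto
    finally have "Y N \<le> 1" .
    moreover have "X \<ge> 0" by (simp add: X_def)
    ultimately show ?thesis using mult_left_mono[of "Y N" 1 X] by simp
  qed
  with lim have "1 \<le> X" using LIMSEQ_le_const2 by blast
  thus ?thesis by (simp add: X_def)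
qed

text \<open>At abscissa 1 + h the simple pole costs h^3 in the 3-4-1 inequality, whereas a zero at 1
  + iy contributes O(h^4). The product of the three \<open>zeta_reg\<close> factors would then be
  O(h^4) although it is at least a constant times h^3.\<close>

lemma zeta_reg_nonzero_Re_1: "zeta_reg (Complex 1 y) \<noteq> 0"
proof
  assume z: "zeta_reg (Complex 1 y) = 0"
  have y: "y \<noteq> 0"
  proof
    assume "y = 0"
    hence "Complex 1 y = 1" by (simp add: complex_eq_iff)
    thus False using z by (simp add: zeta_reg_def)
  qed
  define h where "h = (\<lambda>n. 1 / real (Suc n))"
  have h: "h n > 0" for n by (simp add: h_def)
  have h0: "h \<longlonglongrightarrow> 0" unfolding h_def using LIMSEQ_inverse_real_of_nat by (simp add: inverse_eq_divide)
  have cont: "isCont zeta_reg s" for s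
    using zeta_reg_holomorphic[of UNIV] continuous_on_eq_continuous_at holomorphic_on_imp_continuous_on by blast
  have lim: "(\<lambda>n. zeta_reg (Complex (1 + h n) v)) \<longlonglongrightarrow> zeta_reg (Complex 1 v)" for v
  proof -
    have "(\<lambda>n. Complex (1 + h n) v) \<longlonglongrightarrow> Complex (1 + 0) v"
      by (intro tendsto_intros h0)
    from isCont_tendsto_compose[OF cont this] show ?thesis by simp
  qed
  have "(zeta_reg has_field_derivative deriv zeta_reg (Complex 1 y)) (at (Complex 1 y))"
    by (rule holomorphic_derivI[OF zeta_reg_holomorphic[of UNIV]]) auto
  hence "((\<lambda>k. (zeta_reg (Complex 1 y + k) - zeta_reg (Complex 1 y)) / k) \<longlongrightarrow> deriv zeta_reg (Complex 1 y)) (at 0)"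
    by (simp add: DERIV_def)
  moreover have "filterlim (\<lambda>n. complex_of_real (h n)) (at 0) sequentially"
    unfolding filterlim_at using h tendsto_of_real[OF h0, where 'a = complex]
    by (auto intro!: always_eventually simp: less_imp_neq[symmetric])
  ultimately have "(\<lambda>n. (zeta_reg (Complex 1 y + of_real (h n)) - zeta_reg (Complex 1 y)) / of_real (h n)) \<longlonglongrightarrow> deriv zeta_reg (Complex 1 y)"
    by (rule filterlim_compose)
  hence quot: "(\<lambda>n. zeta_reg (Complex (1 + h n) y) / of_real (h n)) \<longlonglongrightarrow> deriv zeta_reg (Complex 1 y)"
  proof -
    have "Complex 1 y + of_real (h n) = Complex (1 + h n) y" for n by (simp add: complex_eq_iff)
    thus ?thesis using z \<open>(\<lambda>n. _) \<longlonglongrightarrow> deriv zeta_reg (Complex 1 y)\<close> by simp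
  qed
  \<comment> \<open>The exponents of h balance: 3 from the pole, -4 from the quotient, 1 from the
    last factor. The limit is 0 because of that last factor, while the next step bounds the
    expression from below.\<close>
  have "(\<lambda>n. norm (zeta_reg (Complex (1 + h n) 0)) ^ 3 * norm (zeta_reg (Complex (1 + h n) y) / of_real (h n)) ^ 4
      * (h n * norm (zeta_reg (Complex (1 + h n) (2 * y))))) \<longlonglongrightarrow>
      norm (zeta_reg (Complex 1 0)) ^ 3 * norm (deriv zeta_reg (Complex 1 y)) ^ 4 * (0 * norm (zeta_reg (Complex 1 (2 * y))))"
    by (intro tendsto_intros quot lim h0)
  moreover have "\<bar>y\<bar> ^ 4 * \<bar>2 * y\<bar> \<le> norm (zeta_reg (Complex (1 + h n) 0)) ^ 3 * norm (zeta_reg (Complex (1 + h n) y) / of_real (h n)) ^ 4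
      * (h n * norm (zeta_reg (Complex (1 + h n) (2 * y))))" for n
  proof -
    let ?z = "\<lambda>v. norm (riemann_zeta (Complex (1 + h n) v))"
    have reg: "norm (zeta_reg (Complex (1 + h n) v)) = norm (Complex (h n) v) * ?z v" for v
    proof -
      have "Complex (1 + h n) v \<noteq> 1" "Complex (1 + h n) v - 1 = Complex (h n) v" 
        using h[of n] by (auto simp: complex_eq_iff)
      thus ?thesis by (simp add: zeta_reg_def norm_mult)
    qed
    have nv: "norm (Complex (h n) v) \<ge> \<bar>v\<bar>" for v using abs_Im_le_cmod[of "Complex (h n) v"] by simp
    have "norm (Complex (h n) 0) = h n" using h[of n] by (simp add: complex_norm)
    have "of_real (1 + h n) = Complex (1 + h n) 0" by (simp add: Complex_eq)
    hence 1: "?z 0 ^ 3 * ?z y ^ 4 * ?z (2 * y) \<ge> 1"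
      using riemann_zeta_341[of "1 + h n" y] h[of n] by simp
    have "\<bar>y\<bar> ^ 4 * \<bar>2 * y\<bar> * 1 \<le> (norm (Complex (h n) y) ^ 4 * norm (Complex (h n) (2 * y))) * (?z 0 ^ 3 * ?z y ^ 4 * ?z (2 * y))"
      by (intro mult_mono 1 power_mono nv) auto
    also have "\<dots> = norm (zeta_reg (Complex (1 + h n) 0)) ^ 3 * norm (zeta_reg (Complex (1 + h n) y) / of_real (h n)) ^ 4
      * (h n * norm (zeta_reg (Complex (1 + h n) (2 * y))))"
      using h[of n] unfolding norm_divide reg \<open>norm (Complex (h n) 0) = h n\<close>
      by (simp add: field_simps power_mult_distrib power_divide) (simp add: eval_nat_numeral)
    finally show ?thesis by simp
  qed
  ultimately have "\<bar>y\<bar> ^ 4 * \<bar>2 * y\<bar> \<le> norm (zeta_reg (Complex 1 0)) ^ 3 *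
      norm (deriv zeta_reg (Complex 1 y)) ^ 4 * (0 * norm (zeta_reg (Complex 1 (2 * y))))"
    by (intro LIMSEQ_le_const) auto
  hence "\<bar>y\<bar> ^ 4 * \<bar>2 * y\<bar> \<le> 0" by simp
  thus False using y by (simp add: mult_le_0_iff)
qed

lemma zeta_reg_nonzero_Re_ge_1:
  assumes "Re s \<ge> 1"
  shows "zeta_reg s \<noteq> 0"
proof (cases "Re s = 1")
  case True
  hence "s = Complex 1 (Im s)" by (simp add: complex_eq_iff)
  thus ?thesis using zeta_reg_nonzero_Re_1 by metis
next
  case False
  hence "Re s > 1" "s \<noteq> 1" using assms by auto
  thus ?thesis using riemann_zeta_nonzero_Re_gt_1 by (simp add: zeta_reg_def)
qed

section \<open>A polynomial bound for the reciprocal\<close>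

text \<open>The terms of the series other than the leading 1 add up to at most 3/4 in modulus: 1/4
  for n = 2, and 1/2 for n \<ge> 3 by telescoping 1/n^2 \<le> 1/(n - 1) - 1/n.\<close>

lemma norm_riemann_zeta_ge:
  assumes s: "Re s \<ge> 2"
  shows "norm (riemann_zeta s) \<ge> 1 / 4"
proof -
  have "(\<lambda>n. of_nat (Suc n) powr (- s)) sums riemann_zeta s" using s by (intro riemann_zeta_sums) auto
  hence S: "(\<lambda>n. of_nat (Suc (Suc n)) powr (- s)) sums (riemann_zeta s - 1)"
    using sums_Suc_iff[of "\<lambda>n. of_nat (Suc n) powr (- s)" "riemann_zeta s - 1"] by simp
  have tele: "(\<lambda>n. 1 / real (Suc (Suc n)) - 1 / real (Suc (Suc (Suc n)))) sums (1 / real (Suc (Suc 0)) - 0)"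
  proof (rule telescope_sums')
    show "(\<lambda>n. 1 / real (Suc (Suc n))) \<longlonglongrightarrow> 0"
      using LIMSEQ_Suc[OF LIMSEQ_inverse_real_of_nat] by (simp add: inverse_eq_divide)
  qed
  define b where "b = (\<lambda>n. case n of 0 \<Rightarrow> 1 / 4 | Suc n \<Rightarrow> 1 / real (Suc (Suc n)) - 1 / real (Suc (Suc (Suc n))))"
  have b: "b sums (3 / 4)"
    using sums_Suc[of b] tele by (fastforce simp: b_def)
  have "norm (of_nat (Suc (Suc n)) powr (- s)) \<le> b n" for n
  proof -
    have "norm (of_nat (Suc (Suc n)) powr (- s)) \<le> real (Suc (Suc n)) powr (- 2)"
      unfolding norm_of_nat_powr using s by (intro powr_mono) auto
    also have "\<dots> = 1 / (real (Suc (Suc n)))\<^sup>2"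
      using powr_realpow[of "real (Suc (Suc n))" 2] by (simp add: powr_minus divide_inverse del: of_nat_Suc)
    also have "\<dots> \<le> b n"
    proof (cases n)
      case (Suc m)
      define x where "x = real m + 2"
      have x: "x > 0" by (simp add: x_def)
      have "1 / (x + 1)\<^sup>2 \<le> 1 / (x * (x + 1))"
        using x by (intro divide_left_mono) (auto simp: power2_eq_square)
      also have "\<dots> = 1 / x - 1 / (x + 1)" using x by (simp add: field_simps)
      finally show ?thesis by (simp add: b_def Suc x_def add_ac)
    qed (simp add: b_def)
    finally show ?thesis .
  qed
  hence "norm (\<Sum>n. of_nat (Suc (Suc n)) powr (- s)) \<le> suminf b"
    by (rule norm_suminf_le[OF _ sums_summable[OF b]])
  hence "norm (riemann_zeta s - 1) \<le> 3 / 4"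
    unfolding sums_unique[OF S, symmetric] sums_unique[OF b, symmetric] .
  thus ?thesis using norm_triangle_ineq2[of 1 "1 - riemann_zeta s"]
    by (simp add: norm_minus_commute)
qed

text \<open>k / (2 M - k) sends the half-plane Re k < M to the unit disc and 0 to 0, so Schwarz's
  lemma applies; solving its estimate for |g z| gives the claim, written as a product to avoid a
  quotient.\<close>

lemma borel_caratheodory:
  assumes g: "g holomorphic_on ball c R" and R: "R > 0" and gc: "g c = 0"
    and le: "\<And>z. z \<in> ball c R \<Longrightarrow> Re (g z) < M" and z: "z \<in> ball c R"
  shows "norm (g z) * (R - norm (z - c)) \<le> 2 * M * norm (z - c)"
proof -
  have M: "M > 0" using le[of c] gc R by simp
  define k where "k = (\<lambda>w. g (c + of_real R * w))"
  define \<phi> where "\<phi> = (\<lambda>w. k w / (of_real (2 * M) - k w))"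
  have mem: "c + of_real R * w \<in> ball c R" if "norm w < 1" for w
    using that R by (simp add: dist_norm norm_mult)
  have lt: "norm (k w) < norm (of_real (2 * M) - k w)" if "norm w < 1" for w
  proof -
    have "Re (k w) < M" using le[OF mem[OF that]] by (simp add: k_def)
    hence "M * Re (k w) < M * M" using M by simp
    hence "(norm (k w))\<^sup>2 < (norm (of_real (2 * M) - k w))\<^sup>2"
      unfolding cmod_power2 by (simp add: power2_eq_square algebra_simps)
    thus ?thesis by (rule power_less_imp_less_base) simp
  qed
  have kh: "k holomorphic_on ball 0 1"
  proof -
    have "g \<circ> (\<lambda>w. c + of_real R * w) holomorphic_on ball 0 1"
      by (rule holomorphic_on_compose_gen[OF _ g]) (use mem in \<open>auto intro!: holomorphic_intros\<close>)
    thus ?thesis by (simp add: k_def o_def)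
  qed
  have nz: "of_real (2 * M) - k w \<noteq> 0" if "norm w < 1" for w
    using lt[OF that] by (metis norm_ge_zero norm_zero not_less)
  define w where "w = (z - c) / of_real R"
  have w: "norm w < 1" using z R by (simp add: w_def norm_divide dist_norm norm_minus_commute)
  have kw: "k w = g z" using R by (simp add: k_def w_def)
  have "norm (\<phi> w) \<le> norm w"
  proof (rule Schwarz_Lemma(1))
    show "\<phi> holomorphic_on ball 0 1"
      unfolding \<phi>_def by (intro holomorphic_intros kh) (use nz in auto)
    show "\<phi> 0 = 0" using gc by (simp add: \<phi>_def k_def)
    show "norm (\<phi> z) < 1" if "norm z < 1" for z
      using lt[OF that] nz[OF that] by (simp add: \<phi>_def norm_divide)
  qed (fact w)
  hence "norm (g z) \<le> norm w * norm (of_real (2 * M) - g z)"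
    using nz[OF w] by (simp add: \<phi>_def norm_divide kw field_simps)
  also have "\<dots> \<le> norm w * (2 * M + norm (g z))"
    using norm_triangle_ineq4[of "of_real (2 * M)" "g z"] M by (intro mult_left_mono) auto
  finally have "norm (g z) * R \<le> norm w * (2 * M + norm (g z)) * R" using R by (intro mult_right_mono) auto
  moreover have "norm w * R = norm (z - c)" using R by (simp add: w_def norm_divide)
  hence "norm w * (2 * M + norm (g z)) * R = norm (z - c) * (2 * M + norm (g z))" by (simp add: mult_ac)
  ultimately show ?thesis by (simp add: algebra_simps)
qed

text \<open>The disc about 2 + i Im s of radius 3/2 just reaches the line Re = 1/2, so
  \<open>zeta_reg\<close> has a logarithm \<open>L\<close> on it. Its real part exceeds the one at
  the centre by less than ln X, with X polynomial in |s|. Borel-Caratheodory turns this one-sided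
  bound into a bound for |L s - L c|, and thereby bounds \<open>zeta_reg s\<close> from
  below.\<close>

lemma zeta_reg_lower_bound:
  assumes nz: "\<And>s. Re s > 1 / 2 \<Longrightarrow> zeta_reg s \<noteq> 0" and \<sigma>: "\<sigma> > 1 / 2"
  shows "\<exists>C k. \<forall>s. Re s \<ge> \<sigma> \<longrightarrow> norm (1 / zeta_reg s) \<le> C * (1 + norm s) ^ k"
proof -
  obtain C where C: "\<And>s. Re s \<ge> 1 / 2 \<Longrightarrow> norm (zeta_reg s) \<le> C * (1 + norm s) ^ 2"
    using zeta_reg_bound by blast
  \<comment> \<open>101 exceeds 25 * 4: the 25 comes from squaring 1 + |z| \<le> 5 (1 + |s|), the 4
    from the lower bound 1/4 at the centre. The 1 keeps \<open>K\<close> positive should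
    \<open>C\<close> be 0.\<close>
  define K where "K = max 1 (101 * C)"
  \<comment> \<open>\<open>A\<close> bounds the factor 2 |s - c| / (3/2 - |s - c|) of
    Borel-Caratheodory, where |s - c| = 2 - Re s \<le> 2 - \<sigma>. It becomes the exponent of
    X.\<close>
  define A where "A = 2 * (2 - \<sigma>) / (\<sigma> - 1 / 2)"
  define k where "k = nat \<lceil>A\<rceil>"
  have K1: "K \<ge> 1" by (simp add: K_def)
  have two: "norm (zeta_reg s) \<ge> 1 / 4" if s: "Re s \<ge> 2" for s
  proof -
    have s1: "s \<noteq> 1" using s by auto
    have "1 * (1 / 4) \<le> norm (s - 1) * norm (riemann_zeta s)"
      using abs_Re_le_cmod[of "s - 1"] s by (intro mult_mono norm_riemann_zeta_ge) auto
    thus ?thesis using s1 by (simp add: zeta_reg_def norm_mult)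
  qed
  have "norm (1 / zeta_reg s) \<le> (4 * K ^ k) * (1 + norm s) ^ (2 * k)" if s: "Re s \<ge> \<sigma>" for s
  proof (cases "Re s \<ge> 2")
    case True
    have "norm (1 / zeta_reg s) \<le> 4 * 1 * 1"
      using two[OF True] by (simp add: norm_divide divide_simps)
    also have "\<dots> \<le> (4 * K ^ k) * (1 + norm s) ^ (2 * k)"
      using K1 by (intro mult_mono one_le_power) auto
    finally show ?thesis .
  next
    case False
    define c where "c = Complex 2 (Im s)"
    have c2: "Re c \<ge> 2" by (simp add: c_def)
    have sc: "norm (s - c) = 2 - Re s"
      using False by (simp add: c_def cmod_def)
    have half: "Re z > 1 / 2" if "z \<in> ball c (3 / 2)" for z
      using that abs_Re_le_cmod[of "c - z"] by (auto simp: dist_norm c_def)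
    obtain L where L: "L holomorphic_on ball c (3 / 2)" "\<And>z. z \<in> ball c (3 / 2) \<Longrightarrow> exp (L z) = zeta_reg z"
      using holomorphic_logarithm_exists[of "ball c (3 / 2)" zeta_reg c] zeta_reg_holomorphic nz half
      by (metis convex_ball open_ball centre_in_ball zero_less_divide_iff zero_less_numeral)
    have Ln: "Re (L z) = ln (norm (zeta_reg z))" if "z \<in> ball c (3 / 2)" for z
      using L(2)[OF that] by (metis ln_exp norm_exp_eq_Re)
    define X where "X = K * (1 + norm s) ^ 2"
    have X1: "X \<ge> 1"
      using mult_mono[of 1 K 1 "(1 + norm s) ^ 2"] K1 by (simp add: X_def one_le_power)
    have cb: "c \<in> ball c (3 / 2)" by simp
    have sb: "s \<in> ball c (3 / 2)" using sc s \<sigma> by (simp add: dist_norm norm_minus_commute)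
    have le: "Re (L z - L c) < ln X" if z: "z \<in> ball c (3 / 2)" for z
    proof -
      have "norm z \<le> norm s + norm (c - s) + norm (z - c)"
        using norm_triangle_ineq[of "s + (c - s)" "z - c"] norm_triangle_ineq[of s "c - s"] by simp
      also have "norm (z - c) < 3 / 2" using z by (simp add: dist_norm norm_minus_commute)
      finally have "1 + norm z \<le> 5 * (1 + norm s)"
        using sc s \<sigma> norm_ge_zero[of s] abs_Re_le_cmod[of s] by (simp add: norm_minus_commute)
      hence sq: "(1 + norm z) ^ 2 \<le> (5 * (1 + norm s)) ^ 2" by (intro power_mono) auto
      have C0: "C \<ge> 0"
        using order_trans[OF norm_ge_zero C[of 1]] by (simp add: zero_le_mult_iff)
      have "norm (zeta_reg z) \<le> C * (1 + norm z) ^ 2"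
        by (rule C) (use half[OF z] in simp)
      also have "\<dots> \<le> C * (5 * (1 + norm s)) ^ 2" by (intro mult_left_mono sq C0)
      also have "\<dots> = 25 * C * (1 + norm s) ^ 2" unfolding power_mult_distrib by simp
      also have "\<dots> < K / 4 * (1 + norm s) ^ 2"
        using C0 by (intro mult_strict_right_mono zero_less_power)
          (auto simp: K_def max_def intro: add_pos_nonneg)
      finally have "norm (zeta_reg z) < X * (1 / 4)" by (simp add: X_def)
      also have "\<dots> \<le> X * norm (zeta_reg c)"
        using two[OF c2] X1 by (intro mult_left_mono) auto
      finally have "ln (norm (zeta_reg z)) < ln (X * norm (zeta_reg c))"
        using nz[OF half[OF z]] nz[of c] c2 X1 by simp
      also have "\<dots> = ln X + ln (norm (zeta_reg c))"
        using X1 nz[of c] c2 by (simp add: ln_mult)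
      finally show ?thesis using Ln[OF z] Ln[OF cb] by simp
    qed
    have "norm (L s - L c) * (3 / 2 - norm (s - c)) \<le> 2 * ln X * norm (s - c)"
      by (rule borel_caratheodory[where g = "\<lambda>z. L z - L c", OF _ _ _ le sb])
         (auto intro!: holomorphic_intros L)
    moreover have "norm (L s - L c) * (\<sigma> - 1 / 2) \<le> norm (L s - L c) * (3 / 2 - norm (s - c))"
      using s sc by (intro mult_left_mono) auto
    moreover have "2 * ln X * norm (s - c) \<le> 2 * ln X * (2 - \<sigma>)"
      using s sc X1 by (intro mult_left_mono) auto
    ultimately have "norm (L s - L c) * (\<sigma> - 1 / 2) \<le> 2 * ln X * (2 - \<sigma>)" by linarith
    hence "norm (L s - L c) \<le> A * ln X"
      using \<sigma> by (simp add: A_def field_simps)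
    also have "\<dots> \<le> real k * ln X"
      using X1 by (intro mult_right_mono) (auto simp: k_def real_nat_ceiling_ge)
    finally have "Re (L c) - Re (L s) \<le> real k * ln X"
      using abs_Re_le_cmod[of "L s - L c"] by simp
    hence "ln (norm (zeta_reg c)) \<le> ln (norm (zeta_reg s)) + ln (X ^ k)"
      using Ln[OF cb] Ln[OF sb] X1 by (simp add: ln_realpow)
    also have "\<dots> = ln (norm (zeta_reg s) * X ^ k)"
      using nz[OF half[OF sb]] X1 by (simp add: ln_mult)
    finally have "norm (zeta_reg c) \<le> norm (zeta_reg s) * X ^ k"
      using nz[of c] c2 nz[OF half[OF sb]] X1 by (subst (asm) ln_le_cancel_iff) auto
    hence "1 / 4 \<le> norm (zeta_reg s) * X ^ k" using two[OF c2] by linarith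
    hence "norm (1 / zeta_reg s) \<le> 4 * X ^ k"
      using nz[OF half[OF sb]] by (simp add: norm_divide field_simps)
    thus ?thesis by (simp add: X_def power_mult_distrib power_mult)
  qed
  thus ?thesis by blast
qed

subsection \<open>Mellin transforms and the functional equation\<close>

text \<open>Cauchy's inequality on half the radius converts the majorant \<open>g\<close> of the
  integrand into the majorant \<open>2 * g / d\<close> of its difference quotients; dominated
  convergence then differentiates under the integral.\<close>

lemma holomorphic_on_parametric_integral:
  fixes f :: "complex \<Rightarrow> 'a \<Rightarrow> complex"
  assumes S: "open S"
    and hol: "\<And>x. x \<in> space M \<Longrightarrow> (\<lambda>s. f s x) holomorphic_on S"
    and meas: "\<And>s. s \<in> S \<Longrightarrow> f s \<in> borel_measurable M"
    and bnd: "\<And>s. s \<in> S \<Longrightarrow> \<exists>d>0. \<exists>g. cball s d \<subseteq> S \<and> integrable M g \<and>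
       (\<forall>z\<in>cball s d. \<forall>x\<in>space M. norm (f z x) \<le> g x)"
  shows "(\<lambda>s. \<integral>x. f s x \<partial>M) holomorphic_on S"
  unfolding holomorphic_on_open[OF S]
proof
  fix s assume s: "s \<in> S"
  obtain d g where d: "d > 0" "cball s d \<subseteq> S" and g: "integrable M g"
      "\<And>z x. z \<in> cball s d \<Longrightarrow> x \<in> space M \<Longrightarrow> norm (f z x) \<le> g x"
    using bnd[OF s] by blast
  have int: "integrable M (f z)" if "z \<in> cball s d" for z
    by (rule Bochner_Integration.integrable_bound[OF g(1)])
       (use g(2)[OF that] meas that d in \<open>auto intro!: AE_I2 intro: order_trans[OF _ abs_ge_self]\<close>)
  define f' where "f' = (\<lambda>x. deriv (\<lambda>z. f z x) s)"
  have lip: "norm (f z x - f s x) \<le> 2 * g x / d * norm (z - s)"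
    if z: "z \<in> cball s (d / 2)" and x: "x \<in> space M" for z x
  proof (rule field_differentiable_bound[where S = "cball s (d / 2)" and f' = "deriv (\<lambda>z. f z x)"])
    fix w assume w: "w \<in> cball s (d / 2)"
    have sub: "cball w (d / 2) \<subseteq> cball s d"
    proof
      fix v assume "v \<in> cball w (d / 2)"
      hence "dist s v \<le> d" using w dist_triangle[of s v w] by simp
      thus "v \<in> cball s d" by simp
    qed
    have wS: "w \<in> S" using sub d by force
    show "((\<lambda>z. f z x) has_field_derivative deriv (\<lambda>z. f z x) w) (at w within cball s (d / 2))"
      using holomorphic_derivI[OF hol[OF x] S wS] has_field_derivative_at_within by blast
    have "norm ((deriv ^^ 1) (\<lambda>z. f z x) w) \<le> fact 1 * g x / (d / 2) ^ 1"
    proof (rule Cauchy_inequality)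
      show "(\<lambda>z. f z x) holomorphic_on ball w (d / 2)"
        by (rule holomorphic_on_subset[OF hol[OF x]]) (use sub d ball_subset_cball in fast)
      show "continuous_on (cball w (d / 2)) (\<lambda>z. f z x)"
        by (rule holomorphic_on_imp_continuous_on[OF holomorphic_on_subset[OF hol[OF x]]]) (use sub d in fast)
      show "norm (f v x) \<le> g x" if "norm (w - v) = d / 2" for v
        by (rule g(2)[OF _ x]) (use sub that in \<open>force simp: dist_norm\<close>)
    qed (use d in auto)
    thus "norm (deriv (\<lambda>z. f z x) w) \<le> 2 * g x / d" by (simp add: mult.commute)
  qed (use z d in auto)
  have lim: "(\<lambda>i. (f (s + X i) x - f s x) / X i) \<longlonglongrightarrow> f' x"
    if X: "\<And>i. X i \<noteq> 0" "X \<longlonglongrightarrow> 0" and x: "x \<in> space M" for X x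
  proof -
    have "((\<lambda>z. f z x) has_field_derivative f' x) (at s)"
      unfolding f'_def by (rule holomorphic_derivI[OF hol[OF x] S s])
    hence "((\<lambda>h. (f (s + h) x - f s x) / h) \<longlongrightarrow> f' x) (at 0)" by (simp add: DERIV_def)
    thus ?thesis using X by (auto simp: tendsto_at_iff_sequentially o_def)
  qed
  have "((\<lambda>s. \<integral>x. f s x \<partial>M) has_field_derivative (\<integral>x. f' x \<partial>M)) (at s)"
    unfolding DERIV_def tendsto_at_iff_sequentially
  proof (intro allI impI)
    fix X :: "nat \<Rightarrow> complex" assume X: "\<forall>i. X i \<in> UNIV - {0}" "X \<longlonglongrightarrow> 0"
    from X(2) d(1) have "\<forall>\<^sub>F i in sequentially. dist (X i) 0 < d / 2"
      by (intro tendstoD) auto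
    then obtain N where N: "\<And>i. i \<ge> N \<Longrightarrow> norm (X i) < d / 2"
      by (auto simp: eventually_sequentially)
    \<comment> \<open>Only a tail of the sequence satisfies |X i| < d / 2, and dominated convergence
      wants the bound at every index.\<close>
    define Y where "Y = (\<lambda>i. X (i + N))"
    have Y: "Y i \<noteq> 0" "norm (Y i) < d / 2" for i using X(1) N by (auto simp: Y_def)
    have Y0: "Y \<longlonglongrightarrow> 0" unfolding Y_def by (rule LIMSEQ_ignore_initial_segment[OF X(2)])
    have mem: "s + Y i \<in> cball s (d / 2)" for i using Y(2)[of i] by (simp add: dist_norm)
    have mem': "s + Y i \<in> cball s d" "s \<in> cball s d" for i using mem[of i] d by (auto simp: dist_norm)
    have m: "(\<lambda>x. (f (s + Y i) x - f s x) / Y i) \<in> borel_measurable M" for i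
      using meas[OF subsetD[OF d(2) mem'(1)], of i] meas[OF s] by (intro borel_measurable_divide borel_measurable_diff) auto
    have "(\<lambda>i. \<integral>x. (f (s + Y i) x - f s x) / Y i \<partial>M) \<longlonglongrightarrow> (\<integral>x. f' x \<partial>M)"
    proof (rule integral_dominated_convergence)
      show "integrable M (\<lambda>x. 2 * g x / d)" using g(1) by simp
      show "AE x in M. (\<lambda>i. (f (s + Y i) x - f s x) / Y i) \<longlonglongrightarrow> f' x"
        using lim[OF Y(1) Y0] by (intro AE_I2)
      show "AE x in M. norm ((f (s + Y i) x - f s x) / Y i) \<le> 2 * g x / d" for i
      proof (rule AE_I2)
        fix x assume x: "x \<in> space M"
        show "norm ((f (s + Y i) x - f s x) / Y i) \<le> 2 * g x / d"
          using lip[OF mem x, of i] Y(1)[of i] by (simp add: norm_divide divide_le_eq)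
      qed
      show "f' \<in> borel_measurable M"
        by (rule borel_measurable_LIMSEQ_metric[OF m]) (rule lim[OF Y(1) Y0])
    qed (fact m)
    moreover have "(\<integral>x. (f (s + Y i) x - f s x) / Y i \<partial>M) =
       ((\<integral>x. f (s + Y i) x \<partial>M) - (\<integral>x. f s x \<partial>M)) / Y i" for i
      using int[OF mem'(1)] int[OF mem'(2)] by simp
    ultimately have "(\<lambda>i. ((\<integral>x. f (s + Y i) x \<partial>M) - (\<integral>x. f s x \<partial>M)) / Y i) \<longlonglongrightarrow> (\<integral>x. f' x \<partial>M)"
      by (simp only:)
    thus "((\<lambda>h. ((\<integral>x. f (s + h) x \<partial>M) - (\<integral>x. f s x \<partial>M)) / h) \<circ> X) \<longlonglongrightarrow> (\<integral>x. f' x \<partial>M)"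
      unfolding Y_def o_def by (rule LIMSEQ_offset)
  qed
  thus "\<exists>f'. ((\<lambda>s. \<integral>x. f s x \<partial>M) has_field_derivative f') (at s)" by blast
qed

section \<open>Mellin transforms of real functions\<close>

lemma norm_of_real_powr: "x > 0 \<Longrightarrow> norm (complex_of_real x powr s) = x powr Re s"
  by (simp add: norm_powr_real_powr)

lemma borel_measurable_of_real_powr [measurable]:
  "(\<lambda>x. complex_of_real x powr s) \<in> borel_measurable borel"
  by (simp add: powr_def) measurable

definition mellin_on :: "real set \<Rightarrow> (real \<Rightarrow> real) \<Rightarrow> complex \<Rightarrow> complex" where
  "mellin_on A f s = (LBINT x:A. of_real x powr (s - 1) * of_real (f x))"

abbreviation mellin_integrand :: "(real \<Rightarrow> real) \<Rightarrow> complex \<Rightarrow> real \<Rightarrow> complex" where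
  "mellin_integrand f s \<equiv> (\<lambda>x. of_real x powr (s - 1) * of_real (f x))"

lemma set_integrable_mellin:
  assumes A: "A \<in> sets borel" "A \<subseteq> {0<..}" and f[measurable]: "f \<in> borel_measurable borel"
    and int: "set_integrable lborel A (\<lambda>x. x powr (Re s - 1) * f x)"
  shows "set_integrable lborel A (mellin_integrand f s)"
proof (rule set_integrable_bound[OF int])
  note [measurable] = A(1)
  show "set_borel_measurable lborel A (mellin_integrand f s)"
    unfolding set_borel_measurable_def by measurable
  show "AE x in lborel. x \<in> A \<longrightarrow> norm (of_real x powr (s - 1) * complex_of_real (f x)) \<le> norm (x powr (Re s - 1) * f x)"
    using A(2) by (intro AE_I2) (auto simp: norm_mult norm_of_real_powr abs_mult)
qed

text \<open>On a disc about \<open>s\<close> the power of x is dominated by the sum of the two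
  extreme powers, the larger exponent serving x \<ge> 1 and the smaller one x < 1. Integrability at
  real exponents therefore suffices.\<close>

lemma mellin_on_holomorphic:
  assumes A: "A \<in> sets borel" "A \<subseteq> {0<..}" and f[measurable]: "f \<in> borel_measurable borel"
    and I: "open I" and int: "\<And>r. r \<in> I \<Longrightarrow> set_integrable lborel A (\<lambda>x. x powr (r - 1) * f x)"
  shows "mellin_on A f holomorphic_on {s. Re s \<in> I}"
  unfolding mellin_on_def set_lebesgue_integral_def
proof (rule holomorphic_on_parametric_integral)
  note [measurable] = A(1)
  have "open (Re -` I)" by (rule open_vimage[OF I]) (intro continuous_intros)
  thus "open {s. Re s \<in> I}" by (simp add: vimage_def)
  show "(\<lambda>s. indicat_real A x *\<^sub>R (of_real x powr (s - 1) * complex_of_real (f x))) holomorphic_on {s. Re s \<in> I}" for x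
    unfolding scaleR_conv_of_real by (cases "x \<in> A") (use A(2) in \<open>auto intro!: holomorphic_intros\<close>)
  show "(\<lambda>x. indicat_real A x *\<^sub>R (of_real x powr (s - 1) * complex_of_real (f x))) \<in> borel_measurable lborel" for s
    by measurable
  fix s :: complex assume "s \<in> {s. Re s \<in> I}"
  then obtain d where d: "d > 0" "cball (Re s) d \<subseteq> I" using I open_contains_cball by blast
  define g where "g = (\<lambda>x. indicat_real A x * \<bar>x powr (Re s - d - 1) * f x\<bar> + indicat_real A x * \<bar>x powr (Re s + d - 1) * f x\<bar>)"
  have "integrable lborel g"
    unfolding g_def
  proof (rule Bochner_Integration.integrable_add)
    have "Re s - d \<in> I" "Re s + d \<in> I" using d by (auto simp: dist_norm intro!: subsetD[OF d(2)])
    from this[THEN int, THEN set_integrable_abs]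
    show "integrable lborel (\<lambda>x. indicat_real A x * \<bar>x powr (Re s - d - 1) * f x\<bar>)"
      "integrable lborel (\<lambda>x. indicat_real A x * \<bar>x powr (Re s + d - 1) * f x\<bar>)"
      by (auto simp: set_integrable_def)
  qed
  moreover have "norm (indicat_real A x *\<^sub>R (of_real x powr (z - 1) * complex_of_real (f x))) \<le> g x"
    if z: "z \<in> cball s d" for z x
  proof (cases "x \<in> A")
    case True
    hence x: "x > 0" using A(2) by auto
    have z': "Re s - d \<le> Re z" "Re z \<le> Re s + d"
      using z abs_Re_le_cmod[of "s - z"] by (auto simp: dist_norm)
    have "x powr (Re z - 1) \<le> x powr (Re s - d - 1) + x powr (Re s + d - 1)"
    proof (cases "x \<ge> 1")
      case True
      hence "x powr (Re z - 1) \<le> x powr (Re s + d - 1)" using z' by (intro powr_mono) auto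
      thus ?thesis by (simp add: add_increasing)
    next
      case False
      hence "x powr (Re z - 1) \<le> x powr (Re s - d - 1)" using z' x by (intro powr_mono') auto
      thus ?thesis by (simp add: add_increasing2)
    qed
    hence "x powr (Re z - 1) * \<bar>f x\<bar> \<le> (x powr (Re s - d - 1) + x powr (Re s + d - 1)) * \<bar>f x\<bar>"
      by (intro mult_right_mono) auto
    thus ?thesis using True x by (simp add: g_def norm_mult norm_of_real_powr abs_mult distrib_right)
  qed (simp add: g_def)
  moreover have "cball s d \<subseteq> {s. Re s \<in> I}"
  proof
    fix z assume "z \<in> cball s d"
    hence "Re z \<in> cball (Re s) d" using abs_Re_le_cmod[of "s - z"] by (auto simp: dist_norm)
    thus "z \<in> {s. Re s \<in> I}" using d by auto
  qed
  ultimately show "\<exists>d>0. \<exists>g. cball s d \<subseteq> {s. Re s \<in> I} \<and> integrable lborel g \<and>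
       (\<forall>z\<in>cball s d. \<forall>x\<in>space lborel. norm (indicat_real A x *\<^sub>R (of_real x powr (z - 1) * complex_of_real (f x))) \<le> g x)"
    using d(1) by blast
qed

lemma mellin_on_scale:
  assumes c: "c > 0"
  shows "mellin_on {0<..} (\<lambda>x. f (c * x)) s = of_real c powr (- s) * mellin_on {0<..} f s"
    and "set_integrable lborel {0<..} (mellin_integrand f s) \<Longrightarrow>
         set_integrable lborel {0<..} (\<lambda>x. of_real x powr (s - 1) * complex_of_real (f (c * x)))"
proof -
  have eq: "indicat_real {0<..} (c * x) *\<^sub>R (of_real (c * x) powr (s - 1) * complex_of_real (f (c * x)))
     = of_real c powr (s - 1) * (indicat_real {0<..} x *\<^sub>R (of_real x powr (s - 1) * complex_of_real (f (c * x))))" for x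
    using c by (cases "x > 0") (auto simp: indicator_def zero_less_mult_iff powr_times_real)
  have "mellin_on {0<..} f s = c *\<^sub>R (LBINT x. indicat_real {0<..} (c * x) *\<^sub>R (of_real (c * x) powr (s - 1) * complex_of_real (f (c * x))))"
    unfolding mellin_on_def set_lebesgue_integral_def
    by (subst lborel_integral_real_affine[of c _ 0]) (use c in auto)
  also have "\<dots> = c *\<^sub>R (of_real c powr (s - 1) * mellin_on {0<..} (\<lambda>x. f (c * x)) s)"
    unfolding eq mellin_on_def set_lebesgue_integral_def integral_mult_right_zero ..
  also have "\<dots> = of_real c powr s * mellin_on {0<..} (\<lambda>x. f (c * x)) s"
    using c by (simp add: scaleR_conv_of_real powr_diff field_simps)
  finally show "mellin_on {0<..} (\<lambda>x. f (c * x)) s = of_real c powr (- s) * mellin_on {0<..} f s"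
    using c by (simp add: powr_minus field_simps)
  assume "set_integrable lborel {0<..} (mellin_integrand f s)"
  hence "integrable lborel (\<lambda>x. indicat_real {0<..} (c * x) *\<^sub>R (of_real (c * x) powr (s - 1) * complex_of_real (f (c * x))))"
    unfolding set_integrable_def by (drule_tac lborel_integrable_real_affine[of _ c 0]) (use c in auto)
  hence "integrable lborel (\<lambda>x. of_real c powr (1 - s) * (of_real c powr (s - 1) * (indicat_real {0<..} x *\<^sub>R (of_real x powr (s - 1) * complex_of_real (f (c * x))))))"
    unfolding eq by (rule integrable_mult_right)
  moreover have "of_real c powr (1 - s) * (of_real c powr (s - 1) * y) = y" for y
    using c by (simp add: mult.assoc[symmetric] flip: powr_add)
  ultimately show "set_integrable lborel {0<..} (\<lambda>x. of_real x powr (s - 1) * complex_of_real (f (c * x)))"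
    unfolding set_integrable_def by simp
qed

section \<open>Partial fractions of 1 / (e^x - 1)\<close>

text \<open>Differentiating the reflection formula gives pi cot (pi z) = Digamma (1 - z) - Digamma
  z, and the series of Digamma turn this into the partial fractions of the cotangent. Passing from
  Digamma z to Digamma (z + 1) splits off the term 1 / z.\<close>

lemma Digamma_reflection_sums:
  assumes z: "z \<notin> \<int>"
  shows "(\<lambda>n. inverse (z + 1 + of_nat n) - inverse (1 - z + of_nat n)) sums
     (of_real pi * cos (of_real pi * z) / sin (of_real pi * z) - 1 / (z :: complex))"
proof -
  have z1: "z \<notin> \<int>\<^sub>\<le>\<^sub>0" "1 - z \<notin> \<int>\<^sub>\<le>\<^sub>0" "z \<noteq> 0" "1 - z \<noteq> 0" "z + 1 \<noteq> 0"
  proof -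
    show "z \<notin> \<int>\<^sub>\<le>\<^sub>0" using z nonpos_Ints_Int by blast
    show "1 - z \<notin> \<int>\<^sub>\<le>\<^sub>0"
    proof
      assume "1 - z \<in> \<int>\<^sub>\<le>\<^sub>0"
      hence "1 - (1 - z) \<in> \<int>" by (intro Ints_diff Ints_1 nonpos_Ints_Int)
      thus False using z by simp
    qed
    show "z \<noteq> 0" "1 - z \<noteq> 0" using z by auto
    show "z + 1 \<noteq> 0"
    proof
      assume "z + 1 = 0"
      hence "z = -1" by (simp add: eq_neg_iff_add_eq_0)
      thus False using z by simp
    qed
  qed
  have "((\<lambda>z. rGamma z * rGamma (1 - z)) has_field_derivative
     (rGamma z * (- (- rGamma (1 - z) * Digamma (1 - z))) + (- rGamma z * Digamma z) * rGamma (1 - z))) (at z)"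
  proof (rule DERIV_mult'[OF has_field_derivative_rGamma_no_nonpos_int[OF z1(1)]])
    have "((\<lambda>z. rGamma (1 - z)) has_field_derivative - rGamma (1 - z) * Digamma (1 - z) * - 1) (at z)"
      by (rule DERIV_chain2[where f = rGamma and g = "\<lambda>z. 1 - z", OF has_field_derivative_rGamma_no_nonpos_int[OF z1(2)]])
         (auto intro!: derivative_eq_intros)
    thus "((\<lambda>z. rGamma (1 - z)) has_field_derivative - (- rGamma (1 - z) * Digamma (1 - z))) (at z)" by simp
  qed
  moreover have "(\<lambda>z. rGamma z * rGamma (1 - z)) = (\<lambda>z::complex. sin (of_real pi * z) / of_real pi)"
    by (simp add: rGamma_reflection_complex)
  moreover have "((\<lambda>z. sin (of_real pi * z) / of_real pi) has_field_derivative cos (of_real pi * z)) (at z)"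
    by (auto intro!: derivative_eq_intros)
  ultimately have "rGamma z * (- (- rGamma (1 - z) * Digamma (1 - z))) + (- rGamma z * Digamma z) * rGamma (1 - z)
     = cos (of_real pi * z)"
    using DERIV_unique by metis
  hence "(rGamma z * rGamma (1 - z)) * (Digamma (1 - z) - Digamma z) = cos (of_real pi * z)"
    by (simp add: algebra_simps)
  hence eq: "sin (of_real pi * z) * (Digamma (1 - z) - Digamma z) = of_real pi * cos (of_real pi * z)"
    unfolding rGamma_reflection_complex by (simp add: field_simps)
  have "rGamma z * rGamma (1 - z) \<noteq> 0" using z1 by (simp add: rGamma_eq_zero_iff)
  hence "sin (of_real pi * z) \<noteq> 0" unfolding rGamma_reflection_complex by auto
  hence d: "Digamma (1 - z) - Digamma z = of_real pi * cos (of_real pi * z) / sin (of_real pi * z)"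
    using eq by (simp add: field_simps)
  have dig: "(\<lambda>n. inverse (of_nat (Suc n)) - inverse (w + of_nat n)) sums (Digamma w + euler_mascheroni)"
    if "w \<noteq> 0" for w :: complex
    using summable_sums[OF summable_Digamma[OF that]] by (simp add: Digamma_def)
  have "(\<lambda>n. (inverse (of_nat (Suc n)) - inverse (1 - z + of_nat n)) - (inverse (of_nat (Suc n)) - inverse (z + 1 + of_nat n)))
     sums ((Digamma (1 - z) + euler_mascheroni) - (Digamma (z + 1) + euler_mascheroni))"
    by (intro sums_diff dig z1)
  moreover have "(Digamma (1 - z) + euler_mascheroni) - (Digamma (z + 1) + euler_mascheroni) =
      of_real pi * cos (of_real pi * z) / sin (of_real pi * z) - 1 / z"
    using Digamma_plus1[OF z1(3)] d by simp
  ultimately show ?thesis by (simp del: of_nat_Suc)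
qed

definition bose :: "real \<Rightarrow> real" where
  "bose x = 1 / (exp x - 1)"

text \<open>1 / x - 1 / 2 is the beginning of the Laurent expansion of \<open>bose\<close> at 0, so
  what remains vanishes there to first order.\<close>

definition bose_reg :: "real \<Rightarrow> real" where
  "bose_reg x = bose x - 1 / x + 1 / 2"

text \<open>The cotangent expansion at z = i x / (2 pi): up to the factor -i, cot (pi z) is the
  hyperbolic cotangent of x / 2, which equals 1 + 2 bose x, and the n-th pair of fractions becomes
  the n-th summand.\<close>

lemma bose_reg_sums:
  assumes x: "x > 0"
  shows "(\<lambda>n. 2 * x / (x\<^sup>2 + (2 * pi * real (Suc n))\<^sup>2)) sums bose_reg x"
proof -
  define y where "y = x / (2 * pi)"
  have y: "y > 0" "x = 2 * pi * y" using x by (auto simp: y_def)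
  define z where "z = \<i> * complex_of_real y"
  have zI: "z \<notin> \<int>" using y by (auto simp: z_def Ints_def complex_eq_iff)
  have z2: "z\<^sup>2 = - of_real (y\<^sup>2)" by (simp add: z_def power_mult_distrib)
  have ez: "\<i> * (of_real pi * z) = - of_real (x / 2)"
    by (simp add: z_def y(2) complex_eq_iff)
  have c: "cos (of_real pi * z) = of_real ((exp (- x / 2) + exp (x / 2)) / 2)"
    unfolding cos_exp_eq ez by (simp add: exp_of_real[symmetric])
  have s: "sin (of_real pi * z) = of_real (exp (- x / 2) - exp (x / 2)) / (2 * \<i>)"
    unfolding sin_exp_eq ez by (simp add: exp_of_real[symmetric])
  have ne: "exp (- x / 2) - exp (x / 2) \<noteq> (0::real)" using x by simp
  have E: "(exp (- x / 2) + exp (x / 2)) / (exp (- x / 2) - exp (x / 2)) = - (1 + 2 * bose x)"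
  proof -
    have e1: "exp x = exp (x / 2) * exp (x / 2)" by (simp flip: exp_add)
    have e0: "exp (- x / 2) * exp (x / 2) = 1" by (simp flip: exp_add)
    have "(exp (- x / 2) + exp (x / 2)) * exp (x / 2) = 1 + exp x"
      unfolding distrib_right e0 e1[symmetric] ..
    moreover have "(exp (- x / 2) - exp (x / 2)) * exp (x / 2) = 1 - exp x"
      unfolding left_diff_distrib e0 e1[symmetric] ..
    ultimately have "(exp (- x / 2) + exp (x / 2)) / (exp (- x / 2) - exp (x / 2)) = (1 + exp x) / (1 - exp x)"
      by (metis exp_not_eq_zero mult_divide_mult_cancel_right)
    also have "\<dots> = - (1 + 2 * bose x)"
      using x unfolding bose_def by (simp add: field_simps)
    finally show ?thesis .
  qed
  have q: "of_real pi * cos (of_real pi * z) / sin (of_real pi * z) = - \<i> * of_real (pi * (1 + 2 * bose x))"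
  proof -
    have "cos (of_real pi * z) / sin (of_real pi * z) = \<i> * of_real ((exp (- x / 2) + exp (x / 2)) / (exp (- x / 2) - exp (x / 2)))"
    proof -
      have "complex_of_real (A / 2) / (of_real B / (2 * \<i>)) = \<i> * of_real (A / B)" for A B :: real
        by (cases "B = 0") (simp_all add: field_simps)
      thus ?thesis unfolding c s .
    qed
    hence "of_real pi * (cos (of_real pi * z) / sin (of_real pi * z)) = of_real pi * (\<i> * of_real (- (1 + 2 * bose x)))"
      unfolding E by (simp only:)
    also have "\<dots> = - \<i> * of_real (pi * (1 + 2 * bose x))"
      by (simp add: algebra_simps)
    finally show ?thesis by (simp only: times_divide_eq_right)
  qed
  have t: "inverse (z + 1 + of_nat n) - inverse (1 - z + of_nat n) = - \<i> * of_real (2 * y / (y\<^sup>2 + (real (Suc n))\<^sup>2))" for n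
  proof -
    define N where "N = (of_nat (Suc n) :: complex)"
    have n1: "N + z \<noteq> 0" "N - z \<noteq> 0" using y by (auto simp: N_def z_def complex_eq_iff)
    have "inverse (z + 1 + of_nat n) - inverse (1 - z + of_nat n) = inverse (N + z) - inverse (N - z)"
      by (simp add: N_def algebra_simps)
    also have "\<dots> = - 2 * z / ((N + z) * (N - z))"
      using n1 by (simp add: field_simps)
    also have "(N + z) * (N - z) = N\<^sup>2 - z\<^sup>2" by (simp add: algebra_simps power2_eq_square)
    also have "\<dots> = of_real (y\<^sup>2 + (real (Suc n))\<^sup>2)" unfolding z2 by (simp add: N_def)
    finally show ?thesis by (simp add: z_def)
  qed
  have "(\<lambda>n. \<i> / of_real (2 * pi) * (- \<i> * of_real (2 * y / (y\<^sup>2 + (real (Suc n))\<^sup>2)))) sums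
     (\<i> / of_real (2 * pi) * (- \<i> * of_real (pi * (1 + 2 * bose x)) - 1 / z))"
    using sums_mult[OF Digamma_reflection_sums[OF zI], of "\<i> / of_real (2 * pi)"] unfolding t q .
  moreover have "\<i> / of_real (2 * pi) * (- \<i> * of_real (2 * y / (y\<^sup>2 + (real (Suc n))\<^sup>2))) =
      complex_of_real (2 * x / (x\<^sup>2 + (2 * pi * real (Suc n))\<^sup>2))" for n
  proof -
    have "2 * x / (x\<^sup>2 + (2 * pi * real (Suc n))\<^sup>2) = 2 * (2 * pi * y) / ((2 * pi)\<^sup>2 * (y\<^sup>2 + (real (Suc n))\<^sup>2))"
      unfolding y(2) by (simp add: power_mult_distrib distrib_left del: of_nat_Suc)
    also have "\<dots> = (2 * y / (y\<^sup>2 + (real (Suc n))\<^sup>2)) / (2 * pi)"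
      by (simp add: power2_eq_square del: of_nat_Suc)
    finally show ?thesis by (simp del: of_nat_Suc)
  qed
  moreover have "\<i> / of_real (2 * pi) * (- \<i> * of_real (pi * (1 + 2 * bose x)) - 1 / z) = of_real (bose_reg x)"
  proof -
    have "1 / z = - \<i> * of_real (1 / y)" using y by (simp add: z_def field_simps)
    hence "\<i> / of_real (2 * pi) * (- \<i> * of_real (pi * (1 + 2 * bose x)) - 1 / z) =
       \<i> * (- \<i>) * of_real ((pi * (1 + 2 * bose x) - 1 / y) / (2 * pi))"
      by (simp add: field_simps)
    also have "(pi * (1 + 2 * bose x) - 1 / y) / (2 * pi) = bose_reg x"
      using y(1) by (simp add: bose_reg_def y(2) field_simps)
    finally show ?thesis by simp
  qed
  ultimately have "(\<lambda>n. complex_of_real (2 * x / (x\<^sup>2 + (2 * pi * real (Suc n))\<^sup>2))) sums of_real (bose_reg x)"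
    by (simp only:)
  thus ?thesis by (simp only: sums_of_real_iff)
qed

lemma bose_reg_bounds:
  assumes x: "x > 0"
  shows "0 \<le> bose_reg x" "bose_reg x \<le> x * (\<Sum>n. 1 / (real (Suc n))\<^sup>2)"
proof -
  have S: "summable (\<lambda>n. 1 / (real (Suc n))\<^sup>2)"
    using summable_Suc_iff[of "\<lambda>n. 1 / (real n)\<^sup>2"] inverse_power_summable[of 2, where 'a = real]
    by (simp add: divide_inverse)
  have "2 * x / (x\<^sup>2 + (2 * pi * real (Suc n))\<^sup>2) \<le> x * (1 / (real (Suc n))\<^sup>2)" for n
  proof -
    have "2 * (real (Suc n))\<^sup>2 \<le> (2 * pi * real (Suc n))\<^sup>2"
    proof -
      have "1 * 1 \<le> pi * pi" using pi_gt3 by (intro mult_mono) auto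
      hence "2 \<le> (2 * pi)\<^sup>2" by (simp add: power2_eq_square)
      thus ?thesis unfolding power_mult_distrib[of "2 * pi"] by (intro mult_right_mono) auto
    qed
    also have "\<dots> \<le> x\<^sup>2 + (2 * pi * real (Suc n))\<^sup>2" by simp
    finally have "2 * x / (x\<^sup>2 + (2 * pi * real (Suc n))\<^sup>2) \<le> 2 * x / (2 * (real (Suc n))\<^sup>2)"
      using x by (intro divide_left_mono) (auto intro!: mult_pos_pos add_nonneg_pos)
    thus ?thesis by simp
  qed
  from sums_le[OF this bose_reg_sums[OF x] sums_mult[OF summable_sums[OF S]]]
  show "bose_reg x \<le> x * (\<Sum>n. 1 / (real (Suc n))\<^sup>2)" .
  show "0 \<le> bose_reg x"
    by (rule sums_le[OF _ sums_zero bose_reg_sums[OF x]]) (use x in simp)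
qed

section \<open>Power integrals over (0, 1] and (1, \<infinity>)\<close>

lemma tendsto_of_real_powr_at_right_0:
  assumes "Re v > 0"
  shows "((\<lambda>x. complex_of_real x powr v) \<longlongrightarrow> 0) (at_right 0)"
proof (rule tendsto_norm_zero_cancel)
  have "((\<lambda>x. x powr Re v) \<longlongrightarrow> 0 powr Re v) (at_right (0::real))"
    using assms by (intro tendsto_powr') (auto simp: eventually_at_filter intro!: tendsto_intros)
  moreover have "\<forall>\<^sub>F x in at_right 0. norm (complex_of_real x powr v) = x powr Re v"
    by (auto simp: eventually_at_filter norm_of_real_powr)
  ultimately show "((\<lambda>x. norm (complex_of_real x powr v)) \<longlongrightarrow> 0) (at_right 0)"
    using tendsto_cong[of "\<lambda>x. norm (complex_of_real x powr v)" "\<lambda>x. x powr Re v" "at_right 0" 0] by simp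
qed

lemma tendsto_of_real_powr_at_top:
  assumes "Re v < 0"
  shows "((\<lambda>x. complex_of_real x powr v) \<longlongrightarrow> 0) at_top"
proof (rule tendsto_norm_zero_cancel)
  have "((\<lambda>x::real. x powr Re v) \<longlongrightarrow> 0) at_top"
    using assms by (intro tendsto_neg_powr filterlim_ident)
  moreover have "\<forall>\<^sub>F x in at_top. norm (complex_of_real x powr v) = x powr Re v"
    using eventually_gt_at_top[of "0::real"] by eventually_elim (simp add: norm_of_real_powr)
  ultimately show "((\<lambda>x. norm (complex_of_real x powr v)) \<longlongrightarrow> 0) at_top"
    using tendsto_cong[of "\<lambda>x. norm (complex_of_real x powr v)" "\<lambda>x. x powr Re v" at_top 0] by simp
qed

lemma has_vector_derivative_of_real_powr:
  assumes "x > 0" "w \<noteq> -1"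
  shows "((\<lambda>x. complex_of_real x powr (w + 1) / (w + 1)) has_vector_derivative of_real x powr w) (at x)"
proof (rule has_vector_derivative_real_field)
  have "w + 1 \<noteq> 0" using assms(2) by (simp add: eq_neg_iff_add_eq_0)
  thus "((\<lambda>z. z powr (w + 1) / (w + 1)) has_field_derivative of_real x powr w) (at (of_real x))"
    using assms by (auto intro!: derivative_eq_intros)
qed

lemma isCont_of_real_powr: "x > 0 \<Longrightarrow> isCont (\<lambda>x. complex_of_real x powr w) x"
  by (intro continuous_intros) auto

lemma set_integrable_powr_Ioc:
  assumes r: "r > -1"
  shows "set_integrable lborel {0<..1} (\<lambda>x::real. x powr r)"
proof -
  let ?F = "\<lambda>x::real. x powr (r + 1) / (r + 1)"
  \<comment> \<open>The fundamental theorem is available for open intervals; going up to 2 includes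
    the endpoint 1.\<close>
  have "set_integrable lborel (einterval (ereal 0) (ereal 2)) (\<lambda>x::real. x powr r)"
  proof (rule interval_integral_FTC_nonneg(1)[where F = ?F])
    show "(?F has_real_derivative x powr r) (at x)" if "ereal 0 < ereal x" for x
      using that r by (auto intro!: derivative_eq_intros)
    show "isCont (\<lambda>x. x powr r) x" if "ereal 0 < ereal x" for x
      using that by (intro continuous_intros) auto
    have "(?F \<longlongrightarrow> 0 powr (r + 1) / (r + 1)) (at_right (0::real))"
      using r by (intro tendsto_divide tendsto_powr') (auto simp: eventually_at_filter intro!: tendsto_intros)
    thus "((?F \<circ> real_of_ereal) \<longlongrightarrow> 0) (at_right (ereal 0))"
      by (simp add: ereal_tendsto_simps)
    have "(?F \<longlongrightarrow> 2 powr (r + 1) / (r + 1)) (at_left (2::real))"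
      using r by (intro tendsto_intros) auto
    thus "((?F \<circ> real_of_ereal) \<longlongrightarrow> 2 powr (r + 1) / (r + 1)) (at_left (ereal 2))"
      by (simp add: ereal_tendsto_simps)
  qed auto
  thus ?thesis unfolding einterval_eq by (rule set_integrable_subset) auto
qed

lemma set_integrable_powr_Ioi:
  assumes r: "r < -1"
  shows "set_integrable lborel {1<..} (\<lambda>x::real. x powr r)"
proof -
  let ?F = "\<lambda>x::real. x powr (r + 1) / (r + 1)"
  have "set_integrable lborel (einterval (ereal 1) \<infinity>) (\<lambda>x::real. x powr r)"
  proof (rule interval_integral_FTC_nonneg(1)[where F = ?F])
    show "(?F has_real_derivative x powr r) (at x)" if "ereal 1 < ereal x" for x
      using that r by (auto intro!: derivative_eq_intros)
    show "isCont (\<lambda>x. x powr r) x" if "ereal 1 < ereal x" for x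
      using that by (intro continuous_intros) auto
    have "(?F \<longlongrightarrow> 1 powr (r + 1) / (r + 1)) (at_right (1::real))"
      using r by (intro tendsto_intros) auto
    thus "((?F \<circ> real_of_ereal) \<longlongrightarrow> 1 powr (r + 1) / (r + 1)) (at_right (ereal 1))"
      by (simp add: ereal_tendsto_simps)
    have "(?F \<longlongrightarrow> 0 / (r + 1)) at_top"
      using r by (intro tendsto_divide tendsto_neg_powr filterlim_ident tendsto_const) auto
    thus "((?F \<circ> real_of_ereal) \<longlongrightarrow> 0) (at_left \<infinity>)"
      by (simp add: ereal_tendsto_simps)
  qed auto
  thus ?thesis unfolding einterval_eq .
qed

lemma set_integrable_complex_powr:
  assumes "A \<in> sets borel" "A \<subseteq> {0<..}" "set_integrable lborel A (\<lambda>x. x powr Re w)"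
  shows "set_integrable lborel A (\<lambda>x. complex_of_real x powr w)"
  using set_integrable_mellin[of A "\<lambda>_. 1" "w + 1"] assms by simp

lemma integral_powr_Ioc:
  assumes w: "Re w > -1"
  shows "(LBINT x:{0<..1}. complex_of_real x powr w) = 1 / (w + 1)"
proof -
  let ?F = "\<lambda>x. complex_of_real x powr (w + 1) / (w + 1)" and ?p = "\<lambda>x. complex_of_real x powr w"
  have w1: "w + 1 \<noteq> 0" "w \<noteq> -1" using w by (auto simp: complex_eq_iff)
  have "set_integrable lborel {0<..1} ?p"
    by (intro set_integrable_complex_powr set_integrable_powr_Ioc w) auto
  hence i: "set_integrable lborel {0<..<1} ?p"
    by (rule set_integrable_subset) auto
  have "(LBINT x=ereal 0..ereal 1. complex_of_real x powr w) = 1 / (w + 1) - 0"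
  proof (rule interval_integral_FTC_integrable[where F = ?F])
    show "(?F has_vector_derivative of_real x powr w) (at x)"
      if "ereal 0 < ereal x" for x
      using that w1 by (intro has_vector_derivative_of_real_powr) auto
    show "isCont ?p x" if "ereal 0 < ereal x" for x
      using that by (intro isCont_of_real_powr) auto
    show "set_integrable lborel (einterval (ereal 0) (ereal 1)) ?p"
      unfolding einterval_eq by (rule i)
    have "(?F \<longlongrightarrow> 0 / (w + 1)) (at_right 0)"
      using w w1 by (intro tendsto_divide tendsto_of_real_powr_at_right_0 tendsto_const) auto
    thus "((?F \<circ> real_of_ereal) \<longlongrightarrow> 0) (at_right (ereal 0))"
      by (simp add: ereal_tendsto_simps)
    have "isCont ?F 1"
      using w1 by (intro continuous_intros) auto
    hence "(?F \<longlongrightarrow> 1 / (w + 1)) (at_left 1)"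
      by (simp add: isCont_def filterlim_at_split)
    thus "((?F \<circ> real_of_ereal) \<longlongrightarrow> 1 / (w + 1)) (at_left (ereal 1))"
      by (simp add: ereal_tendsto_simps)
  qed auto
  thus ?thesis using interval_integral_Ioc[of 0 1 ?p] by simp
qed

lemma integral_powr_Ioi:
  assumes w: "Re w < -1"
  shows "(LBINT x:{1<..}. complex_of_real x powr w) = - 1 / (w + 1)"
proof -
  let ?F = "\<lambda>x. complex_of_real x powr (w + 1) / (w + 1)" and ?p = "\<lambda>x. complex_of_real x powr w"
  have w1: "w + 1 \<noteq> 0" "w \<noteq> -1" using w by (auto simp: complex_eq_iff)
  have i: "set_integrable lborel {1<..} ?p"
    by (intro set_integrable_complex_powr set_integrable_powr_Ioi w) auto
  have "(LBINT x=ereal 1..\<infinity>. complex_of_real x powr w) = 0 - 1 / (w + 1)"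
  proof (rule interval_integral_FTC_integrable[where F = ?F])
    show "(?F has_vector_derivative of_real x powr w) (at x)"
      if "ereal 1 < ereal x" for x
      using that w1 by (intro has_vector_derivative_of_real_powr) auto
    show "isCont ?p x" if "ereal 1 < ereal x" for x
      using that by (intro isCont_of_real_powr) auto
    show "set_integrable lborel (einterval (ereal 1) \<infinity>) ?p"
      unfolding einterval_eq by (rule i)
    have "(?F \<longlongrightarrow> 0 / (w + 1)) at_top"
      using w w1 by (intro tendsto_divide tendsto_of_real_powr_at_top tendsto_const) auto
    thus "((?F \<circ> real_of_ereal) \<longlongrightarrow> 0) (at_left \<infinity>)"
      by (simp add: ereal_tendsto_simps)
    have "isCont ?F 1"
      using w1 by (intro continuous_intros) auto
    hence "(?F \<longlongrightarrow> 1 / (w + 1)) (at_right 1)"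
      by (simp add: isCont_def filterlim_at_split)
    thus "((?F \<circ> real_of_ereal) \<longlongrightarrow> 1 / (w + 1)) (at_right (ereal 1))"
      by (simp add: ereal_tendsto_simps)
  qed auto
  thus ?thesis by (simp add: interval_integral_to_infinity_eq)
qed

section \<open>Termwise Mellin transforms\<close>

text \<open>For nonnegative terms the norm of the integrand at \<open>s\<close> is the integrand at
  Re s. The condition for exchanging sum and integral is thus summability of the same Mellin
  transforms at a real argument, where they are known explicitly up to a constant factor.\<close>

lemma mellin_on_sums:
  fixes g :: "nat \<Rightarrow> real \<Rightarrow> real"
  assumes A: "A \<subseteq> {0<..}" and nn: "\<And>n x. x \<in> A \<Longrightarrow> g n x \<ge> 0"
    and int: "\<And>n. set_integrable lborel A (mellin_integrand (g n) s)"
    and f: "\<And>x. x \<in> A \<Longrightarrow> (\<lambda>n. g n x) sums f x"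
    and sm: "summable (\<lambda>n. norm (mellin_on A (g n) (of_real (Re s))))"
  shows "set_integrable lborel A (mellin_integrand f s)"
    and "(\<lambda>n. mellin_on A (g n) s) sums mellin_on A f s"
proof -
  define F where "F = (\<lambda>n x. indicat_real A x *\<^sub>R (complex_of_real x powr (s - 1) * of_real (g n x)))"
  have Fi: "integrable lborel (F n)" for n using int[of n] by (simp add: F_def set_integrable_def)
  have nF: "norm (F n x) = indicat_real A x * (x powr (Re s - 1) * g n x)" for n x
    using A nn by (cases "x \<in> A") (auto simp: F_def norm_mult norm_of_real_powr)
  have "mellin_on A (g n) (of_real (Re s)) = of_real (LBINT x. norm (F n x))" for n
  proof -
    have "indicat_real A x *\<^sub>R (complex_of_real x powr (of_real (Re s) - 1) * of_real (g n x)) = of_real (norm (F n x))" for x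
      unfolding nF using A powr_of_real[of x "Re s - 1"] by (cases "x \<in> A") auto
    thus ?thesis unfolding mellin_on_def set_lebesgue_integral_def by simp
  qed
  hence sm': "summable (\<lambda>n. LBINT x. norm (F n x))" using sm by simp
  have AE: "AE x in lborel. summable (\<lambda>n. norm (F n x))"
    unfolding nF using f by (intro AE_I2) (auto simp: indicator_def intro!: summable_mult sums_summable)
  have S: "(\<Sum>n. F n x) = indicat_real A x *\<^sub>R (complex_of_real x powr (s - 1) * of_real (f x))" for x
  proof (cases "x \<in> A")
    case True
    have "(\<lambda>n. complex_of_real x powr (s - 1) * of_real (g n x)) sums (complex_of_real x powr (s - 1) * of_real (f x))"
      by (intro sums_mult sums_of_real f True)
    thus ?thesis using True by (simp add: F_def sums_iff)
  qed (simp add: F_def)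
  show "set_integrable lborel A (mellin_integrand f s)"
    using integrable_suminf[OF Fi AE sm'] by (simp add: S set_integrable_def)
  show "(\<lambda>n. mellin_on A (g n) s) sums mellin_on A f s"
    using sums_integral[OF Fi AE sm'] unfolding S unfolding F_def mellin_on_def set_lebesgue_integral_def .
qed

lemma Gamma_mellin:
  assumes s: "Re s > 0"
  shows "set_integrable lborel {0<..} (\<lambda>x. complex_of_real x powr (s - 1) * of_real (exp (- x)))"
    and "mellin_on {0<..} (\<lambda>x. exp (- x)) s = Gamma s"
proof -
  have eq: "complex_of_real x powr (s - 1) / of_real (exp x) = complex_of_real x powr (s - 1) * of_real (exp (- x))" for x
    by (simp add: exp_minus divide_inverse)
  have a: "(\<lambda>x. complex_of_real x powr (s - 1) * of_real (exp (- x))) absolutely_integrable_on {0<..}"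
    using absolutely_integrable_Gamma_integral'[OF s] unfolding eq .
  show i: "set_integrable lborel {0<..} (\<lambda>x. complex_of_real x powr (s - 1) * of_real (exp (- x)))"
    using a unfolding set_integrable_def
    by (subst (asm) integrable_completion) measurable
  show "mellin_on {0<..} (\<lambda>x. exp (- x)) s = Gamma s"
    unfolding mellin_on_def using set_borel_integral_eq_integral(2)[OF i] Gamma_integral_complex'[OF s]
    by (simp add: eq integral_unique)
qed

text \<open>\<open>bose x\<close> is the geometric series of exp (-(n + 1) x), and by scaling each
  term contributes Gamma s * (n + 1)^(-s).\<close>

lemma bose_mellin:
  assumes s: "Re s > 1"
  shows "set_integrable lborel {0<..} (mellin_integrand bose s)"
    and "mellin_on {0<..} bose s = Gamma s * riemann_zeta s"
proof -
  define g where "g = (\<lambda>n x. exp (- (real (Suc n) * x)))"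
  have m: "mellin_on {0<..} (g n) z = of_nat (Suc n) powr (- z) * Gamma z" if "Re z > 0" for n z
    unfolding g_def using mellin_on_scale(1)[of "real (Suc n)" "\<lambda>x. exp (- x)" z] Gamma_mellin(2)[OF that]
    by (simp del: of_nat_Suc)
  have int: "set_integrable lborel {0<..} (mellin_integrand (g n) s)" for n
    unfolding g_def using mellin_on_scale(2)[of "real (Suc n)" s "\<lambda>x. exp (- x)"] Gamma_mellin(1)[of s] s by simp
  have sums: "(\<lambda>n. g n x) sums bose x" if "x \<in> {0<..}" for x
  proof -
    have x: "x > 0" using that by simp
    have "(\<lambda>n. exp (- x) * exp (- x) ^ n) sums (exp (- x) * (1 / (1 - exp (- x))))"
      using x by (intro sums_mult geometric_sums) auto
    moreover have "exp (- x) * exp (- x) ^ n = g n x" for n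
      by (simp add: g_def exp_of_nat_mult[symmetric] distrib_right flip: exp_add)
    moreover have "exp (- x) * (1 / (1 - exp (- x))) = bose x"
      using x by (simp add: bose_def exp_minus field_simps)
    ultimately show ?thesis by simp
  qed
  have "summable (\<lambda>n. real (Suc n) powr (- Re s) * norm (Gamma (complex_of_real (Re s))))"
    by (intro summable_mult2 summable_Suc_powr) (use s in simp)
  hence sm: "summable (\<lambda>n. norm (mellin_on {0<..} (g n) (of_real (Re s))))"
    using s m[of "of_real (Re s)"] by (simp add: norm_mult norm_of_nat_powr del: of_nat_Suc)
  note R = mellin_on_sums[where g = g and f = bose, OF _ _ int sums sm]
  show "set_integrable lborel {0<..} (mellin_integrand bose s)"
    by (rule R(1)) (auto simp: g_def)
  have "(\<lambda>n. mellin_on {0<..} (g n) s) sums mellin_on {0<..} bose s"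
    by (rule R(2)) (auto simp: g_def)
  moreover have "(\<lambda>n. of_nat (Suc n) powr (- s) * Gamma s) sums (riemann_zeta s * Gamma s)"
    by (intro sums_mult2 riemann_zeta_sums s)
  ultimately show "mellin_on {0<..} bose s = Gamma s * riemann_zeta s"
    using m[of s] s by (simp add: sums_iff mult.commute)
qed

text \<open>Up to scaling, every term of the series for \<open>bose_reg\<close> is this function.
  Its Mellin transform is classically (pi / 2) / cos (pi s / 2) for |Re s| < 1.\<close>

definition cauchy_kernel :: "real \<Rightarrow> real" where
  "cauchy_kernel x = x / (1 + x\<^sup>2)"

definition cauchy_mellin :: "complex \<Rightarrow> complex" where
  "cauchy_mellin = mellin_on {0<..} cauchy_kernel"

lemma set_integrable_Ioi_split:
  fixes f :: "real \<Rightarrow> real"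
  assumes "set_integrable lborel {0<..1} f" "set_integrable lborel {1<..} f"
  shows "set_integrable lborel {0<..} f"
proof -
  have "set_integrable lborel ({0<..1} \<union> {1<..}) f"
    by (rule set_integrable_Un[OF assms]) auto
  also have "{0<..1} \<union> {1<..} = {0::real<..}" by auto
  finally show ?thesis .
qed

text \<open>The kernel behaves like x at 0 and like 1 / x at infinity, whence the range of
  \<open>r\<close>.\<close>

lemma cauchy_kernel_integrable_real:
  assumes r: "-1 < r" "r < 1"
  shows "set_integrable lborel {0<..} (\<lambda>x. x powr (r - 1) * cauchy_kernel x)"
proof (rule set_integrable_Ioi_split)
  have eq: "x powr (r - 1) * x = x powr r" if "x > 0" for x :: real
    using that by (simp add: powr_diff)
  have pos: "1 + x\<^sup>2 > (0::real)" for x by (rule add_pos_nonneg) auto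
  show "set_integrable lborel {0<..1} (\<lambda>x. x powr (r - 1) * cauchy_kernel x)"
  proof (rule set_integrable_bound[OF set_integrable_powr_Ioc[of r]])
    show "AE x in lborel. x \<in> {0<..1} \<longrightarrow> norm (x powr (r - 1) * cauchy_kernel x) \<le> norm (x powr r)"
    proof (rule AE_I2, rule impI)
      fix x :: real assume x: "x \<in> {0<..1}"
      have "x powr r / (1 + x\<^sup>2) \<le> x powr r / 1" by (intro divide_left_mono) (auto intro: add_pos_nonneg)
      thus "norm (x powr (r - 1) * cauchy_kernel x) \<le> norm (x powr r)"
        using x eq[of x] pos[of x] by (simp add: cauchy_kernel_def)
    qed
  qed (use r in \<open>auto simp: set_borel_measurable_def cauchy_kernel_def\<close>)
  show "set_integrable lborel {1<..} (\<lambda>x. x powr (r - 1) * cauchy_kernel x)"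
  proof (rule set_integrable_bound[OF set_integrable_powr_Ioi[of "r - 2"]])
    show "AE x in lborel. x \<in> {1<..} \<longrightarrow> norm (x powr (r - 1) * cauchy_kernel x) \<le> norm (x powr (r - 2))"
    proof (rule AE_I2, rule impI)
      fix x :: real assume x: "x \<in> {1<..}"
      have "x powr r / (1 + x\<^sup>2) \<le> x powr r / x\<^sup>2" using x by (intro divide_left_mono) (auto intro!: mult_pos_pos add_pos_nonneg)
      also have "\<dots> = x powr (r - 2)" using x by (simp add: powr_diff powr_numeral)
      finally show "norm (x powr (r - 1) * cauchy_kernel x) \<le> norm (x powr (r - 2))"
        using x eq[of x] pos[of x] by (simp add: cauchy_kernel_def)
    qed
  qed (use r in \<open>auto simp: set_borel_measurable_def cauchy_kernel_def\<close>)
qed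

lemma cauchy_kernel_measurable: "cauchy_kernel \<in> borel_measurable borel"
  unfolding cauchy_kernel_def by measurable

lemma cauchy_mellin_holomorphic: "cauchy_mellin holomorphic_on {s. Re s \<in> {-1<..<1}}"
  unfolding cauchy_mellin_def
  by (rule mellin_on_holomorphic[OF _ _ cauchy_kernel_measurable _ cauchy_kernel_integrable_real]) auto

text \<open>Each term is a rescaled \<open>cauchy_kernel\<close> and contributes the factor (2 pi (n
  + 1))^(s - 1). Summation of these produces zeta (1 - s) and demands Re s < 0; the behaviour of the
  kernel at 0 demands Re s > -1.\<close>

lemma bose_reg_mellin:
  assumes s: "-1 < Re s" "Re s < 0"
  shows "set_integrable lborel {0<..} (mellin_integrand bose_reg s)"
    and "mellin_on {0<..} bose_reg s = 2 * of_real (2 * pi) powr (s - 1) * cauchy_mellin s * riemann_zeta (1 - s)"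
proof -
  define c where "c = (\<lambda>n. 2 * pi * real (Suc n))"
  have c: "c n > 0" for n by (simp add: c_def)
  define g where "g = (\<lambda>n x. 2 * x / (x\<^sup>2 + (c n)\<^sup>2))"
  have gk: "g n x = 2 / c n * cauchy_kernel (1 / c n * x)" for n x
    using c[of n] by (simp add: g_def cauchy_kernel_def field_simps power2_eq_square)
  have m: "mellin_on {0<..} (g n) z = 2 * of_real (c n) powr (z - 1) * cauchy_mellin z"
    for n z
  proof -
    have "mellin_on {0<..} (g n) z = of_real (2 / c n) * mellin_on {0<..} (\<lambda>x. cauchy_kernel (1 / c n * x)) z"
    proof -
      have "mellin_on {0<..} (g n) z = (LBINT x:{0<..}. of_real (2 / c n) * (of_real x powr (z - 1) * of_real (cauchy_kernel (1 / c n * x))))"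
        unfolding mellin_on_def gk by (simp add: mult_ac)
      thus ?thesis unfolding mellin_on_def set_integral_mult_right .
    qed
    also have "\<dots> = of_real (2 / c n) * (of_real (1 / c n) powr (- z) * cauchy_mellin z)"
      using mellin_on_scale(1)[of "1 / c n" cauchy_kernel z] c[of n] by (simp add: cauchy_mellin_def)
    also have "of_real (1 / c n) powr (- z) = of_real (c n) powr z"
      using c[of n] Ln_of_real[of "c n"] Ln_of_real[of "1 / c n"] 
      by (simp add: powr_def ln_div del: of_real_divide)
    finally show ?thesis using c[of n] by (simp add: powr_diff field_simps)
  qed
  have int: "set_integrable lborel {0<..} (mellin_integrand (g n) s)" for n
  proof -
    have "set_integrable lborel {0<..} (mellin_integrand cauchy_kernel s)"
      by (rule set_integrable_mellin[OF _ _ cauchy_kernel_measurable cauchy_kernel_integrable_real]) (use s in auto)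
    from mellin_on_scale(2)[OF _ this, of "1 / c n"] c[of n]
    have "set_integrable lborel {0<..} (\<lambda>x. complex_of_real x powr (s - 1) * of_real (cauchy_kernel (1 / c n * x)))"
      by simp
    hence "set_integrable lborel {0<..} (\<lambda>x. of_real (2 / c n) * (complex_of_real x powr (s - 1) * of_real (cauchy_kernel (1 / c n * x))))"
      by (rule set_integrable_mult_right)
    thus ?thesis unfolding gk by (simp add: mult_ac)
  qed
  have cp: "of_real (c n) powr (z - 1) = of_real (2 * pi) powr (z - 1) * of_nat (Suc n) powr (- (1 - z))" for n and z :: complex
    unfolding c_def using powr_times_real[of "of_real (2 * pi)" "of_real (real (Suc n))" "z - 1"] by simp
  have "summable (\<lambda>n. 2 * norm (complex_of_real (2 * pi) powr (of_real (Re s) - 1)) * real (Suc n) powr (Re s - 1) * norm (cauchy_mellin (of_real (Re s))))"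
    by (intro summable_mult summable_mult2 summable_Suc_powr) (use s in simp)
  hence sm: "summable (\<lambda>n. norm (mellin_on {0<..} (g n) (of_real (Re s))))"
    unfolding m cp norm_mult norm_of_nat_powr by (simp add: mult_ac)
  have sums: "(\<lambda>n. g n x) sums bose_reg x" if "x \<in> {0<..}" for x
    using bose_reg_sums[of x] that by (simp add: g_def c_def)
  note R = mellin_on_sums[where g = g and f = bose_reg, OF _ _ int sums sm]
  show "set_integrable lborel {0<..} (mellin_integrand bose_reg s)"
    by (rule R(1)) (auto simp: g_def)
  have "(\<lambda>n. mellin_on {0<..} (g n) s) sums mellin_on {0<..} bose_reg s"
    by (rule R(2)) (auto simp: g_def)
  hence 1: "(\<lambda>n. (2 * of_real (2 * pi) powr (s - 1) * cauchy_mellin s) * of_nat (Suc n) powr (- (1 - s))) sums mellin_on {0<..} bose_reg s"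
    unfolding m cp by (simp add: mult_ac)
  have "(\<lambda>n. (2 * of_real (2 * pi) powr (s - 1) * cauchy_mellin s) * of_nat (Suc n) powr (- (1 - s))) sums
      ((2 * of_real (2 * pi) powr (s - 1) * cauchy_mellin s) * riemann_zeta (1 - s))"
    by (intro sums_mult riemann_zeta_sums) (use s in simp)
  with 1 show "mellin_on {0<..} bose_reg s = 2 * of_real (2 * pi) powr (s - 1) * cauchy_mellin s * riemann_zeta (1 - s)"
    by (rule sums_unique2)
qed

section \<open>Continuation of Gamma times zeta and the functional equation\<close>

text \<open>The singular part 1/x - 1/2 is removed only on (0, 1]; beyond 1 the decay of
  \<open>bose\<close> is kept. The Mellin transform then exists for all Re s > -1 and links the
  formula for Re s > 1 with the one for -1 < Re s < 0.\<close>

definition bose_cut :: "real \<Rightarrow> real" where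
  "bose_cut x = (if x \<le> 1 then bose_reg x else bose x)"

lemma bose_measurable: "bose \<in> borel_measurable borel" "bose_reg \<in> borel_measurable borel"
  "bose_cut \<in> borel_measurable borel"
  unfolding bose_def[abs_def] bose_reg_def[abs_def] bose_cut_def[abs_def] by measurable

lemma bose_cut_integrable_real:
  assumes r: "-1 < r"
  shows "set_integrable lborel {0<..} (\<lambda>x. x powr (r - 1) * bose_cut x)"
proof (rule set_integrable_Ioi_split)
  note [measurable] = bose_measurable
  define K where "K = (\<Sum>n. 1 / (real (Suc n))\<^sup>2)"
  show "set_integrable lborel {0<..1} (\<lambda>x. x powr (r - 1) * bose_cut x)"
  proof (rule set_integrable_bound[OF set_integrable_mult_right[OF set_integrable_powr_Ioc[OF r], of K]])
    show "AE x in lborel. x \<in> {0<..1} \<longrightarrow> norm (x powr (r - 1) * bose_cut x) \<le> norm (K * x powr r)"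
    proof (rule AE_I2, rule impI)
      fix x :: real assume x: "x \<in> {0<..1}"
      hence b: "0 \<le> bose_reg x" "bose_reg x \<le> x * K" using bose_reg_bounds[of x] by (auto simp: K_def)
      have "x powr (r - 1) * bose_reg x \<le> x powr (r - 1) * (x * K)" by (intro mult_left_mono b) auto
      also have "\<dots> = K * x powr r" using x by (simp add: powr_diff)
      also have "\<dots> \<le> \<bar>K\<bar> * x powr r" by (intro mult_right_mono) auto
      finally show "norm (x powr (r - 1) * bose_cut x) \<le> norm (K * x powr r)"
        using x b by (simp add: bose_cut_def abs_mult)
    qed
  qed (auto simp: set_borel_measurable_def)
  \<comment> \<open>With exponent at least 2, \<open>bose_mellin\<close> supplies an integrable
    majorant; on x > 1 a larger exponent only increases the integrand.\<close>
  define R where "R = max r 2"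
  have "set_integrable lborel {0<..} (\<lambda>x. norm (complex_of_real x powr (of_real R - 1) * of_real (bose x)))"
    by (intro set_integrable_norm bose_mellin(1)) (simp add: R_def)
  hence "set_integrable lborel {1<..} (\<lambda>x. norm (complex_of_real x powr (of_real R - 1) * of_real (bose x)))"
    by (rule set_integrable_subset) auto
  thus "set_integrable lborel {1<..} (\<lambda>x. x powr (r - 1) * bose_cut x)"
  proof (rule set_integrable_bound)
    show "AE x in lborel. x \<in> {1<..} \<longrightarrow> norm (x powr (r - 1) * bose_cut x) \<le> norm (norm (complex_of_real x powr (of_real R - 1) * of_real (bose x)))"
    proof (rule AE_I2, rule impI)
      fix x :: real assume x: "x \<in> {1<..}"
      have "x powr (r - 1) * \<bar>bose x\<bar> \<le> x powr (R - 1) * \<bar>bose x\<bar>"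
        using x by (intro mult_right_mono powr_mono) (auto simp: R_def)
      thus "norm (x powr (r - 1) * bose_cut x) \<le> norm (norm (complex_of_real x powr (of_real R - 1) * of_real (bose x)))"
        using x by (simp add: bose_cut_def abs_mult norm_mult norm_of_real_powr)
    qed
  qed (auto simp: set_borel_measurable_def)
qed

definition bose_cut_mellin :: "complex \<Rightarrow> complex" where
  "bose_cut_mellin = mellin_on {0<..} bose_cut"

lemma bose_cut_mellin_holomorphic: "bose_cut_mellin holomorphic_on {s. Re s \<in> {-1<..}}"
  unfolding bose_cut_mellin_def
  by (rule mellin_on_holomorphic[OF _ _ bose_measurable(3) _ bose_cut_integrable_real]) auto

lemma bose_cut_set_integrable:
  assumes "Re s > -1"
  shows "set_integrable lborel {0<..} (mellin_integrand bose_cut s)"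
  by (rule set_integrable_mellin[OF _ _ bose_measurable(3) bose_cut_integrable_real]) (use assms in auto)

lemma powr_times_inverse:
  assumes x: "x > 0"
  shows "complex_of_real x powr (s - 1) * of_real (1 / x - 1 / 2) = of_real x powr (s - 2) - of_real x powr (s - 1) / 2"
proof -
  have "complex_of_real x powr (s - 1) = of_real x powr ((s - 2) + 1)" by simp
  also have "\<dots> = of_real x powr (s - 2) * of_real x powr 1" by (rule powr_add)
  finally have "complex_of_real x powr (s - 1) = of_real x powr (s - 2) * of_real x powr 1" .
  hence "complex_of_real x powr (s - 1) / of_real x = of_real x powr (s - 2)" using x by simp
  thus ?thesis by (simp add: right_diff_distrib)
qed

text \<open>\<open>bose\<close> and \<open>bose_cut\<close> differ by 1/x - 1/2 on (0, 1], whose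
  Mellin integral there is 1/(s - 1) - 1/(2 s).\<close>

lemma Gamma_zeta_eq:
  assumes s: "Re s > 1"
  shows "Gamma s * riemann_zeta s = bose_cut_mellin s + 1 / (s - 1) - 1 / (2 * s)"
proof -
  let ?p = "\<lambda>x. complex_of_real x powr (s - 1)"
  let ?q = "\<lambda>x. complex_of_real x powr (s - 2) - ?p x / 2"
  have i1: "set_integrable lborel {0<..1} (\<lambda>x. complex_of_real x powr (s - 2))"
    and i2: "set_integrable lborel {0<..1} (\<lambda>x. ?p x / 2)"
    using s by (auto intro!: set_integrable_complex_powr set_integrable_powr_Ioc set_integrable_divide)
  have "(LBINT x:{0<..1}. ?q x) =
    (LBINT x:{0<..1}. complex_of_real x powr (s - 2)) - (LBINT x:{0<..1}. ?p x / 2)"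
    by (rule set_integral_diff(2)[OF i1 i2])
  also have "\<dots> = 1 / (s - 2 + 1) - 1 / (s - 1 + 1) / 2"
    using s by (simp add: integral_powr_Ioc)
  finally have q: "(LBINT x:{0<..1}. ?q x) = 1 / (s - 1) - 1 / (2 * s)"
    by simp
  have qi: "set_integrable lborel {0<..1} ?q"
    by (rule set_integral_diff(1)[OF i1 i2])
  have split: "indicat_real {0<..} x *\<^sub>R (?p x * of_real (bose x)) =
      indicat_real {0<..} x *\<^sub>R (?p x * of_real (bose_cut x)) +
      indicat_real {0<..1} x *\<^sub>R ?q x" for x
  proof (cases "x > 0 \<and> x \<le> 1")
    case True
    hence "bose x = bose_cut x + (1 / x - 1 / 2)" by (simp add: bose_cut_def bose_reg_def)
    hence "?p x * of_real (bose x) = ?p x * of_real (bose_cut x) + ?p x * of_real (1 / x - 1 / 2)"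
      by (simp only: of_real_add distrib_left)
    thus ?thesis using True by (simp only: powr_times_inverse) simp
  qed (auto simp: bose_cut_def indicator_def)
  have "mellin_on {0<..} bose s = bose_cut_mellin s + (1 / (s - 1) - 1 / (2 * s))"
    unfolding bose_cut_mellin_def mellin_on_def q[symmetric] set_lebesgue_integral_def split
    using bose_cut_set_integrable[of s] s qi unfolding set_integrable_def
    by (intro Bochner_Integration.integral_add) auto
  thus ?thesis using bose_mellin(2)[OF s] by simp
qed

text \<open>\<open>bose_cut\<close> and \<open>bose_reg\<close> differ by 1/x - 1/2 on (1,
  \<infinity>). The Mellin integral of that difference is the negative of the rational function from
  (0, 1] and is subtracted, so the right side coincides with that of \<open>Gamma_zeta_eq\<close>:
  this coincidence is the functional equation.\<close>

lemma zeta_reflection_strip: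
  assumes s: "-1 < Re s" "Re s < 0"
  shows "2 * of_real (2 * pi) powr (s - 1) * cauchy_mellin s * riemann_zeta (1 - s)
     = bose_cut_mellin s + 1 / (s - 1) - 1 / (2 * s)"
proof -
  let ?p = "\<lambda>x. complex_of_real x powr (s - 1)"
  let ?q = "\<lambda>x. complex_of_real x powr (s - 2) - ?p x / 2"
  have i1: "set_integrable lborel {1<..} (\<lambda>x. complex_of_real x powr (s - 2))"
    and i2: "set_integrable lborel {1<..} (\<lambda>x. ?p x / 2)"
    using s by (auto intro!: set_integrable_complex_powr set_integrable_powr_Ioi set_integrable_divide)
  have "(LBINT x:{1<..}. ?q x) =
    (LBINT x:{1<..}. complex_of_real x powr (s - 2)) - (LBINT x:{1<..}. ?p x / 2)"
    by (rule set_integral_diff(2)[OF i1 i2])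
  also have "\<dots> = - 1 / (s - 2 + 1) - (- 1 / (s - 1 + 1)) / 2"
    using s by (simp add: integral_powr_Ioi)
  finally have q: "(LBINT x:{1<..}. ?q x) = - 1 / (s - 1) + 1 / (2 * s)"
    by simp
  have qi: "set_integrable lborel {1<..} ?q"
    by (rule set_integral_diff(1)[OF i1 i2])
  have split: "indicat_real {0<..} x *\<^sub>R (?p x * of_real (bose_reg x)) =
      indicat_real {0<..} x *\<^sub>R (?p x * of_real (bose_cut x)) -
      indicat_real {1<..} x *\<^sub>R ?q x" for x
  proof (cases "x > 1")
    case True
    hence "bose_reg x = bose_cut x - (1 / x - 1 / 2)" by (simp add: bose_cut_def bose_reg_def)
    hence "?p x * of_real (bose_reg x) = ?p x * of_real (bose_cut x) - ?p x * of_real (1 / x - 1 / 2)"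
      by (simp only: of_real_diff right_diff_distrib)
    thus ?thesis using True powr_times_inverse[of x s] by simp
  qed (auto simp: bose_cut_def indicator_def)
  have "mellin_on {0<..} bose_reg s = bose_cut_mellin s - (- 1 / (s - 1) + 1 / (2 * s))"
    unfolding bose_cut_mellin_def mellin_on_def q[symmetric] set_lebesgue_integral_def split
    using bose_cut_set_integrable[of s] s qi unfolding set_integrable_def
    by (intro Bochner_Integration.integral_diff) auto
  thus ?thesis using bose_reg_mellin(2)[OF s] by simp
qed

lemma nonpos_Ints_Re_le: "z \<in> \<int>\<^sub>\<le>\<^sub>0 \<Longrightarrow> Re z \<le> 0"
  by (auto elim!: nonpos_Ints_cases)

text \<open>Multiplication by s (s - 1) clears the poles at 0 and 1, so \<open>Gamma_zeta_eq\<close>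
  continues to the strip in which the reflected formula was obtained.\<close>

lemma Gamma_zeta_reg_eq:
  assumes s: "Re s > -1"
  shows "Gamma (s + 1) * zeta_reg s = s * (s - 1) * bose_cut_mellin s + s - (s - 1) / 2"
proof -
  let ?f = "\<lambda>s. Gamma (s + 1) * zeta_reg s" and ?g = "\<lambda>s. s * (s - 1) * bose_cut_mellin s + s - (s - 1) / 2"
  show ?thesis
  proof (rule Re_gt_analytic_unique[where S = "{s. Re s > -1}" and f = ?f and g = ?g])
    have "Gamma \<circ> (\<lambda>s. s + 1) holomorphic_on {s. Re s > -1}"
      by (rule holomorphic_on_compose_gen[OF _ holomorphic_Gamma[of "{s. Re s > 0}"]])
         (auto intro!: holomorphic_intros dest!: nonpos_Ints_Re_le)
    thus "?f holomorphic_on {s. Re s > -1}"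
      by (intro holomorphic_intros zeta_reg_holomorphic) (auto simp: o_def dest!: nonpos_Ints_Re_le)
    have "bose_cut_mellin holomorphic_on {s. Re s > -1}" using bose_cut_mellin_holomorphic by simp
    thus "?g holomorphic_on {s. Re s > -1}"
      by (intro holomorphic_intros) auto
    show "connected {s. Re s > -1}" by (intro convex_connected convex_halfspace_Re_gt)
    fix s :: complex assume s: "Re s > 1"
    have s0: "s \<noteq> 0" "s - 1 \<noteq> 0" "s \<noteq> 1" using s by auto
    have "s \<notin> \<int>\<^sub>\<le>\<^sub>0" using s nonpos_Ints_Re_le[of s] by auto
    hence "Gamma (s + 1) * zeta_reg s = s * (s - 1) * (Gamma s * riemann_zeta s)"
      using s0 by (simp add: Gamma_plus1 zeta_reg_def mult_ac)
    also have "\<dots> = s * (s - 1) * bose_cut_mellin s + s - (s - 1) / 2"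
      unfolding Gamma_zeta_eq[OF s] using s0 by (simp add: field_simps)
    finally show "Gamma (s + 1) * zeta_reg s = s * (s - 1) * bose_cut_mellin s + s - (s - 1) / 2" .
  qed (use s in \<open>auto simp: open_Re_gt\<close>)
qed

text \<open>Both formulas hold on -1 < Re s < 0. The result continues to |Re s| < 1, where
  \<open>cauchy_mellin\<close> is holomorphic, and so covers the critical strip.\<close>

lemma zeta_reg_functional_equation:
  assumes s: "-1 < Re s" "Re s < 1"
  shows "Gamma (s + 1) * zeta_reg s = 2 * of_real (2 * pi) powr (s - 1) * (1 - s) * cauchy_mellin s * zeta_reg (1 - s)"
proof -
  let ?f = "\<lambda>s. Gamma (s + 1) * zeta_reg s"
  let ?g = "\<lambda>s. 2 * of_real (2 * pi) powr (s - 1) * (1 - s) * cauchy_mellin s * zeta_reg (1 - s)"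
  let ?S = "{s. Re s \<in> {-1<..<1}}" and ?T = "{s. Re s \<in> {-1<..<0}}"
  have S: "?S = {s. Re s > -1} \<inter> {s. Re s < 1}" "?T = {s. Re s > -1} \<inter> {s. Re s < 0}" by auto
  show ?thesis
  proof (rule analytic_continuation_open[where s = ?T and s' = ?S and
      f = ?f and g = ?g])
    show "open ?T" "open ?S" unfolding S by (intro open_Int open_halfspace_Re_gt open_halfspace_Re_lt)+
    show "connected ?S" unfolding S
      by (intro convex_connected convex_Int convex_halfspace_Re_gt convex_halfspace_Re_lt)
    have "complex_of_real (-1/2) \<in> ?T" by simp
    thus "?T \<noteq> {}" by blast
    have "Gamma \<circ> (\<lambda>s. s + 1) holomorphic_on ?S"
      by (rule holomorphic_on_compose_gen[OF _ holomorphic_Gamma[of "{s. Re s > 0}"]])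
         (auto intro!: holomorphic_intros dest!: nonpos_Ints_Re_le)
    thus "?f holomorphic_on ?S"
      by (intro holomorphic_intros zeta_reg_holomorphic) (auto simp: o_def dest!: nonpos_Ints_Re_le)
    have "zeta_reg \<circ> (\<lambda>s. 1 - s) holomorphic_on ?S"
      by (rule holomorphic_on_compose_gen[OF _ zeta_reg_holomorphic[of UNIV]]) (auto intro!: holomorphic_intros)
    thus "?g holomorphic_on ?S"
      by (intro holomorphic_intros cauchy_mellin_holomorphic) (auto simp: o_def)
    fix s assume "s \<in> ?T"
    hence s: "-1 < Re s" "Re s < 0" by auto
    have s0: "s \<noteq> 0" "s - 1 \<noteq> 0" using s by auto
    have "Gamma (s + 1) * zeta_reg s = s * (s - 1) * (bose_cut_mellin s + 1 / (s - 1) - 1 / (2 * s))"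
      unfolding Gamma_zeta_reg_eq[OF s(1)] using s0 by (simp add: field_simps)
    also have "\<dots> = s * (s - 1) * (2 * of_real (2 * pi) powr (s - 1) * cauchy_mellin s * riemann_zeta (1 - s))"
      unfolding zeta_reflection_strip[OF s] ..
    also have "\<dots> = ?g s"
      using s0 by (simp add: zeta_reg_def algebra_simps)
    finally show "?f s = ?g s" .
  qed (use s in auto)
qed

text \<open>This makes it possible to choose points and vertical lines free of zeros.\<close>

lemma countable_zeta_reg_zeros: "countable {s. zeta_reg s = 0}"
proof (cases "zeta_reg constant_on UNIV")
  case True
  then obtain c where c: "\<And>s. zeta_reg s = c" by (auto simp: constant_on_def)
  have "c = 1" using c[of 1] by (simp add: zeta_reg_def)
  hence "{s. zeta_reg s = 0} = {}" using c by simp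
  thus ?thesis by (metis countable_empty)
next
  case False
  from holomorphic_countable_zeros[OF zeta_reg_holomorphic open_UNIV connected_UNIV fsigma_UNIV this]
  show ?thesis by simp
qed

text \<open>
  Multiplying the functional equation at \<open>s\<close> by the one at \<open>1 - s\<close> cancels the zeta factors.  The
  resulting identity shows that \<^const>\<open>cauchy_mellin\<close> has no zeros, without evaluating it.
\<close>

lemma cauchy_mellin_mult:
  assumes s: "0 < Re s" "Re s < 1"
  shows "Gamma (s + 1) * Gamma (2 - s) = 4 * of_real (2 * pi) powr (s - 1) * of_real (2 * pi) powr (- s)
      * s * (1 - s) * cauchy_mellin s * cauchy_mellin (1 - s)"
proof -
  let ?S = "{s. Re s \<in> {0<..<1}}" and ?Z = "{s. zeta_reg s * zeta_reg (1 - s) = 0}"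
  let ?f = "\<lambda>s. Gamma (s + 1) * Gamma (2 - s)"
  let ?g = "\<lambda>s. 4 * of_real (2 * pi) powr (s - 1) * of_real (2 * pi) powr (- s) * s * (1 - s) * cauchy_mellin s * cauchy_mellin (1 - s)"
  have S: "?S = {s. Re s > 0} \<inter> {s. Re s < 1}" by auto
  have S': "open ?S" "connected ?S" unfolding S
    by (auto intro!: open_Int open_halfspace_Re_gt open_halfspace_Re_lt convex_connected convex_Int convex_halfspace_Re_gt convex_halfspace_Re_lt)
  have refl: "(h \<circ> (\<lambda>s. b - s)) holomorphic_on ?S" if "h holomorphic_on A" "\<And>s. s \<in> ?S \<Longrightarrow> b - s \<in> A" for h A b
    by (rule holomorphic_on_compose_gen[OF _ that(1)]) (use that in \<open>auto intro!: holomorphic_intros\<close>)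
  have zr: "(\<lambda>s. zeta_reg (1 - s)) holomorphic_on A" for A
  proof -
    have "zeta_reg \<circ> (\<lambda>s. 1 - s) holomorphic_on A"
      by (rule holomorphic_on_compose_gen[OF _ zeta_reg_holomorphic[of UNIV]]) (auto intro!: holomorphic_intros)
    thus ?thesis by (simp add: o_def)
  qed
  have Gh: "Gamma holomorphic_on {s. Re s > 0}"
    by (rule holomorphic_Gamma) (auto dest!: nonpos_Ints_Re_le)
  \<comment> \<open>The zeta factors can be cancelled only off their zeros; continuation from that
    open subset recovers the whole strip.\<close>
  show ?thesis
  proof (rule analytic_continuation_open[where s = "?S - ?Z" and s' = ?S and f = ?f and g = ?g])
    have "continuous_on ?S (\<lambda>s. zeta_reg s * zeta_reg (1 - s))"
      by (intro holomorphic_on_imp_continuous_on holomorphic_intros zeta_reg_holomorphic zr)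
    from continuous_open_preimage[OF this S'(1), of "- {0}"]
    have "open (?S \<inter> (\<lambda>s. zeta_reg s * zeta_reg (1 - s)) -` (- {0}))" by auto
    moreover have "?S \<inter> (\<lambda>s. zeta_reg s * zeta_reg (1 - s)) -` (- {0}) = ?S - ?Z" by auto
    ultimately show "open (?S - ?Z)" by simp
    show "?S - ?Z \<noteq> {}"
    proof -
      have cnt: "countable (Re ` {s. zeta_reg s = 0} \<union> (\<lambda>s. 1 - Re s) ` {s. zeta_reg s = 0})"
        using countable_zeta_reg_zeros by simp
      obtain x where x: "0 < x" "x < 1" "x \<notin> Re ` {s. zeta_reg s = 0} \<union> (\<lambda>s. 1 - Re s) ` {s. zeta_reg s = 0}"
        using real_interval_avoid_countable_set[OF zero_less_one cnt] by auto
      have "zeta_reg (of_real x) \<noteq> 0" using x(3) by (auto simp: image_iff)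
      moreover have "zeta_reg (1 - of_real x) \<noteq> 0"
      proof
        assume "zeta_reg (1 - of_real x) = 0"
        hence "1 - Re (1 - of_real x) \<in> (\<lambda>s. 1 - Re s) ` {s. zeta_reg s = 0}" by blast
        thus False using x(3) by simp
      qed
      ultimately have "complex_of_real x \<in> ?S - ?Z" using x by simp
      thus ?thesis by blast
    qed
    have "Gamma \<circ> (\<lambda>s. s + 1) holomorphic_on ?S"
      by (rule holomorphic_on_compose_gen[OF _ Gh]) (auto intro!: holomorphic_intros)
    moreover have "Gamma \<circ> (\<lambda>s. 2 - s) holomorphic_on ?S" by (rule refl[OF Gh]) auto
    ultimately show "?f holomorphic_on ?S" by (intro holomorphic_intros) (auto simp: o_def dest!: nonpos_Ints_Re_le)
    have "cauchy_mellin \<circ> (\<lambda>s. 1 - s) holomorphic_on ?S" by (rule refl[OF cauchy_mellin_holomorphic]) auto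
    moreover have "cauchy_mellin holomorphic_on ?S" by (rule holomorphic_on_subset[OF cauchy_mellin_holomorphic]) auto
    ultimately show "?g holomorphic_on ?S" by (intro holomorphic_intros) (auto simp: o_def)
    fix s assume s: "s \<in> ?S - ?Z"
    have "Gamma (s + 1) * zeta_reg s * (Gamma ((1 - s) + 1) * zeta_reg (1 - s)) =
       (2 * of_real (2 * pi) powr (s - 1) * (1 - s) * cauchy_mellin s * zeta_reg (1 - s)) *
       (2 * of_real (2 * pi) powr ((1 - s) - 1) * (1 - (1 - s)) * cauchy_mellin (1 - s) * zeta_reg (1 - (1 - s)))"
      using s zeta_reg_functional_equation[of s] zeta_reg_functional_equation[of "1 - s"] by simp
    moreover have "(1 - s) + 1 = 2 - s" "(1 - s) - 1 = - s" "1 - (1 - s) = s" by simp_all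
    ultimately have "?f s * (zeta_reg s * zeta_reg (1 - s)) = ?g s * (zeta_reg s * zeta_reg (1 - s))"
      by (simp only: mult_ac) (simp add: mult_ac)
    thus "?f s = ?g s" using s by simp
  qed (use s S' in auto)
qed

text \<open>Gamma has no zeros, so \<open>cauchy_mellin_mult\<close> makes
  \<open>cauchy_mellin s\<close> nonzero, and the functional equation hands the zero over to 1 -
  s.\<close>

lemma zeta_zero_reflect:
  assumes "riemann_zeta s = 0" "0 < Re s" "Re s < 1"
  shows "riemann_zeta (1 - s) = 0"
proof -
  have s: "s \<noteq> 0" "s \<noteq> 1" using assms by auto
  have "Gamma (s + 1) * Gamma (2 - s) \<noteq> 0"
    using assms by (auto simp: Gamma_eq_zero_iff dest!: nonpos_Ints_Re_le)
  hence "cauchy_mellin s \<noteq> 0" using cauchy_mellin_mult[OF assms(2,3)] by auto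
  moreover have "zeta_reg s = 0" using assms s by (simp add: zeta_reg_def)
  ultimately have "zeta_reg (1 - s) = 0"
    using zeta_reg_functional_equation[of s] assms s by auto
  thus ?thesis using s by (simp add: zeta_reg_def)
qed

subsection \<open>The criteria\<close>

lemma Re_euler_mascheroni [simp]: "Re euler_mascheroni = euler_mascheroni"
  by (metis Re_complex_of_real of_real_euler_mascheroni)

lemma riemann_hypothesis_imp_nonzero:
  assumes RH: riemann_hypothesis and s: "Re s > 1 / 2"
  shows "zeta_reg s \<noteq> 0"
proof (cases "Re s \<ge> 1")
  case True
  thus ?thesis by (rule zeta_reg_nonzero_Re_ge_1)
next
  case False
  hence "s \<noteq> 1" by auto
  thus ?thesis using RH s False by (auto simp: riemann_hypothesis_def zeta_reg_def)
qed

lemma half_plane_value_inverse: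
  assumes "F field_differentiable at z" "F z \<noteq> 0"
  shows "half_plane_value l a (\<lambda>s. 1 / F s) z = - half_plane_value l a F z"
proof -
  have "((\<lambda>s. 1 / F s) has_field_derivative - deriv F z / (F z)\<^sup>2) (at z)"
    using assms by (auto intro!: derivative_eq_intros DERIV_deriv_iff_field_differentiable[THEN iffD2]
       simp: power2_eq_square)
  hence "deriv (\<lambda>s. 1 / F s) z / (1 / F z) = - (deriv F z / F z)"
    using assms by (simp add: DERIV_imp_deriv power2_eq_square)
  thus ?thesis using assms by (simp add: half_plane_value_def norm_divide ln_div algebra_simps)
qed

lemma zeta_half_plane_integral_eq:
  assumes RH: riemann_hypothesis and \<sigma>: "\<sigma> > 1 / 2" and a: "a > 0" and l: "0 \<le> l" "l \<le> 1"
  shows "half_plane_mean l a \<sigma> zeta_reg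
     = half_plane_value l a zeta_reg (of_real (\<sigma> + a))"
proof (rule antisym)
  have nz: "zeta_reg s \<noteq> 0" if "Re s \<ge> \<sigma>" for s
    by (rule riemann_hypothesis_imp_nonzero[OF RH]) (use that \<sigma> in simp)
  obtain C where C: "\<And>s. Re s \<ge> 1 / 2 \<Longrightarrow> norm (zeta_reg s) \<le> C * (1 + norm s) ^ 2"
    using zeta_reg_bound by blast
  show "half_plane_value l a zeta_reg (of_real (\<sigma> + a)) \<le>
      half_plane_mean l a \<sigma> zeta_reg"
    by (rule half_plane_jensen(2)[OF zeta_reg_holomorphic[of UNIV] open_UNIV UNIV_I a l, where C = C and k = 2])
       (use nz C \<sigma> in auto)
  \<comment> \<open>The bound for the reciprocal is uniform only at a positive distance from the
    critical line, which is where \<sigma> > 1 / 2 enters.\<close>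
  have "\<exists>C k. \<forall>s. Re s \<ge> \<sigma> \<longrightarrow> norm (1 / zeta_reg s) \<le> C * (1 + norm s) ^ k"
    by (rule zeta_reg_lower_bound[OF riemann_hypothesis_imp_nonzero[OF RH] \<sigma>])
  then obtain D k where D: "\<And>s. Re s \<ge> \<sigma> \<Longrightarrow> norm (1 / zeta_reg s) \<le> D * (1 + norm s) ^ k" by blast
  have hol: "(\<lambda>s. 1 / zeta_reg s) holomorphic_on {s. Re s > 1 / 2}"
    using riemann_hypothesis_imp_nonzero[OF RH] by (intro holomorphic_intros zeta_reg_holomorphic) auto
  have "half_plane_value l a (\<lambda>s. 1 / zeta_reg s) (of_real (\<sigma> + a)) \<le>
      (LBINT t. ln (norm (1 / zeta_reg (Complex \<sigma> t))) * half_plane_kernel l a t)"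
    by (rule half_plane_jensen(2)[OF hol open_Re_gt _ a l, where C = D and k = k])
       (use nz D \<sigma> in auto)
  also have "half_plane_value l a (\<lambda>s. 1 / zeta_reg s) (of_real (\<sigma> + a)) =
      - half_plane_value l a zeta_reg (of_real (\<sigma> + a))"
    by (rule half_plane_value_inverse)
       (use nz[of "of_real (\<sigma> + a)"] a zeta_reg_holomorphic[of UNIV] holomorphic_on_imp_differentiable_at in auto)
  also have "(\<lambda>t. ln (norm (1 / zeta_reg (Complex \<sigma> t))) * half_plane_kernel l a t) =
      (\<lambda>t. - (ln (norm (zeta_reg (Complex \<sigma> t))) * half_plane_kernel l a t))"
    using nz by (auto simp: norm_divide ln_div)
  finally show "half_plane_mean l a \<sigma> zeta_reg
     \<le> half_plane_value l a zeta_reg (of_real (\<sigma> + a))" by simp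
qed

text \<open>The line is placed strictly between 1/2 and the zero, off the real parts of all zeros,
  since \<open>half_plane_jensen\<close> wants a zero-free edge. Taking a = 1 - \<sigma> puts the
  centre at 1, to the left of which all zeros lie. One \<sigma> serves every
  \<open>l\<close>.\<close>

lemma zeta_half_plane_integral_gt:
  assumes "\<not> riemann_hypothesis"
  shows "\<exists>\<sigma>. 1 / 2 < \<sigma> \<and> \<sigma> < 1 \<and> (\<forall>l. 0 \<le> l \<and> l \<le> 1 \<longrightarrow> half_plane_value l (1 - \<sigma>) zeta_reg 1 <
     half_plane_mean l (1 - \<sigma>) \<sigma> zeta_reg)"
proof -
  obtain s where s: "riemann_zeta s = 0" "0 < Re s" "Re s < 1" "Re s \<noteq> 1 / 2"
    using assms by (auto simp: riemann_hypothesis_def)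
  define s0 where "s0 = (if Re s > 1 / 2 then s else 1 - s)"
  have s0: "riemann_zeta s0 = 0" "1 / 2 < Re s0" "Re s0 < 1"
    using s zeta_zero_reflect[of s] by (auto simp: s0_def)
  have z0: "zeta_reg s0 = 0" using s0 by (auto simp: zeta_reg_def)
  have "countable (Re ` {z. zeta_reg z = 0})" using countable_zeta_reg_zeros by simp
  from real_interval_avoid_countable_set[OF s0(2) this]
  obtain \<sigma> where \<sigma>: "1 / 2 < \<sigma>" "\<sigma> < Re s0" "\<sigma> \<notin> Re ` {z. zeta_reg z = 0}" by auto
  obtain C where C: "\<And>s. Re s \<ge> 1 / 2 \<Longrightarrow> norm (zeta_reg s) \<le> C * (1 + norm s) ^ 2"
    using zeta_reg_bound by blast
  have "half_plane_value l (1 - \<sigma>) zeta_reg (of_real (\<sigma> + (1 - \<sigma>))) <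
     half_plane_mean l (1 - \<sigma>) \<sigma> zeta_reg"
    if l: "0 \<le> l" "l \<le> 1" for l
  proof (rule half_plane_jensen(3)[OF zeta_reg_holomorphic[of UNIV] open_UNIV UNIV_I _ l, where C = C and k = 2 and s = s0])
    show "zeta_reg s \<noteq> 0" if "Re s = \<sigma>" for s using \<sigma>(3) that by auto
    show "Re s < \<sigma> + (1 - \<sigma>)" if "zeta_reg s = 0" for s
      using zeta_reg_nonzero_Re_ge_1[of s] that by force
  qed (use \<sigma> s0 z0 C in auto)
  thus ?thesis using \<sigma> s0 by (intro exI[of _ \<sigma>]) auto
qed

context
  fixes \<alpha> a \<sigma> :: real
  assumes \<alpha>: "\<alpha> > 0" "\<alpha> \<noteq> 1 / 2"
  defines "a \<equiv> \<bar>\<alpha> - 1 / 2\<bar>" and "\<sigma> \<equiv> 1 / 2 + \<alpha>"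
begin

text \<open>For \<alpha> < 1/2 the linear factor in the integrand is the mirror image of \<sigma> -
  1 + it in the imaginary axis, which has the same modulus.\<close>

lemma norm_zeta_reg_line: "norm (riemann_zeta (Complex (1/2 + \<alpha>) t) * Complex \<bar>\<alpha> - 1/2\<bar> t) = norm (zeta_reg (Complex \<sigma> t))"
proof -
  have "Complex \<sigma> t \<noteq> 1" using \<alpha> by (auto simp: complex_eq_iff \<sigma>_def)
  hence "norm (zeta_reg (Complex \<sigma> t)) = norm (Complex \<sigma> t - 1) * norm (riemann_zeta (Complex \<sigma> t))"
    by (simp add: zeta_reg_def norm_mult)
  also have "norm (Complex \<sigma> t - 1) = norm (Complex \<bar>\<alpha> - 1/2\<bar> t)"
    by (simp add: cmod_def \<sigma>_def power2_abs)
  finally show ?thesis by (simp add: norm_mult \<sigma>_def mult.commute)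
qed

lemma phi1_eq: "phi1 \<alpha> = half_plane_mean 0 a \<sigma> zeta_reg"
proof -
  let ?u = "\<lambda>t. ln (norm (zeta_reg (Complex \<sigma> t)))"
  have a2: "a\<^sup>2 = (1/2 - \<alpha>)\<^sup>2" by (simp add: a_def power2_commute)
  have "phi1 \<alpha> = a / pi * (LBINT t. ?u t / (a\<^sup>2 + t\<^sup>2))"
    unfolding phi1_def norm_zeta_reg_line a2 unfolding a_def ..
  also have "\<dots> = (LBINT t. a / pi * (?u t / (a\<^sup>2 + t\<^sup>2)))"
    by (rule integral_mult_right_zero[symmetric])
  also have "(\<lambda>t. a / pi * (?u t / (a\<^sup>2 + t\<^sup>2))) =
      (\<lambda>t. ?u t * half_plane_kernel 0 a t)"
    by (simp add: half_plane_kernel_def mult.commute)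
  finally show ?thesis .
qed

lemma phi2_eq: "2 * a\<^sup>2 * phi2 \<alpha> = half_plane_mean 1 a \<sigma> zeta_reg"
proof -
  let ?u = "\<lambda>t. ln (norm (zeta_reg (Complex \<sigma> t)))"
  have a2: "a\<^sup>2 = (1/2 - \<alpha>)\<^sup>2" by (simp add: a_def power2_commute)
  have "phi2 \<alpha> = a / pi * (LBINT t. ?u t / (a\<^sup>2 + t\<^sup>2)\<^sup>2)"
    unfolding phi2_def norm_zeta_reg_line a2 unfolding a_def ..
  hence "2 * a\<^sup>2 * phi2 \<alpha> = 2 * a\<^sup>2 * (a / pi) * (LBINT t. ?u t / (a\<^sup>2 + t\<^sup>2)\<^sup>2)"
    by (simp only: mult.assoc)
  also have "\<dots> = (LBINT t. 2 * a\<^sup>2 * (a / pi) * (?u t / (a\<^sup>2 + t\<^sup>2)\<^sup>2))"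
    by (rule integral_mult_right_zero[symmetric])
  also have "(\<lambda>t. 2 * a\<^sup>2 * (a / pi) * (?u t / (a\<^sup>2 + t\<^sup>2)\<^sup>2)) =
      (\<lambda>t. ?u t * half_plane_kernel 1 a t)"
    by (simp add: half_plane_kernel_def power2_eq_square mult_ac)
  finally show ?thesis .
qed

text \<open>The absolute value in \<open>a\<close> produces the two branches of (A) and (B): the
  centre \<sigma> + a is 1 on one side and 2 \<alpha> on the other, where the factor s - 1 adds 1 /
  (2 \<alpha> - 1) to the logarithmic derivative of zeta.\<close>

lemma half_plane_value_zeta:
  "half_plane_value l a zeta_reg (of_real (\<sigma> + a)) =
     (if \<alpha> < 1 / 2 then - l * a * euler_mascheroni
      else ln (zeta_real (2 * \<alpha>) * (2 * \<alpha> - 1))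
         - l * a * (zeta_deriv_real (2 * \<alpha>) / zeta_real (2 * \<alpha>) + 1 / (2 * \<alpha> - 1)))"
proof (cases "\<alpha> < 1 / 2")
  case True
  hence "\<sigma> + a = 1" by (simp add: \<sigma>_def a_def)
  hence "half_plane_value l a zeta_reg (of_real (\<sigma> + a)) = half_plane_value l a zeta_reg 1"
    by (simp only: of_real_1)
  also have "\<dots> = - l * a * euler_mascheroni"
    by (simp add: half_plane_value_def deriv_zeta_reg_1 zeta_reg_def)
  finally show ?thesis using True by simp
next
  case False
  hence "\<sigma> + a = 2 * \<alpha>" "2 * \<alpha> > 1" using \<alpha> by (auto simp: \<sigma>_def a_def)
  thus ?thesis using False zeta_reg_real[of "2 * \<alpha>"] by (simp add: half_plane_value_def)
qed

end

theorem theorem1p1: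
  shows
    "(riemann_hypothesis \<longleftrightarrow>
        (\<forall>\<alpha>::real. \<alpha> > 0 \<and> \<alpha> \<noteq> 1/2 \<longrightarrow>
           phi1 \<alpha> = (if \<alpha> < 1/2 then 0 else ln (zeta_real (2*\<alpha>) * (2*\<alpha> - 1)))))
     \<and>
     (riemann_hypothesis \<longleftrightarrow>
        (\<forall>\<alpha>::real. \<alpha> > 0 \<and> \<alpha> \<noteq> 1/2 \<longrightarrow>
           phi2 \<alpha> =
             (if \<alpha> < 1/2 then - euler_mascheroni / (2 * (1/2 - \<alpha>))
              else - 1 / (2*\<alpha> - 1) *
                     (zeta_deriv_real (2*\<alpha>) / zeta_real (2*\<alpha>) + 1 / (2*\<alpha> - 1))
                   + ln (zeta_real (2*\<alpha>) * (2*\<alpha> - 1)) / (2 * (\<alpha> - 1/2)\<^sup>2))))"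
    (is "(_ \<longleftrightarrow> (\<forall>\<alpha>. _ \<longrightarrow> _ = ?f1 \<alpha>)) \<and> (_ \<longleftrightarrow> (\<forall>\<alpha>. _ \<longrightarrow> _ = ?f2 \<alpha>))")
proof (intro conjI iffI allI impI)
  fix \<alpha> :: real assume RH: riemann_hypothesis and "\<alpha> > 0 \<and> \<alpha> \<noteq> 1 / 2"
  hence \<alpha>: "\<alpha> > 0" "\<alpha> \<noteq> 1 / 2" by auto
  have a: "\<bar>\<alpha> - 1 / 2\<bar> > 0" using \<alpha> by auto
  have eq: "(LBINT t. ln (norm (zeta_reg (Complex (1 / 2 + \<alpha>) t))) * half_plane_kernel l \<bar>\<alpha> - 1 / 2\<bar> t)
     = half_plane_value l \<bar>\<alpha> - 1 / 2\<bar> zeta_reg (of_real (1 / 2 + \<alpha> + \<bar>\<alpha> - 1 / 2\<bar>))" if "0 \<le> l" "l \<le> 1" for l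
    by (rule zeta_half_plane_integral_eq[OF RH _ a that]) (use \<alpha> in simp)
  show "phi1 \<alpha> = ?f1 \<alpha>"
    using eq[of 0] unfolding phi1_eq[OF \<alpha>] half_plane_value_zeta[OF \<alpha>] by simp
  \<comment> \<open>This is (B) multiplied by 2 a^2; the two branches below divide this factor
    out.\<close>
  have p2: "2 * \<bar>\<alpha> - 1 / 2\<bar>\<^sup>2 * phi2 \<alpha> =
     (if \<alpha> < 1 / 2 then - \<bar>\<alpha> - 1 / 2\<bar> * euler_mascheroni
      else ln (zeta_real (2 * \<alpha>) * (2 * \<alpha> - 1))
         - \<bar>\<alpha> - 1 / 2\<bar> * (zeta_deriv_real (2 * \<alpha>) / zeta_real (2 * \<alpha>) + 1 / (2 * \<alpha> - 1)))"
    using eq[of 1] unfolding phi2_eq[OF \<alpha>] half_plane_value_zeta[OF \<alpha>] by simp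
  show "phi2 \<alpha> = ?f2 \<alpha>"
  proof (cases "\<alpha> < 1 / 2")
    case True
    define b where "b = 1 / 2 - \<alpha>"
    have b: "b > 0" "\<bar>\<alpha> - 1 / 2\<bar> = b" using True by (auto simp: b_def)
    have "2 * b\<^sup>2 * phi2 \<alpha> = - b * euler_mascheroni" using p2 True b by simp
    hence "b * (2 * b * phi2 \<alpha> + euler_mascheroni) = 0" by (simp add: algebra_simps power2_eq_square)
    hence "2 * b * phi2 \<alpha> + euler_mascheroni = 0" using b(1) by (metis mult_eq_0_iff less_irrefl)
    hence "phi2 \<alpha> = - euler_mascheroni / (2 * b)" using b(1) by (simp add: field_simps)
    thus ?thesis using True by (simp add: b_def)
  next
    case False
    define b where "b = \<alpha> - 1 / 2"
    have b: "b > 0" "\<bar>\<alpha> - 1 / 2\<bar> = b" "2 * \<alpha> - 1 = 2 * b" using False \<alpha> by (auto simp: b_def)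
    define X where "X = ln (zeta_real (2 * \<alpha>) * (2 * b))"
    define Y where "Y = zeta_deriv_real (2 * \<alpha>) / zeta_real (2 * \<alpha>) + 1 / (2 * b)"
    have "2 * b\<^sup>2 * phi2 \<alpha> = X - b * Y" using p2 False by (simp add: b X_def Y_def)
    hence "phi2 \<alpha> = - 1 / (2 * b) * Y + X / (2 * b\<^sup>2)" using b(1) by (simp add: field_simps power2_eq_square)
    thus ?thesis using False by (simp add: b X_def Y_def flip: b_def)
  qed
next
  assume A: "\<forall>\<alpha>::real. \<alpha> > 0 \<and> \<alpha> \<noteq> 1/2 \<longrightarrow> phi1 \<alpha> = ?f1 \<alpha>"
  show riemann_hypothesis
  proof (rule ccontr)
    assume "\<not> riemann_hypothesis"
    then obtain \<sigma> where \<sigma>: "1 / 2 < \<sigma>" "\<sigma> < 1" "half_plane_value 0 (1 - \<sigma>) zeta_reg 1 <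
       half_plane_mean 0 (1 - \<sigma>) \<sigma> zeta_reg"
      using zeta_half_plane_integral_gt by (metis order_refl zero_le_one)
    \<comment> \<open>\<sigma> < 1 puts \<alpha> below 1/2, so that a = 1 - \<sigma> and the first
      branch of (A) predicts 0.\<close>
    define \<alpha> where "\<alpha> = \<sigma> - 1 / 2"
    have \<alpha>: "\<alpha> > 0" "\<alpha> \<noteq> 1 / 2" "\<alpha> < 1 / 2" "1 - \<sigma> = \<bar>\<alpha> - 1 / 2\<bar>" "1 / 2 + \<alpha> = \<sigma>"
      using \<sigma> by (auto simp: \<alpha>_def)
    have "phi1 \<alpha> > 0" unfolding phi1_eq[OF \<alpha>(1,2)] using \<sigma>(3) \<alpha>(4,5)
      by (simp add: half_plane_value_def zeta_reg_def)
    thus False using A \<alpha> by auto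
  qed
next
  assume B: "\<forall>\<alpha>::real. \<alpha> > 0 \<and> \<alpha> \<noteq> 1/2 \<longrightarrow> phi2 \<alpha> = ?f2 \<alpha>"
  show riemann_hypothesis
  proof (rule ccontr)
    assume "\<not> riemann_hypothesis"
    then obtain \<sigma> where \<sigma>: "1 / 2 < \<sigma>" "\<sigma> < 1" "half_plane_value 1 (1 - \<sigma>) zeta_reg 1 <
       half_plane_mean 1 (1 - \<sigma>) \<sigma> zeta_reg"
      using zeta_half_plane_integral_gt by (metis order_refl zero_le_one)
    define \<alpha> where "\<alpha> = \<sigma> - 1 / 2"
    have \<alpha>: "\<alpha> > 0" "\<alpha> \<noteq> 1 / 2" "\<alpha> < 1 / 2" "1 - \<sigma> = \<bar>\<alpha> - 1 / 2\<bar>" "1 / 2 + \<alpha> = \<sigma>"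
      using \<sigma> by (auto simp: \<alpha>_def)
    define b where "b = 1 / 2 - \<alpha>"
    have b: "b > 0" "1 - \<sigma> = b" "\<bar>\<alpha> - 1 / 2\<bar> = b" using \<alpha> by (auto simp: b_def)
    \<comment> \<open>The first branch of (B), multiplied by 2 b^2, is exactly the right side here,
      so strictness is the contradiction.\<close>
    have "2 * b\<^sup>2 * phi2 \<alpha> > - b * euler_mascheroni"
      using phi2_eq[OF \<alpha>(1,2)] \<sigma>(3) \<alpha>(5) unfolding b
      by (simp add: half_plane_value_def zeta_reg_def deriv_zeta_reg_1)
    moreover have "phi2 \<alpha> = - euler_mascheroni / (2 * b)" using B \<alpha> by (simp add: b_def)
    ultimately show False using b(1) by (simp add: power2_eq_square)
  qed
qed

end
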